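(* Suppose that $G$ is an irreducible finite Coxeter group of rank $\ge3$ which is not of type $A$ or $B$, acting on the complexification $V$ of its reflection representation. Then every Dunkl system with the reflection hyperplanes of $G$ as its polar arrangement is $G$-invariant.
   Context: Let $\mathcal H$ be the set of (complexified) reflection hyperplanes of $G$ in $V$ and $V^\circ=V\setminus\bigcup_{H\in\mathcal H}H$. A Dunkl system with polar arrangement $\mathcal H$ is given by a positive definite hermitian inner product on $V$ and nonzero complex numbers $\kappa_H$ ($H\in\mathcal H$) such that the connection $\nabla^0-\sum_{H\in\mathcal H}\omega_H\otimes\kappa_H\pi_H$ on the tangent bundle of $V^\circ$ is flat, where $\nabla^0$ is the translation invariant connection, $\omega_H=\phi_H^{-1}d\phi_H$ with $\phi_H$ a linear equation of $H$, and $\pi_H$ is the projection with kernel $H$ that is orthogonal for the inner product. The system is $G$-invariant if the inner product is $G$-invariant and $\kappa_{gH}=\kappa_H$ for all $g\in G$, $H\in\mathcal H$. *)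

theory Defs
  imports "HOL-Analysis.Analysis" "HOL-Algebra.Group"
begin

section \<open>Coxeter groups and their reflection representation\<close>

text \<open>
  The entry 0 of a Coxeter matrix stands for infinity.
\<close>

definition coxeter_matrix :: "('n \<Rightarrow> 'n \<Rightarrow> nat) \<Rightarrow> bool" where
  "coxeter_matrix m \<longleftrightarrow>
     (\<forall>i. m i i = 1) \<and> (\<forall>i j. m i j = m j i) \<and> (\<forall>i j. i \<noteq> j \<longrightarrow> m i j \<noteq> 1)"

text \<open>
  The congruence on words generated by \<open>(s\<^sub>i s\<^sub>j)\<^bsup>m i j\<^esup> = 1\<close>. Words in the generators alone suffice
  for a group presentation, because \<open>m i i = 1\<close> makes every generator its own inverse.
\<close>

inductive coxeter_cong :: "('n \<Rightarrow> 'n \<Rightarrow> nat) \<Rightarrow> 'n list \<Rightarrow> 'n list \<Rightarrow> bool"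
  for m :: "'n \<Rightarrow> 'n \<Rightarrow> nat" where
  cox_rel: "m i j \<noteq> 0 \<Longrightarrow> coxeter_cong m (u @ concat (replicate (m i j) [i, j]) @ v) (u @ v)"
| cox_refl: "coxeter_cong m w w"
| cox_sym: "coxeter_cong m u v \<Longrightarrow> coxeter_cong m v u"
| cox_trans: "coxeter_cong m u v \<Longrightarrow> coxeter_cong m v w \<Longrightarrow> coxeter_cong m u w"

definition word_prod :: "('a, 'b) monoid_scheme \<Rightarrow> ('n \<Rightarrow> 'a) \<Rightarrow> 'n list \<Rightarrow> 'a" where
  "word_prod G s w = foldr (\<lambda>i x. s i \<otimes>\<^bsub>G\<^esub> x) w \<one>\<^bsub>G\<^esub>"

text \<open>
  \<open>G\<close> is presented by the generators \<open>s i\<close> and the relations \<open>(s\<^sub>i s\<^sub>j)\<^bsup>m i j\<^esup> = 1\<close>.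
\<close>

definition coxeter_system ::
  "('a, 'b) monoid_scheme \<Rightarrow> ('n \<Rightarrow> 'a) \<Rightarrow> ('n \<Rightarrow> 'n \<Rightarrow> nat) \<Rightarrow> bool" where
  "coxeter_system G s m \<longleftrightarrow>
     group G \<and> coxeter_matrix m \<and> range s \<subseteq> carrier G \<and>
     (\<forall>g\<in>carrier G. \<exists>w. g = word_prod G s w) \<and>
     (\<forall>u v. word_prod G s u = word_prod G s v \<longleftrightarrow> coxeter_cong m u v)"

text \<open>Connectedness of the Coxeter graph.\<close>

definition coxeter_irreducible :: "('n \<Rightarrow> 'n \<Rightarrow> nat) \<Rightarrow> bool" where
  "coxeter_irreducible m \<longleftrightarrow> (\<forall>i j. (i, j) \<in> {(k, l). k \<noteq> l \<and> m k l \<noteq> 2}\<^sup>*)"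

text \<open>
  The Coxeter matrices of \<open>A\<^sub>n\<close> and \<open>B\<^sub>n\<close> are the restrictions of the following ones to
  \<open>{..<n}\<close>; the double bond of \<open>B\<^sub>n\<close> joins the nodes 0 and 1.
\<close>

definition cox_A :: "nat \<Rightarrow> nat \<Rightarrow> nat" where
  "cox_A i j = (if i = j then 1 else if j = Suc i \<or> i = Suc j then 3 else 2)"

definition cox_B :: "nat \<Rightarrow> nat \<Rightarrow> nat" where
  "cox_B i j = (if {i, j} = {0, 1} then 4 else cox_A i j)"

definition of_coxeter_type ::
  "('n::finite \<Rightarrow> 'n \<Rightarrow> nat) \<Rightarrow> (nat \<Rightarrow> nat \<Rightarrow> nat) \<Rightarrow> bool" where
  "of_coxeter_type m M \<longleftrightarrow>
     (\<exists>f. bij_betw f (UNIV :: 'n set) {..<CARD('n)} \<and> (\<forall>i j. m i j = M (f i) (f j)))"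

text \<open>
  Since \<open>pi / 0 = 0\<close>, the form takes the customary value \<open>-1\<close> on a pair of basis vectors
  with \<open>m i j\<close> infinite.
\<close>

definition coxeter_form :: "('n::finite \<Rightarrow> 'n \<Rightarrow> nat) \<Rightarrow> real ^ 'n \<Rightarrow> real ^ 'n \<Rightarrow> real" where
  "coxeter_form m x y = (\<Sum>i\<in>UNIV. \<Sum>j\<in>UNIV. - cos (pi / real (m i j)) * (x $ i) * (y $ j))"

definition reflection_representation ::
  "('a, 'b) monoid_scheme \<Rightarrow> ('n::finite \<Rightarrow> 'a) \<Rightarrow> ('n \<Rightarrow> 'n \<Rightarrow> nat) \<Rightarrow>
   ('a \<Rightarrow> real ^ 'n \<Rightarrow> real ^ 'n) \<Rightarrow> bool" where
  "reflection_representation G s m \<rho> \<longleftrightarrow>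
     (\<forall>g\<in>carrier G. linear (\<rho> g)) \<and>
     \<rho> \<one>\<^bsub>G\<^esub> = id \<and>
     (\<forall>g\<in>carrier G. \<forall>h\<in>carrier G. \<rho> (g \<otimes>\<^bsub>G\<^esub> h) = \<rho> g \<circ> \<rho> h) \<and>
     (\<forall>i x. \<rho> (s i) x = x - (2 * coxeter_form m (axis i 1) x) *\<^sub>R axis i 1)"

definition is_reflection :: "(real ^ 'n::finite \<Rightarrow> real ^ 'n) \<Rightarrow> bool" where
  "is_reflection f \<longleftrightarrow> linear f \<and> f \<circ> f = id \<and> dim {x. f x = x} = CARD('n) - 1"


section \<open>Complexification\<close>

definition vec_Re :: "complex ^ 'n \<Rightarrow> real ^ 'n" where
  "vec_Re z = (\<chi> i. Re (z $ i))"

definition vec_Im :: "complex ^ 'n \<Rightarrow> real ^ 'n" where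
  "vec_Im z = (\<chi> i. Im (z $ i))"

definition complexify_set :: "(real ^ 'n) set \<Rightarrow> (complex ^ 'n) set" where
  "complexify_set H = {z. vec_Re z \<in> H \<and> vec_Im z \<in> H}"

definition complexify_map :: "(real ^ 'n \<Rightarrow> real ^ 'n) \<Rightarrow> complex ^ 'n \<Rightarrow> complex ^ 'n" where
  "complexify_map f z = (\<chi> i. Complex (f (vec_Re z) $ i) (f (vec_Im z) $ i))"

definition reflection_hyperplanes ::
  "('a, 'b) monoid_scheme \<Rightarrow> ('a \<Rightarrow> real ^ 'n::finite \<Rightarrow> real ^ 'n) \<Rightarrow> (complex ^ 'n) set set" where
  "reflection_hyperplanes G \<rho> =
     {complexify_set {x. \<rho> g x = x} | g. g \<in> carrier G \<and> is_reflection (\<rho> g)}"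


section \<open>Dunkl systems\<close>

definition pos_def_hermitian :: "(complex ^ 'n \<Rightarrow> complex ^ 'n \<Rightarrow> complex) \<Rightarrow> bool" where
  "pos_def_hermitian ip \<longleftrightarrow>
     (\<forall>x y z. ip (x + y) z = ip x z + ip y z) \<and>
     (\<forall>c x y. ip (c *s x) y = c * ip x y) \<and>
     (\<forall>x y. ip y x = cnj (ip x y)) \<and>
     (\<forall>x. x \<noteq> 0 \<longrightarrow> Re (ip x x) > 0)"

definition linear_equation :: "(complex ^ 'n) set \<Rightarrow> (complex ^ 'n \<Rightarrow> complex) \<Rightarrow> bool" where
  "linear_equation H \<phi> \<longleftrightarrow>
     Vector_Spaces.linear vector_scalar_mult times \<phi> \<and> {z. \<phi> z = 0} = H"

text \<open>
  The value at the point \<open>z\<close> and the tangent vector \<open>v\<close> of the form \<open>d\<phi> / \<phi>\<close>, with \<open>\<phi>\<close> a linear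
  equation of \<open>H\<close>. It does not depend on the choice of \<open>\<phi>\<close>, which is unique up to a nonzero
  factor, and \<open>d\<phi>\<close> is \<open>\<phi>\<close> itself at every point.
\<close>

definition omega :: "(complex ^ 'n) set \<Rightarrow> complex ^ 'n \<Rightarrow> complex ^ 'n \<Rightarrow> complex" where
  "omega H z v = (let \<phi> = (SOME \<phi>. linear_equation H \<phi>) in \<phi> v / \<phi> z)"

definition orth_proj ::
  "(complex ^ 'n \<Rightarrow> complex ^ 'n \<Rightarrow> complex) \<Rightarrow> (complex ^ 'n) set \<Rightarrow>
   complex ^ 'n \<Rightarrow> complex ^ 'n" where
  "orth_proj ip H =
     (THE p. Vector_Spaces.linear vector_scalar_mult vector_scalar_mult p \<and> p \<circ> p = p \<and>
             {z. p z = 0} = H \<and> (\<forall>z. \<forall>w\<in>H. ip (p z) w = 0))"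

definition arr_complement :: "(complex ^ 'n) set set \<Rightarrow> (complex ^ 'n) set" where
  "arr_complement \<H> = UNIV - \<Union>\<H>"

text \<open>
  The tangent bundle of an open subset of \<open>V\<close> is trivialized by translations, so that vector
  fields are \<open>V\<close>-valued functions and the translation invariant connection is
  differentiation. A vector field is holomorphic if its derivatives are complex linear.
\<close>

definition holomorphic_field ::
  "(complex ^ 'n::finite) set \<Rightarrow> (complex ^ 'n \<Rightarrow> complex ^ 'n) \<Rightarrow> bool" where
  "holomorphic_field U X \<longleftrightarrow>
     (\<forall>z\<in>U. \<exists>D. (X has_derivative D) (at z) \<and> (\<forall>c v. D (c *s v) = c *s D v))"

definition lie_bracket ::
  "(complex ^ 'n::finite \<Rightarrow> complex ^ 'n) \<Rightarrow> (complex ^ 'n \<Rightarrow> complex ^ 'n) \<Rightarrow>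
   complex ^ 'n \<Rightarrow> complex ^ 'n" where
  "lie_bracket X Y z =
     frechet_derivative Y (at z) (X z) - frechet_derivative X (at z) (Y z)"

text \<open>The covariant derivative of \<open>Y\<close> along \<open>X\<close>.\<close>

definition dunkl_nabla ::
  "(complex ^ 'n::finite) set set \<Rightarrow> (complex ^ 'n \<Rightarrow> complex ^ 'n \<Rightarrow> complex) \<Rightarrow>
   ((complex ^ 'n) set \<Rightarrow> complex) \<Rightarrow> (complex ^ 'n \<Rightarrow> complex ^ 'n) \<Rightarrow>
   (complex ^ 'n \<Rightarrow> complex ^ 'n) \<Rightarrow> complex ^ 'n \<Rightarrow> complex ^ 'n" where
  "dunkl_nabla \<H> ip \<kappa> X Y z =
     frechet_derivative Y (at z) (X z) -
     (\<Sum>H\<in>\<H>. omega H z (X z) *s (\<kappa> H *s orth_proj ip H (Y z)))"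

text \<open>Flatness is the vanishing of the curvature on the complement of the arrangement.\<close>

definition dunkl_flat ::
  "(complex ^ 'n::finite) set set \<Rightarrow> (complex ^ 'n \<Rightarrow> complex ^ 'n \<Rightarrow> complex) \<Rightarrow>
   ((complex ^ 'n) set \<Rightarrow> complex) \<Rightarrow> bool" where
  "dunkl_flat \<H> ip \<kappa> \<longleftrightarrow>
     (let nab = dunkl_nabla \<H> ip \<kappa>; U = arr_complement \<H> in
      \<forall>X Y Z. holomorphic_field U X \<longrightarrow> holomorphic_field U Y \<longrightarrow> holomorphic_field U Z \<longrightarrow>
        (\<forall>z\<in>U. nab X (nab Y Z) z - nab Y (nab X Z) z - nab (lie_bracket X Y) Z z = 0))"

text \<open>Only the values of \<open>\<kappa>\<close> on members of \<open>\<H>\<close> matter.\<close>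

definition dunkl_system ::
  "(complex ^ 'n::finite) set set \<Rightarrow> (complex ^ 'n \<Rightarrow> complex ^ 'n \<Rightarrow> complex) \<Rightarrow>
   ((complex ^ 'n) set \<Rightarrow> complex) \<Rightarrow> bool" where
  "dunkl_system \<H> ip \<kappa> \<longleftrightarrow>
     pos_def_hermitian ip \<and> (\<forall>H\<in>\<H>. \<kappa> H \<noteq> 0) \<and> dunkl_flat \<H> ip \<kappa>"

definition dunkl_invariant ::
  "('a, 'b) monoid_scheme \<Rightarrow> ('a \<Rightarrow> complex ^ 'n \<Rightarrow> complex ^ 'n) \<Rightarrow> (complex ^ 'n::finite) set set \<Rightarrow>
   (complex ^ 'n \<Rightarrow> complex ^ 'n \<Rightarrow> complex) \<Rightarrow> ((complex ^ 'n) set \<Rightarrow> complex) \<Rightarrow> bool" where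
  "dunkl_invariant G act \<H> ip \<kappa> \<longleftrightarrow>
     (\<forall>g\<in>carrier G. \<forall>x y. ip (act g x) (act g y) = ip x y) \<and>
     (\<forall>g\<in>carrier G. \<forall>H\<in>\<H>. \<kappa> (act g ` H) = \<kappa> H)"

end

theory Submission
  imports Defs
begin

text \<open>
  Flatness of a Dunkl connection is a condition in codimension two. Taking residues of the
  curvature along the intersection of two mirrors shows (\<open>dunkl_residue\<close>) that, for every
  mirror \<open>H\<^sub>0\<close> through it, the projection of \<open>H\<^sub>0\<close> commutes with the sum of the \<open>\<kappa>\<^sub>H \<pi>\<^sub>H\<close> over the
  other mirrors through it. If there are only two mirrors, their two projections commute, so the
  mirrors are orthogonal for the given inner product.

  The inner product is compared with the Coxeter form \<open>B\<close> through the vector \<open>n\<^sub>x\<close> that represents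
  the linear form \<open>B(x, _)\<close>. Suppose that the roots \<open>\<beta>\<close> for which the plane of \<open>\<alpha>\<^sub>i\<close> and \<open>\<beta>\<close>
  carries no other mirrors span the \<open>B\<close>-orthogonal complement of the simple root \<open>\<alpha>\<^sub>i\<close>. Then
  \<open>\<langle>n\<^sub>x, n\<^sub>i\<rangle> = c\<^sub>i B(\<alpha>\<^sub>i, x)\<close> for all \<open>x\<close>; by hermitian symmetry \<open>c\<^sub>i = c\<^sub>j\<close> for nodes joined by an edge,
  and so the inner product is a multiple of the hermitian extension of \<open>B\<close>
  (\<open>hermitian_multiple\<close>).

  The spanning condition is where types A and B drop out (\<open>strongly_orth_span\<close>). It is invariant
  under conjugation, and it survives the addition of a node along an edge with label 3. It
  therefore suffices to find a subdiagram on which it holds and outside of which all labels are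
  3. A diagram that is neither of type A nor of type B has a branch node, an edge with label 5,
  or an edge with label 4 that does not end in a leaf, and accordingly contains a subdiagram
  \<open>D\<^sub>4\<close>, \<open>H\<^sub>3\<close> or \<open>F\<^sub>4\<close> (\<open>base_subdiagram\<close>); there the condition is checked by hand. No
  classification of the finite Coxeter groups is involved: positive definiteness makes the
  diagram a tree with at most one edge of label greater than 3.

  Once the inner product is known, the relations in codimension two say that \<open>\<kappa>\<close> takes the same
  value on the conjugates \<open>w \<alpha>\<^sub>j\<close> and \<open>w s\<^sub>i \<alpha>\<^sub>j\<close> when the label of \<open>i\<close> and \<open>j\<close> is 3 or 4. For label 5
  they say less, but such an edge has an adjacent edge with label 3, and this suffices
  (\<open>kap_label_5\<close>).

  All this depends on knowing which mirrors contain a given intersection, that is, on the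
  theorem that every root is positive or negative (\<open>root_sign\<close>).
\<close>

section \<open>The Coxeter form and the action of words\<close>

abbreviation e :: "'n::finite \<Rightarrow> real ^ 'n" where "e i \<equiv> axis i 1"

definition reflection :: "('n::finite \<Rightarrow> 'n \<Rightarrow> nat) \<Rightarrow> real ^ 'n \<Rightarrow> real ^ 'n \<Rightarrow> real ^ 'n" where
  "reflection m c x = x - (2 * coxeter_form m c x) *\<^sub>R c"

definition act :: "('n::finite \<Rightarrow> 'n \<Rightarrow> nat) \<Rightarrow> 'n list \<Rightarrow> real ^ 'n \<Rightarrow> real ^ 'n" where
  "act m w x = foldr (\<lambda>i. reflection m (e i)) w x"

lemma act_Nil [simp]: "act m [] x = x"
  by (simp add: act_def)

lemma act_Cons: "act m (i # w) x = reflection m (e i) (act m w x)"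
  by (simp add: act_def)

lemma act_append: "act m (u @ v) x = act m u (act m v x)"
  by (simp add: act_def)

lemma bilinear_coxeter_form: "bilinear (coxeter_form m)"
  unfolding bilinear_def coxeter_form_def
  by (intro conjI allI linearI)
    (simp_all add: algebra_simps sum.distrib sum_distrib_left sum_negf sum_subtractf)

lemmas form_add_left = bilinear_ladd[OF bilinear_coxeter_form]
  and form_add_right = bilinear_radd[OF bilinear_coxeter_form]
  and form_diff_left = bilinear_lsub[OF bilinear_coxeter_form]
  and form_diff_right = bilinear_rsub[OF bilinear_coxeter_form]
  and form_neg_left = bilinear_lneg[OF bilinear_coxeter_form]
  and form_neg_right = bilinear_rneg[OF bilinear_coxeter_form]
  and form_zero_left = bilinear_lzero[OF bilinear_coxeter_form]
  and form_zero_right = bilinear_rzero[OF bilinear_coxeter_form]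

lemma form_scale_left: "coxeter_form m (c *\<^sub>R x) y = c * coxeter_form m x y"
  using bilinear_lmul[OF bilinear_coxeter_form] by simp

lemma form_scale_right: "coxeter_form m x (c *\<^sub>R y) = c * coxeter_form m x y"
  using bilinear_rmul[OF bilinear_coxeter_form] by simp

lemma form_sum_right: "coxeter_form m x (\<Sum>i\<in>A. f i) = (\<Sum>i\<in>A. coxeter_form m x (f i))"
  using linear_sum[of "coxeter_form m x" f A] bilinear_coxeter_form[of m]
  by (simp add: bilinear_def)

lemma form_sum_left: "coxeter_form m (\<Sum>i\<in>A. f i) x = (\<Sum>i\<in>A. coxeter_form m (f i) x)"
  using linear_sum[of "\<lambda>y. coxeter_form m y x" f A] bilinear_coxeter_form[of m]
  by (simp add: bilinear_def)

lemmas form_simps = form_add_left form_add_right form_diff_left form_diff_right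
  form_neg_left form_neg_right form_zero_left form_zero_right form_scale_left form_scale_right

lemma form_axis: "coxeter_form m (e i) (e j) = - cos (pi / real (m i j))"
proof -
  have "(\<Sum>l\<in>UNIV. - cos (pi / real (m k l)) * (e i :: real ^ 'a) $ k * (e j :: real ^ 'a) $ l) =
    (if k = i then - cos (pi / real (m i j)) else 0)" for k :: 'a
    by (simp add: axis_def if_distrib[of "\<lambda>x. _ * x"] cong: if_cong)
  then show ?thesis
    by (simp add: coxeter_form_def)
qed

lemma vec_expand: "(x :: real ^ 'n::finite) = (\<Sum>i\<in>UNIV. (x $ i) *\<^sub>R e i)"
  using basis_expansion[of x] by (simp add: scalar_mult_eq_scaleR)

lemma linear_reflection: "linear (reflection m c)"
  unfolding reflection_def
  by (intro linearI) (simp_all add: form_simps algebra_simps)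

lemma linear_act: "linear (act m w)"
proof (induction w)
  case (Cons i w)
  have "act m (i # w) = reflection m (e i) \<circ> act m w"
    by (simp add: fun_eq_iff act_Cons)
  then show ?case
    using linear_compose[OF Cons linear_reflection[of m "e i"]] by metis
qed (simp add: linear_iff)

lemmas act_simps = linear_add[OF linear_act] linear_diff[OF linear_act]
  linear_neg[OF linear_act] linear_0[OF linear_act] linear_scale[OF linear_act]

section \<open>Positive definite Coxeter forms\<close>

text \<open>
  The group generated by the simple reflections is studied here as the set of the maps
  \<open>act m w\<close>. That the form of a finite group is positive definite is
  \<open>finite_group_form_pos\<close>.
\<close>

locale finite_coxeter =
  fixes m :: "'n::finite \<Rightarrow> 'n \<Rightarrow> nat"
  assumes matrix: "coxeter_matrix m"
    and irreducible: "coxeter_irreducible m"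
    and form_pos: "\<And>x. x \<noteq> 0 \<Longrightarrow> coxeter_form m x x > 0"
    and finite_group: "finite (range (act m))"
begin

abbreviation B :: "real ^ 'n \<Rightarrow> real ^ 'n \<Rightarrow> real" where "B \<equiv> coxeter_form m"

lemma m_sym: "m i j = m j i"
  using matrix by (simp add: coxeter_matrix_def)

lemma m_diag [simp]: "m i i = 1"
  using matrix by (simp add: coxeter_matrix_def)

lemma B_sym: "B x y = B y x"
  unfolding coxeter_form_def
  by (subst sum.swap) (auto simp: m_sym intro!: sum.cong)

lemma B_diag [simp]: "B (e i) (e i) = 1"
  by (simp add: form_axis)

lemma B_nonneg: "B x x \<ge> 0"
  using form_pos[of x] by (cases "x = 0") (auto simp: form_simps)

lemma B_eq_0: "B x x = 0 \<Longrightarrow> x = 0"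
  using form_pos[of x] by fastforce

lemma B_nondegenerate: "(\<And>i. B (e i) x = 0) \<Longrightarrow> x = 0"
proof -
  assume *: "\<And>i. B (e i) x = 0"
  have "B x x = (\<Sum>i\<in>UNIV. (x $ i) * B (e i) x)"
    by (subst (1) vec_expand[of x]) (simp add: form_sum_left form_simps)
  then show "x = 0"
    using * B_eq_0 by simp
qed

lemma m_ge_2: "i \<noteq> j \<Longrightarrow> m i j \<ge> 2"
proof -
  assume ij: "i \<noteq> j"
  have "m i j \<noteq> 0"
  proof
    assume "m i j = 0"
    then have "B (e i + e j) (e i + e j) = 0"
      using B_sym[of "e j" "e i"] by (simp add: form_simps form_axis[of m i j])
    then have "(e i + e j) $ i = (0::real ^ 'n) $ i"
      using B_eq_0 by metis
    then show False
      using ij by (simp add: axis_def)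
  qed
  moreover have "m i j \<noteq> 1"
    using matrix ij by (simp add: coxeter_matrix_def)
  ultimately show ?thesis by simp
qed

lemma B_commuting: "m i j = 2 \<Longrightarrow> B (e i) (e j) = 0"
  by (simp add: form_axis)

lemma B_le_0: "i \<noteq> j \<Longrightarrow> B (e i) (e j) \<le> 0"
proof -
  assume "i \<noteq> j"
  then have "pi / real (m i j) \<le> pi / 2"
    using m_ge_2[of i j] by (intro divide_left_mono) auto
  moreover have "- (pi / 2) \<le> 0" "0 \<le> pi / real (m i j)" by simp_all
  ultimately have "0 \<le> cos (pi / real (m i j))"
    by (intro cos_ge_zero) (linarith, assumption)
  then show ?thesis by (simp add: form_axis)
qed

lemma B_label_mono: "0 < k \<Longrightarrow> k \<le> m i j \<Longrightarrow> B (e i) (e j) \<le> - cos (pi / real k)"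
  by (auto simp: form_axis field_simps intro!: cos_monotone_0_pi_le)

lemma B_label_3: "m i j \<ge> 3 \<Longrightarrow> B (e i) (e j) \<le> - 1 / 2"
  using B_label_mono[of 3 i j] by (simp add: cos_60)

lemma B_label_4: "m i j \<ge> 4 \<Longrightarrow> B (e i) (e j) \<le> - sqrt 2 / 2"
  using B_label_mono[of 4 i j] by (simp add: cos_45)

lemma B_label_6: "m i j \<ge> 6 \<Longrightarrow> B (e i) (e j) \<le> - sqrt 3 / 2"
  using B_label_mono[of 6 i j] by (simp add: cos_30)

lemma B_eq_3: "m i j = 3 \<Longrightarrow> B (e i) (e j) = - 1 / 2"
  by (simp add: form_axis cos_60)

lemma B_eq_4: "m i j = 4 \<Longrightarrow> B (e i) (e j) = - sqrt 2 / 2"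
  by (simp add: form_axis cos_45)

lemma reflection_invariant: "B c c = 1 \<Longrightarrow> B (reflection m c x) (reflection m c y) = B x y"
  using B_sym[of c x] B_sym[of c y] by (simp add: reflection_def form_simps algebra_simps)

lemma reflection_involution [simp]: "B c c = 1 \<Longrightarrow> reflection m c (reflection m c x) = x"
  by (simp add: reflection_def form_simps algebra_simps)

lemma act_invariant: "B (act m w x) (act m w y) = B x y"
  by (induction w) (simp_all add: act_Cons reflection_invariant)

lemma act_rev [simp]: "act m (rev w) (act m w x) = x" "act m w (act m (rev w) x) = x"
  by (induction w arbitrary: x) (simp_all add: act_Cons act_append)

lemma act_adjoint: "B (act m w x) y = B x (act m (rev w) y)"
  using act_invariant[of w x "act m (rev w) y"] by simp

lemma act_inject: "act m w x = act m w y \<Longrightarrow> x = y"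
  by (metis act_rev(1))

lemma act_reflection: "reflection m (act m w c) (act m w x) = act m w (reflection m c x)"
  by (simp add: reflection_def act_invariant act_simps)

end

section \<open>Every root is positive or negative\<close>

context finite_coxeter
begin

lemma det_simple_reflection: "det (matrix (reflection m (e i))) = -1"
proof -
  let ?x = "\<chi> b. (if b = i then 1 else 0) - 2 * B (e i) (e b)"
  have "matrix (reflection m (e i)) =
      (\<chi> a. if a = i then (\<Sum>b\<in>UNIV. (?x $ b) *s row b (mat 1)) else row a (mat 1))"
  proof -
    have "reflection m (e i) (e b) $ a = (if a = i then ?x $ b else mat 1 $ a $ b)" for a b
      by (auto simp: reflection_def axis_def mat_def form_axis)
    moreover have "(\<Sum>b\<in>UNIV. (?x $ b) *s row b (mat 1 :: real ^ 'n ^ 'n)) = ?x"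
      by (simp add: vec_eq_iff row_def mat_def sum_subtractf sum_negf if_distrib[of "\<lambda>x. _ * x"] cong: if_cong)
    ultimately show ?thesis
      by (simp add: vec_eq_iff matrix_def row_def)
  qed
  then have "det (matrix (reflection m (e i))) = ?x $ i * det (mat 1 :: real ^ 'n ^ 'n)"
    using cramer_lemma_transpose[of i ?x "mat 1 :: real ^ 'n ^ 'n"] by simp
  then show ?thesis by simp
qed

lemma det_act: "det (matrix (act m w)) = (- 1) ^ length w"
proof (induction w)
  case Nil
  have "act m [] = id" by (simp add: fun_eq_iff)
  then show ?case by (simp only: matrix_id_mat_1 det_I list.size power_0)
next
  case (Cons i w)
  have "act m (i # w) = reflection m (e i) \<circ> act m w"
    by (simp add: fun_eq_iff act_Cons)
  then have "matrix (act m (i # w)) = matrix (reflection m (e i)) ** matrix (act m w)"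
    using matrix_compose[OF linear_act linear_reflection] by metis
  then show ?case
    using Cons by (simp add: det_mul det_simple_reflection)
qed

lemma parity: "act m u = act m v \<Longrightarrow> even (length u) = even (length v)"
  using det_act[of u] det_act[of v] by (auto simp: minus_one_power_iff split: if_splits)

definition reduced :: "'n list \<Rightarrow> bool" where
  "reduced w \<longleftrightarrow> (\<forall>v. act m v = act m w \<longrightarrow> length w \<le> length v)"

lemma reducedD: "reduced w \<Longrightarrow> act m v = act m w \<Longrightarrow> length w \<le> length v"
  by (simp add: reduced_def)

lemma reduced_exists: "\<exists>v. act m v = act m w \<and> reduced v"
proof -
  obtain v where "act m v = act m w" "\<And>u. act m u = act m w \<Longrightarrow> length v \<le> length u"
    using ex_has_least_nat[of "\<lambda>v. act m v = act m w" w length] by auto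
  then show ?thesis
    by (auto simp: reduced_def)
qed

lemma act_cong: "act m v = act m v' \<Longrightarrow> act m (u @ v @ x) = act m (u @ v' @ x)"
  by (simp add: fun_eq_iff act_append)

lemma act_cancel: "act m (u @ i # i # v) = act m (u @ v)"
  by (simp add: fun_eq_iff act_append act_Cons)

lemma reduced_infix: "reduced (u @ v @ x) \<Longrightarrow> reduced v"
proof -
  assume r: "reduced (u @ v @ x)"
  have "length v \<le> length v'" if "act m v' = act m v" for v'
    using reducedD[OF r act_cong[OF that, of u x]] by simp
  then show ?thesis by (simp add: reduced_def)
qed

lemma not_reduced_cancel: "\<not> reduced (u @ i # i # v)"
  using reducedD[of "u @ i # i # v" "u @ v"] act_cancel[of u i v] by fastforce

lemma reduced_transfer: "reduced v \<Longrightarrow> act m u = act m v \<Longrightarrow> length u = length v \<Longrightarrow> reduced u"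
  by (simp add: reduced_def)

text \<open>
  The last letter of a nonempty alternating word is \<open>t\<close>, so that it remains alternating when
  \<open>s\<close> is appended.
\<close>

fun alternating :: "'n \<Rightarrow> 'n \<Rightarrow> nat \<Rightarrow> 'n list" where
  "alternating s t 0 = []"
| "alternating s t (Suc k) = (if even k then t else s) # alternating s t k"

lemma length_alternating [simp]: "length (alternating s t k) = k"
  by (induction k) auto

lemma alternating_suffix: "j \<le> k \<Longrightarrow> \<exists>u. alternating s t k = u @ alternating s t j"
proof (induction k)
  case (Suc k)
  show ?case
  proof (cases "j = Suc k")
    case False
    then obtain u where "alternating s t k = u @ alternating s t j"
      using Suc by auto
    then show ?thesis
      by (intro exI[of _ "(if even k then t else s) # u"]) simp
  qed auto
qed simp

lemma sin_label_pos: "s \<noteq> t \<Longrightarrow> 0 < sin (pi / real (m s t))"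
  using m_ge_2[of s t] by (intro sin_gt_zero) (auto simp: field_simps)

text \<open>
  The images of the first root under the dihedral group of two simple reflections are found at
  multiples of the angle \<open>\<pi> / m\<close> from each other, so that their coordinates are quotients of sines.
\<close>

lemma act_alternating:
  assumes "s \<noteq> t"
  defines "\<theta> \<equiv> pi / real (m s t)"
  defines "S \<equiv> \<lambda>k. sin (real k * \<theta>) / sin \<theta>"
  shows "act m (alternating s t k) (e s) =
    (if even k then S (Suc k) *\<^sub>R e s + S k *\<^sub>R e t else S k *\<^sub>R e s + S (Suc k) *\<^sub>R e t)"
proof (induction k)
  case 0
  then show ?case
    using sin_label_pos[OF assms(1)] by (simp add: S_def \<theta>_def)
next
  case (Suc k)
  have rec: "S (Suc (Suc k)) = 2 * cos \<theta> * S (Suc k) - S k" for k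
  proof -
    have "sin (real (Suc (Suc k)) * \<theta>) + sin (real k * \<theta>) = 2 * cos \<theta> * sin (real (Suc k) * \<theta>)"
      using sin_add[of "real (Suc k) * \<theta>" \<theta>] sin_diff[of "real (Suc k) * \<theta>" \<theta>]
      by (simp add: algebra_simps)
    then have "sin (real (Suc (Suc k)) * \<theta>) = 2 * cos \<theta> * sin (real (Suc k) * \<theta>) - sin (real k * \<theta>)"
      by linarith
    then show ?thesis
      unfolding S_def by (simp only: diff_divide_distrib times_divide_eq_right)
  qed
  have "B (e s) (e t) = - cos \<theta>" "B (e t) (e s) = - cos \<theta>"
    using B_sym by (simp_all add: form_axis \<theta>_def m_sym)
  moreover have eq: "act m (alternating s t (Suc k)) (e s) = reflection m (e (if even k then t else s))
    (if even k then S (Suc k) *\<^sub>R e s + S k *\<^sub>R e t else S k *\<^sub>R e s + S (Suc k) *\<^sub>R e t)"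
    using Suc by (simp add: act_Cons)
  ultimately show ?case
    unfolding eq by (simp add: rec reflection_def form_simps vec_eq_iff algebra_simps)
qed

text \<open>
  For this word the angles in \<open>act_alternating\<close> are \<open>\<pi>\<close> and \<open>\<pi> - \<pi> / m s t\<close>, so that one of the two
  coordinates is zero and the other one is 1.
\<close>

lemma act_alternating_label:
  assumes "s \<noteq> t"
  shows "act m (alternating s t (m s t - 1)) (e s) = e (if even (m s t - 1) then t else s)"
proof -
  let ?\<theta> = "pi / real (m s t)"
  have m: "m s t \<ge> 2" using m_ge_2[OF assms] .
  then have "real (m s t - 1) * ?\<theta> = pi - ?\<theta>" "real (Suc (m s t - 1)) * ?\<theta> = pi"
    by (auto simp: field_simps of_nat_diff)
  then show ?thesis
    using sin_label_pos[OF assms] by (subst act_alternating[OF assms]) auto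
qed

lemma reduced_alternating_length:
  assumes "s \<noteq> t" "reduced (alternating s t k @ [s])"
  shows "k < m s t"
proof (rule ccontr)
  assume "\<not> k < m s t"
  then obtain u where "alternating s t k = u @ alternating s t (m s t)"
    using alternating_suffix[of "m s t" k s t] by auto
  then have red: "reduced (alternating s t (m s t) @ [s])"
    using assms(2) reduced_infix[of u _ "[]"] by simp
  define n where "n = m s t - 1"
  have n: "m s t = Suc n" using m_ge_2[OF assms(1)] by (simp add: n_def)
  define y where "y = (if even n then t else s)"
  have y: "act m (alternating s t n) (e s) = e y"
    using act_alternating_label[OF assms(1)] by (simp add: n_def y_def)
  \<comment> \<open>The braid relation: the reflection in the image of \<open>e s\<close> is that in \<open>e y\<close>. It makes the
    first two letters of a word of length \<open>m s t + 1\<close> cancel.\<close>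
  have "act m (alternating s t n @ [s]) x = act m (alternating s t (Suc n)) x" for x
    using act_reflection[of "alternating s t n" "e s" x]
    by (simp add: act_append act_Cons y y_def[symmetric])
  then have "act m (alternating s t (m s t) @ [s]) x = act m (alternating s t n) x" for x
    by (simp add: n act_append act_Cons y_def[symmetric])
  then have "act m (alternating s t n) = act m (alternating s t (m s t) @ [s])"
    by (simp add: fun_eq_iff)
  from reducedD[OF red this] show False
    by (simp add: n)
qed

lemma reduced_dihedral_alternating:
  assumes "reduced (u @ [s])" "set u \<subseteq> {s, t}"
  shows "u = alternating s t (length u)"
  using assms
proof (induction u)
  case (Cons a u)
  have "reduced (u @ [s])"
    using Cons.prems reduced_infix[of "[a]" "u @ [s]" "[]"] by simp
  then have u: "u = alternating s t (length u)"
    using Cons by simp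
  show ?case
  proof (cases "length u")
    case 0
    then have "a \<noteq> s"
      using Cons.prems(1) not_reduced_cancel[of "[]" s "[]"] by auto
    then show ?thesis using Cons.prems(2) 0 by simp
  next
    case (Suc k)
    then have "u = (if even k then t else s) # alternating s t k"
      using u by simp
    then have "a \<noteq> (if even k then t else s)"
      using Cons.prems(1) not_reduced_cancel[of "[]" a "alternating s t k @ [s]"] by auto
    then have "a = (if even (length u) then t else s)"
      using Cons.prems(2) Suc by (auto split: if_splits)
    then show ?thesis
      using u by simp
  qed
qed simp

definition nonneg :: "real ^ 'n \<Rightarrow> bool" where
  "nonneg x \<longleftrightarrow> (\<forall>k. 0 \<le> x $ k)"

text \<open>
  Tits' argument. Split off from \<open>w\<close> the longest possible right factor \<open>u\<close> in the dihedral group of \<open>s\<close> and the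
  last letter of \<open>w\<close>. The remaining factor maps both simple roots to nonnegative vectors by
  induction, and \<open>u\<close> maps \<open>e s\<close> to a nonnegative combination of them, because the sines in
  question are taken at angles up to \<open>\<pi>\<close>.
\<close>

theorem reduced_snoc_nonneg: "reduced (w @ [s]) \<Longrightarrow> nonneg (act m w (e s))"
proof (induction "length w" arbitrary: w s rule: less_induct)
  case less
  show ?case
  proof (cases w rule: rev_cases)
    case Nil
    then show ?thesis by (simp add: nonneg_def axis_def)
  next
    case (snoc w0 t)
    have st: "s \<noteq> t"
      using less.prems not_reduced_cancel[of w0 t "[]"] snoc by auto
    have red_w: "reduced w"
      using less.prems reduced_infix[of "[]" w "[s]"] by simp
    define P where "P n \<longleftrightarrow> (\<exists>v u. length v = n \<and> set u \<subseteq> {s, t} \<and>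
      act m (v @ u) = act m w \<and> length v + length u = length w)" for n
    have P0: "P (length w0)"
      unfolding P_def by (rule exI[of _ w0], rule exI[of _ "[t]"]) (simp add: snoc)
    define n where "n = (LEAST n. P n)"
    have "P n" unfolding n_def using P0 by (rule LeastI)
    then obtain v u where v: "length v = n" and u: "set u \<subseteq> {s, t}"
      and vu: "act m (v @ u) = act m w" and len: "length v + length u = length w"
      by (auto simp: P_def)
    have "n \<le> length w0" unfolding n_def using P0 by (rule Least_le)
    then have lv: "length v < length w" by (simp add: v snoc)
    have red: "reduced (v @ [x])" if x: "x \<in> {s, t}" for x
    proof (rule ccontr)
      assume "\<not> reduced (v @ [x])"
      then obtain v' where v': "act m v' = act m (v @ [x])" "length v' < length (v @ [x])"
        by (auto simp: reduced_def not_le)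
      then have lt: "length v' < length v"
        using parity[OF v'(1)] by (cases "length v' = length v") auto
      have "act m (v' @ x # u) = act m (v @ u)"
        using act_cong[OF v'(1), of "[]" "x # u"] act_cancel[of v x u] by simp
      then have eq: "act m (v' @ x # u) = act m w" using vu by simp
      with red_w have "length w \<le> length (v' @ x # u)" by (rule reducedD)
      then have "length v' + length (x # u) = length w"
        using lt len by simp
      then have "P (length v')"
        unfolding P_def using eq x u by (intro exI[of _ v'] exI[of _ "x # u"]) auto
      then have "n \<le> length v'" unfolding n_def by (rule Least_le)
      then show False using lt v by simp
    qed
    have pos: "nonneg (act m v (e s))" "nonneg (act m v (e t))"
      using less.hyps[OF lv] red by auto
    have "act m (v @ u @ [s]) = act m (w @ [s])"
      using act_cong[OF vu, of "[]" "[s]"] by simp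
    then have "reduced (v @ u @ [s])"
      using reduced_transfer[OF less.prems] len by simp
    then have red_us: "reduced (u @ [s])"
      using reduced_infix[of v "u @ [s]" "[]"] by simp
    define k where "k = length u"
    have uk: "u = alternating s t k"
      using reduced_dihedral_alternating[OF red_us u] by (simp add: k_def)
    have km: "k < m s t"
      using reduced_alternating_length[OF st] red_us uk by simp
    let ?\<theta> = "pi / real (m s t)"
    have S: "0 \<le> sin (real j * ?\<theta>) / sin ?\<theta>" if "j \<le> Suc k" for j
    proof -
      have "real j * ?\<theta> \<le> pi"
        using that km by (simp add: field_simps)
      then show ?thesis
        using sin_label_pos[OF st] by (intro divide_nonneg_pos sin_ge_zero) auto
    qed
    obtain a b where ab: "0 \<le> a" "0 \<le> b" "act m u (e s) = a *\<^sub>R e s + b *\<^sub>R e t"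
      using act_alternating[OF st, of k] S[of k] S[of "Suc k"] uk by (cases "even k") auto
    have "act m w (e s) = act m v (act m u (e s))"
      using vu by (metis act_append)
    then have "act m w (e s) = a *\<^sub>R act m v (e s) + b *\<^sub>R act m v (e t)"
      by (simp add: ab act_simps)
    then show ?thesis
      using pos ab by (simp add: nonneg_def)
  qed
qed

lemma reduced_snoc_nonpos: "reduced (w @ [s]) \<Longrightarrow> nonneg (- act m (w @ [s]) (e s))"
  using reduced_snoc_nonneg[of w s]
  by (simp add: act_append act_Cons reflection_def act_simps nonneg_def)

theorem root_sign: "nonneg (act m w (e s)) \<or> nonneg (- act m w (e s))"
proof -
  obtain v where v: "act m v = act m w" "reduced v"
    using reduced_exists by blast
  show ?thesis
  proof (cases "reduced (v @ [s])")
    case True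
    then show ?thesis
      using reduced_snoc_nonneg[of v s] v by simp
  next
    case False
    then obtain u where u: "act m u = act m (v @ [s])" "length u < length (v @ [s])"
      by (auto simp: reduced_def not_le)
    then have "length u < length v"
      using parity[OF u(1)] by (cases "length u = length v") auto
    moreover have us: "act m (u @ [s]) = act m v"
      using act_cong[OF u(1), of "[]" "[s]"] act_cancel[of v s "[]"] by simp
    moreover have "length v \<le> length (u @ [s])"
      using reducedD[OF v(2) us] .
    ultimately have "reduced (u @ [s])"
      using reduced_transfer[OF v(2) us] by simp
    from reduced_snoc_nonpos[OF this] show ?thesis
      using us v by simp
  qed
qed

lemma nontrivial_has_descent:
  assumes "act m w \<noteq> id"
  shows "\<exists>s. nonneg (- act m w (e s))"
proof -
  obtain v where v: "act m v = act m w" "reduced v"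
    using reduced_exists by blast
  have "v \<noteq> []"
    using v assms by (auto simp: fun_eq_iff)
  then obtain u s where "v = u @ [s]"
    by (cases v rule: rev_cases) auto
  then show ?thesis
    using reduced_snoc_nonpos[of u s] v by auto
qed

section \<open>Roots and reflections\<close>

definition roots :: "(real ^ 'n) set" where
  "roots = {act m w (e i) | w i. True}"

lemma root_act: "act m w (e i) \<in> roots"
  by (auto simp: roots_def)

lemma simple_root [simp]: "e i \<in> roots"
  using root_act[of "[]" i] by simp

lemma act_root: "x \<in> roots \<Longrightarrow> act m w x \<in> roots"
proof -
  assume "x \<in> roots"
  then obtain v i where "x = act m v (e i)" by (auto simp: roots_def)
  then have "act m w x = act m (w @ v) (e i)" by (simp add: act_append)
  then show ?thesis by (simp add: root_act)
qed

lemma root_uminus: "x \<in> roots \<Longrightarrow> - x \<in> roots"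
proof -
  assume "x \<in> roots"
  then obtain w i where "x = act m w (e i)" by (auto simp: roots_def)
  then have "- x = act m (w @ [i]) (e i)"
    by (simp add: act_append act_Cons reflection_def act_simps vec_eq_iff)
  then show ?thesis by (simp add: root_act)
qed

lemma root_unit: "x \<in> roots \<Longrightarrow> B x x = 1"
  by (auto simp: roots_def act_invariant)

lemma root_nonneg: "x \<in> roots \<Longrightarrow> nonneg x \<or> nonneg (- x)"
  using root_sign by (auto simp: roots_def)

lemma finite_roots: "finite roots"
proof -
  have "roots \<subseteq> (\<lambda>(f, i). f (e i)) ` (range (act m) \<times> UNIV)"
  proof
    fix x
    assume "x \<in> roots"
    then obtain w i where "x = act m w (e i)" by (auto simp: roots_def)
    then show "x \<in> (\<lambda>(f, i). f (e i)) ` (range (act m) \<times> UNIV)"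
      by (intro image_eqI[of _ _ "(act m w, i)"]) simp_all
  qed
  then show ?thesis
    by (rule finite_subset) (intro finite_imageI finite_cartesian_product finite_group finite)
qed

lemma prescribed_form_values: "\<exists>x. \<forall>k. B x (e k) = c k"
proof -
  let ?f = "\<lambda>x. \<chi> k. B x (e k)"
  have lin: "linear ?f"
    by (intro linearI) (simp_all add: vec_eq_iff form_simps)
  have "x = 0" if "?f x = 0" for x
  proof (rule B_nondegenerate)
    fix i
    have "?f x $ i = 0" using that by simp
    then show "B (e i) x = 0" using B_sym[of "e i" x] by simp
  qed
  then have "inj ?f"
    by (intro iffD2[OF linear_injective_0[OF lin]] allI impI)
  then have "surj ?f"
    using linear_injective_imp_surjective[OF lin] by simp
  from surjD[OF this, of "\<chi> k. c k"] obtain x where "(\<chi> k. c k) = ?f x" by blast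
  then have "\<forall>k. B x (e k) = c k"
    by (simp add: vec_eq_iff)
  then show ?thesis ..
qed

lemma form_expand: "B x y = (\<Sum>k\<in>UNIV. y $ k * B x (e k))"
proof -
  have "B x y = B x (\<Sum>k\<in>UNIV. (y $ k) *\<^sub>R e k)"
    by (simp add: vec_expand[symmetric])
  then show ?thesis by (simp add: form_sum_right form_scale_right)
qed

text \<open>
  Among the finitely many points of an orbit choose one with the largest value at a vector inside
  the fundamental chamber: a simple reflection cannot increase it.
\<close>

lemma chamber_point_exists: "\<exists>w. \<forall>i. 0 \<le> B (act m w x) (e i)"
proof -
  obtain d where d: "\<And>k. B d (e k) = 1"
    using prescribed_form_values[of "\<lambda>_. 1"] by auto
  let ?X = "(\<lambda>f. B (f x) d) ` range (act m)"
  have "finite ?X" "?X \<noteq> {}" using finite_group by auto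
  from Max_in[OF this] obtain w where "Max ?X = B (act m w x) d" by auto
  with Max_ge[OF \<open>finite ?X\<close>] have *: "B (act m v x) d \<le> B (act m w x) d" for v
    by auto
  have "0 \<le> B (act m w x) (e i)" for i
    using *[of "i # w"] B_sym[of d "e i"] B_sym[of "e i" "act m w x"] d[of i]
    by (simp add: act_Cons reflection_def form_simps)
  then show ?thesis by blast
qed

lemma unit_multiple:
  assumes "B b b = 1" "B c c = 1" "(B b c)\<^sup>2 = 1"
  shows "c = b \<or> c = - b"
proof -
  let ?x = "c - B b c *\<^sub>R b"
  have "B ?x ?x = 0"
    using assms by (simp add: form_simps B_sym[of c b] power2_eq_square)
  then have "c = B b c *\<^sub>R b" using B_eq_0 by fastforce
  moreover have "B b c = 1 \<or> B b c = -1" using assms(3) by (simp add: power2_eq_1_iff)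
  ultimately show ?thesis by (metis scaleR_one scaleR_minus_left)
qed

text \<open>
  A real vector space is not a finite union of proper subspaces.
\<close>

lemma generic_point:
  assumes "finite F" "subspace L" "\<And>b. b \<in> F \<Longrightarrow> \<exists>x\<in>L. B b x \<noteq> 0"
  shows "\<exists>x\<in>L. \<forall>b\<in>F. B b x \<noteq> 0"
  using assms(1,3)
proof (induction F)
  case empty
  then show ?case using assms(2) subspace_0 by auto
next
  case (insert b F)
  then obtain x where x: "x \<in> L" "\<And>b. b \<in> F \<Longrightarrow> B b x \<noteq> 0"
    by auto
  obtain y where y: "y \<in> L" "B b y \<noteq> 0"
    using insert.prems by auto
  have "finite {t. B c (x + t *\<^sub>R y) = 0}" if "c \<in> insert b F" for c
  proof (rule finite_subset)
    show "{t. B c (x + t *\<^sub>R y) = 0} \<subseteq> {- B c x / B c y}"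
    proof
      fix t
      assume "t \<in> {t. B c (x + t *\<^sub>R y) = 0}"
      then have t: "B c x + t * B c y = 0" by (simp add: form_simps)
      have "B c y \<noteq> 0"
      proof
        assume "B c y = 0"
        then have "B c x = 0" "c \<noteq> b" using t y by auto
        then show False using x(2)[of c] that by simp
      qed
      then show "t \<in> {- B c x / B c y}" using t by (simp add: field_simps)
    qed
  qed simp
  then have "finite (\<Union>c\<in>insert b F. {t. B c (x + t *\<^sub>R y) = 0})"
    using insert.hyps(1) by (intro finite_UN_I) simp_all
  from ex_new_if_finite[OF infinite_UNIV_char_0 this]
  obtain t where "t \<notin> (\<Union>c\<in>insert b F. {t. B c (x + t *\<^sub>R y) = 0})" ..
  then have "\<forall>c\<in>insert b F. B c (x + t *\<^sub>R y) \<noteq> 0" by blast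
  moreover have "x + t *\<^sub>R y \<in> L"
    using x(1) y(1) assms(2) subspace_add subspace_scale by blast
  ultimately show ?case by blast
qed

text \<open>
  If \<open>c\<close> were not a root, its mirror would contain a point off the mirrors of all roots. Moved
  into the open fundamental chamber, this point would be fixed by a nontrivial element, which makes
  some simple root negative.
\<close>

theorem reflection_root:
  assumes unit: "B c c = 1" and refl: "act m w = reflection m c"
  shows "c \<in> roots"
proof (rule ccontr)
  assume c: "c \<notin> roots"
  let ?L = "{x. B c x = 0}"
  have "subspace ?L"
    by (simp add: subspace_def form_simps)
  moreover have "\<exists>x\<in>?L. B b x \<noteq> 0" if b: "b \<in> roots" for b
  proof
    let ?x = "b - B c b *\<^sub>R c"
    show "?x \<in> ?L" using unit by (simp add: form_simps)
    show "B b ?x \<noteq> 0"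
    proof
      assume "B b ?x = 0"
      then have "(B b c)\<^sup>2 = 1"
        using root_unit[OF b] by (simp add: form_simps B_sym[of c b] power2_eq_square)
      then have "c = b \<or> c = - b"
        using unit_multiple root_unit[OF b] unit by blast
      then show False using b c root_uminus by auto
    qed
  qed
  ultimately obtain x where x: "B c x = 0" "\<And>b. b \<in> roots \<Longrightarrow> B b x \<noteq> 0"
    using generic_point[OF finite_roots, of ?L] by auto
  obtain v where v: "\<And>i. 0 \<le> B (act m v x) (e i)"
    using chamber_point_exists by blast
  have pos: "0 < B (act m v x) (e i)" for i
    using v[of i] x(2)[OF root_act[of "rev v" i]] B_sym
    by (metis act_adjoint less_eq_real_def)
  let ?u = "v @ w @ rev v"
  have fix_x: "act m w x = x"
    using refl x(1) by (simp add: reflection_def)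
  have "act m w c = - c"
    using refl unit by (simp add: reflection_def vec_eq_iff)
  then have "act m ?u (act m v c) = - act m v c"
    by (simp add: act_append act_simps)
  moreover have "act m v c \<noteq> - act m v c"
  proof
    assume "act m v c = - act m v c"
    then have "act m v c = 0" by (simp add: vec_eq_iff)
    then show False using act_invariant[of v c c] unit by (simp add: form_simps)
  qed
  ultimately have "act m ?u \<noteq> id" by (metis id_apply)
  then obtain s where s: "nonneg (- act m ?u (e s))"
    using nontrivial_has_descent by blast
  have "B (act m v x) (act m ?u (e s)) \<le> 0"
    unfolding form_expand[of _ "act m ?u (e s)"]
    using s pos by (intro sum_nonpos mult_nonpos_nonneg) (auto simp: nonneg_def less_imp_le)
  moreover have "B (act m v x) (act m ?u (e s)) = B (act m v x) (e s)"
  proof -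
    have "act m ?u (act m v x) = act m v x"
      using fix_x by (simp add: act_append)
    then show ?thesis using act_invariant[of ?u "act m v x" "e s"] by simp
  qed
  ultimately show False using pos[of s] by simp
qed

end

section \<open>Connected subdiagrams\<close>

context finite_coxeter
begin

definition adj :: "'n \<Rightarrow> 'n \<Rightarrow> bool" where
  "adj i j \<longleftrightarrow> i \<noteq> j \<and> m i j \<noteq> 2"

lemma adj_sym: "adj i j \<Longrightarrow> adj j i"
  using m_sym[of i j] by (auto simp: adj_def)

lemma not_adj: "i \<noteq> j \<Longrightarrow> \<not> adj i j \<longleftrightarrow> m i j = 2"
  by (simp add: adj_def)

lemma adj_m: "adj i j \<Longrightarrow> m i j \<ge> 3"
  using m_ge_2[of i j] by (auto simp: adj_def)

lemma B_adj: "adj i j \<Longrightarrow> B (e i) (e j) \<le> - 1 / 2"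
  using adj_m B_label_3 by blast

inductive conn :: "'n set \<Rightarrow> bool" where
  conn_single: "conn {i}"
| conn_insert: "conn S \<Longrightarrow> j \<in> S \<Longrightarrow> k \<notin> S \<Longrightarrow> adj j k \<Longrightarrow> conn (insert k S)"

text \<open>Irreducibility, as an induction principle for sets of nodes.\<close>

lemma grow_induct [consumes 2, case_names insert]:
  assumes "P T" "T \<noteq> {}"
    and step: "\<And>T j k. P T \<Longrightarrow> j \<in> T \<Longrightarrow> k \<notin> T \<Longrightarrow> adj j k \<Longrightarrow> P (insert k T)"
  shows "P UNIV"
  using assms(1,2)
proof (induction "card (- T)" arbitrary: T rule: less_induct)
  case less
  show ?case
  proof (cases "T = UNIV")
    case False
    then obtain i k where "i \<in> T" "k \<notin> T" using less.prems by auto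
    moreover have "(i, k) \<in> {(k, l). k \<noteq> l \<and> m k l \<noteq> 2}\<^sup>*"
      using irreducible by (simp add: coxeter_irreducible_def)
    ultimately have "k \<in> T \<or> (\<exists>j l. j \<in> T \<and> l \<notin> T \<and> adj j l)"
    proof -
      assume "i \<in> T" and "(i, k) \<in> {(k, l). k \<noteq> l \<and> m k l \<noteq> 2}\<^sup>*"
      from this(2,1) show ?thesis
        by (induction rule: rtrancl_induct) (auto simp: adj_def)
    qed
    with \<open>k \<notin> T\<close> obtain j l where jl: "j \<in> T" "l \<notin> T" "adj j l" by blast
    have "- insert l T \<subset> - T" using jl by auto
    then have "card (- insert l T) < card (- T)"
      by (intro psubset_card_mono) auto
    then show ?thesis
      using less.hyps[of "insert l T"] step[OF less.prems(1) jl] by simp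
  qed (use less.prems in simp)
qed

definition node_sum :: "'n set \<Rightarrow> real ^ 'n" where
  "node_sum S = (\<Sum>i\<in>S. e i)"

lemma node_sum_insert: "k \<notin> S \<Longrightarrow> node_sum (insert k S) = e k + node_sum S"
  by (simp add: node_sum_def)

lemma node_sum_component: "node_sum S $ i = (if i \<in> S then 1 else 0)"
  by (simp add: node_sum_def axis_def sum.delta')

lemma B_node_sum_le:
  assumes "k \<notin> S" "J \<subseteq> S"
  shows "B (e k) (node_sum S) \<le> (\<Sum>j\<in>J. B (e k) (e j))"
proof -
  have "(\<Sum>j\<in>S. B (e k) (e j)) \<le> (\<Sum>j\<in>J. B (e k) (e j))"
    using assms by (subst sum.subset_diff[OF assms(2)]) (auto intro!: sum_nonpos B_le_0)
  then show ?thesis by (simp add: node_sum_def form_sum_right)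
qed

lemma B_node_sum_adj: "k \<notin> S \<Longrightarrow> j \<in> S \<Longrightarrow> B (e k) (node_sum S) \<le> B (e k) (e j)"
  using B_node_sum_le[of k S "{j}"] by simp

lemma B_node_sum_disjoint: "S \<inter> T = {} \<Longrightarrow> B (node_sum S) (node_sum T) \<le> 0"
  unfolding node_sum_def form_sum_left form_sum_right
  by (intro sum_nonpos B_le_0) auto

text \<open>
  The nodes of a tree outnumber its edges by one, and every edge contributes at most
  \<open>-1/2\<close> twice.
\<close>

lemma conn_node_sum: "conn S \<Longrightarrow> B (node_sum S) (node_sum S) \<le> 1"
proof (induction rule: conn.induct)
  case (conn_insert S j k)
  have "B (e k) (node_sum S) \<le> - 1 / 2"
    using B_node_sum_adj[of k S j] B_adj[of k j] adj_sym conn_insert by fastforce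
  then show ?case
    using conn_insert B_sym[of "node_sum S" "e k"] by (simp add: node_sum_insert form_simps)
qed (simp add: node_sum_def)

lemma conn_nonempty: "conn S \<Longrightarrow> S \<noteq> {}"
  by (induction rule: conn.induct) auto

text \<open>
  The diagram is a tree: a second edge into a connected set would make the form nonpositive on
  the sum of the simple roots.
\<close>

lemma unique_neighbour:
  assumes "conn S" "k \<notin> S" "i \<in> S" "j \<in> S" "adj i k" "adj j k"
  shows "i = j"
proof (rule ccontr)
  assume "i \<noteq> j"
  then have "B (e k) (node_sum S) \<le> B (e k) (e i) + B (e k) (e j)"
    using B_node_sum_le[of k S "{i, j}"] assms by simp
  also have "\<dots> \<le> -1"
    using B_adj[of k i] B_adj[of k j] adj_sym assms by fastforce
  finally have "B (node_sum (insert k S)) (node_sum (insert k S)) \<le> 0"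
    using conn_node_sum[OF assms(1)] B_sym[of "node_sum S" "e k"] assms(2)
    by (simp add: node_sum_insert form_simps)
  then have "node_sum (insert k S) $ k = 0"
    using B_nonneg[of "node_sum (insert k S)"] B_eq_0 by fastforce
  then show False by (simp add: node_sum_component)
qed

lemma no_triangle: "adj i j \<Longrightarrow> adj j k \<Longrightarrow> i \<noteq> k \<Longrightarrow> m i k = 2"
proof (rule ccontr)
  assume *: "adj i j" "adj j k" "i \<noteq> k" "m i k \<noteq> 2"
  have "conn (insert j {i})" using * conn_insert[OF conn_single, of i i j] by (auto simp: adj_def)
  then have "i = j"
    using * unique_neighbour[of "{j, i}" k i j] by (auto simp: adj_def)
  then show False using * by (simp add: adj_def)
qed

text \<open>
  Excluded diagrams: each is excluded by a vector, with positive coefficients, on which the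
  form is not positive. A connected set \<open>S\<close> plays the part of a single node.
\<close>

lemma no_two_heavy:
  assumes S: "conn S" and T: "conn T" and disj: "S \<inter> T = {}" and k: "k \<notin> S \<union> T"
    and i: "i \<in> S" and "j \<in> T" "m i j \<ge> 4" and "l \<in> S" "m l k \<ge> 4"
  shows False
proof -
  let ?v = "node_sum T + sqrt 2 *\<^sub>R node_sum S + e k"
  have a: "B (node_sum T) (node_sum T) \<le> 1" "B (node_sum S) (node_sum S) \<le> 1"
    using S T conn_node_sum by auto
  have b: "B (e k) (node_sum S) \<le> - sqrt 2 / 2"
    using B_node_sum_adj[of k S l] B_label_4[of k l] assms m_sym[of k l] by fastforce
  have "T = insert j (T - {j})" using assms(6) by auto
  then have "node_sum T = e j + node_sum (T - {j})"
    using node_sum_insert[of j "T - {j}"] by simp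
  moreover have "B (node_sum (T - {j})) (node_sum S) \<le> 0"
    using disj by (intro B_node_sum_disjoint) auto
  moreover have "B (e j) (node_sum S) \<le> - sqrt 2 / 2"
    using B_node_sum_adj[of j S i] B_label_4[of j i] assms m_sym[of j i] by fastforce
  ultimately have c: "B (node_sum T) (node_sum S) \<le> - sqrt 2 / 2"
    by (simp add: form_simps)
  have d: "B (e k) (node_sum T) \<le> 0"
    using B_node_sum_disjoint[of "{k}" T] k by (simp add: node_sum_def)
  have sqrt2: "sqrt 2 * (sqrt 2 * z) = 2 * z" for z :: real
    by (simp add: mult.assoc[symmetric])
  have "B ?v ?v = B (node_sum T) (node_sum T) + 2 * B (node_sum S) (node_sum S) + 1
      + 2 * (sqrt 2 * B (node_sum T) (node_sum S)) + 2 * (sqrt 2 * B (e k) (node_sum S))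
      + 2 * B (e k) (node_sum T)"
    by (simp add: form_simps B_sym[of "node_sum S" "node_sum T"] B_sym[of "node_sum S" "e k"]
        B_sym[of "node_sum T" "e k"] algebra_simps sqrt2)
  moreover have "sqrt 2 * B (node_sum T) (node_sum S) \<le> -1" "sqrt 2 * B (e k) (node_sum S) \<le> -1"
    using mult_left_mono[OF c, of "sqrt 2"] mult_left_mono[OF b, of "sqrt 2"] by simp_all
  ultimately have "B ?v ?v \<le> 0" using a d by linarith
  then have "?v = 0" using B_nonneg[of ?v] B_eq_0 by fastforce
  moreover have "?v $ k = 1" using k by (simp add: node_sum_component)
  ultimately show False by (metis zero_index zero_neq_one)
qed

lemma no_heavy_and_branch:
  assumes S: "conn S" and "a \<notin> S" "b \<notin> S" "c \<notin> S" and dist: "a \<noteq> b" "a \<noteq> c" "b \<noteq> c"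
    and "i \<in> S" "m i a \<ge> 4" and "j \<in> S" "adj j b" and "l \<in> S" "adj l c"
  shows False
proof -
  let ?v = "sqrt 2 *\<^sub>R node_sum S + e a + (sqrt 2 / 2) *\<^sub>R (e b + e c)"
  have S1: "B (node_sum S) (node_sum S) \<le> 1"
    using S conn_node_sum by auto
  have a: "B (e a) (node_sum S) \<le> - sqrt 2 / 2"
    using B_node_sum_adj[of a S i] B_label_4[of a i] assms m_sym[of a i] by fastforce
  have b: "B (e b) (node_sum S) \<le> - 1 / 2"
    using B_node_sum_adj[of b S j] B_adj[of b j] assms adj_sym[of j b] by fastforce
  have c: "B (e c) (node_sum S) \<le> - 1 / 2"
    using B_node_sum_adj[of c S l] B_adj[of c l] assms adj_sym[of l c] by fastforce
  have sqrt2: "sqrt 2 * (sqrt 2 * z) = 2 * z" for z :: real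
    by (simp add: mult.assoc[symmetric])
  have "B ?v ?v = 2 * B (node_sum S) (node_sum S) + 2 + 2 * (sqrt 2 * B (e a) (node_sum S))
      + 2 * B (e b) (node_sum S) + 2 * B (e c) (node_sum S)
      + sqrt 2 * B (e a) (e b) + sqrt 2 * B (e a) (e c) + B (e b) (e c)"
    by (simp add: form_simps B_sym[of "node_sum S" "e _"] B_sym[of "e b" "e a"]
        B_sym[of "e c" "e a"] B_sym[of "e c" "e b"] algebra_simps sqrt2)
  moreover have "sqrt 2 * B (e a) (node_sum S) \<le> -1"
    using mult_left_mono[OF a, of "sqrt 2"] by simp
  moreover have "sqrt 2 * B (e a) (e b) \<le> 0" "sqrt 2 * B (e a) (e c) \<le> 0" "B (e b) (e c) \<le> 0"
    using dist B_le_0 by (auto intro: mult_nonneg_nonpos)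
  ultimately have "B ?v ?v \<le> 0" using S1 b c by linarith
  then have "?v = 0" using B_nonneg[of ?v] B_eq_0 by fastforce
  moreover have "?v $ a = 1" using assms by (simp add: node_sum_component axis_def)
  ultimately show False by (metis zero_index zero_neq_one)
qed

text \<open>
  The Gram determinant of the three simple roots is positive.
\<close>

lemma path_3_cosines:
  assumes "adj a b" "adj b c" "a \<noteq> c"
  shows "(B (e a) (e b))\<^sup>2 + (B (e b) (e c))\<^sup>2 < 1"
proof -
  let ?x = "B (e a) (e b)" and ?y = "B (e b) (e c)"
  let ?v = "e b - ?x *\<^sub>R e a - ?y *\<^sub>R e c"
  have ac: "B (e a) (e c) = 0"
    using no_triangle[OF assms] B_commuting by simp
  have "a \<noteq> b" "b \<noteq> c" using assms by (auto simp: adj_def)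
  then have "e b $ b = (1::real)" "e a $ b = (0::real)" "e c $ b = (0::real)"
    by (simp_all add: axis_def)
  then have "?v $ b = 1" by simp
  then have "0 < B ?v ?v" using form_pos[of ?v] by (metis zero_index zero_neq_one)
  also have "B ?v ?v = 1 - ?x\<^sup>2 - ?y\<^sup>2"
    using ac by (simp add: form_simps B_sym[of "e b" "e a"] B_sym[of "e c" "e a"]
        B_sym[of "e c" "e b"] algebra_simps power2_eq_square)
  finally show ?thesis by simp
qed

lemma path_3_labels:
  assumes "adj a b" "adj b c" "a \<noteq> c"
  shows "m a b \<le> 5" "m a b \<ge> 4 \<Longrightarrow> m b c = 3"
proof -
  have bc: "1 / 4 \<le> (B (e b) (e c))\<^sup>2"
    using B_adj[OF assms(2)] power_mono[of "1/2" "- B (e b) (e c)" 2] by (simp add: power2_eq_square)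
  show "m a b \<le> 5"
  proof (rule ccontr)
    assume "\<not> m a b \<le> 5"
    then have "3 / 4 \<le> (B (e a) (e b))\<^sup>2"
      using B_label_6[of a b] power_mono[of "sqrt 3 / 2" "- B (e a) (e b)" 2]
      by (simp add: power2_eq_square)
    then show False using bc path_3_cosines[OF assms] by simp
  qed
  show "m b c = 3" if "m a b \<ge> 4"
  proof (rule ccontr)
    assume "m b c \<noteq> 3"
    then have "m b c \<ge> 4" using adj_m[OF assms(2)] by simp
    then have "1 / 2 \<le> (B (e b) (e c))\<^sup>2"
      using B_label_4[of b c] power_mono[of "sqrt 2 / 2" "- B (e b) (e c)" 2]
      by (simp add: power2_eq_square)
    moreover have "1 / 2 \<le> (B (e a) (e b))\<^sup>2"
      using B_label_4[OF that] power_mono[of "sqrt 2 / 2" "- B (e a) (e b)" 2]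
      by (simp add: power2_eq_square)
    ultimately show False using path_3_cosines[OF assms] by simp
  qed
qed

text \<open>
  Remove an edge with label at least 4 and let the two sides grow from its ends. A second such
  edge would be met when one of the sides is enlarged, and contradict \<open>no_two_heavy\<close>.
\<close>

lemma unique_heavy_edge:
  assumes ab: "adj a b" "m a b \<ge> 4" and ij: "adj i j" "m i j \<ge> 4"
  shows "{i, j} = {a, b}"
proof -
  define Q where "Q T \<longleftrightarrow> (\<forall>i\<in>T. \<forall>j\<in>T. adj i j \<longrightarrow> m i j \<ge> 4 \<longrightarrow> {i, j} = {a, b})" for T
  define P where "P T \<longleftrightarrow> (\<exists>T1 T2. T = T1 \<union> T2 \<and> conn T \<and> conn T1 \<and> conn T2 \<and> T1 \<inter> T2 = {} \<and>
    a \<in> T1 \<and> b \<in> T2) \<and> Q T" for T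
  have "a \<noteq> b" using ab by (simp add: adj_def)
  have "P {a, b}"
    unfolding P_def
  proof (rule conjI, rule exI[of _ "{a}"], rule exI[of _ "{b}"], intro conjI conn_single)
    show "conn {a, b}"
      using conn_insert[OF conn_single, of b b a] ab adj_sym \<open>a \<noteq> b\<close> by auto
    show "{a, b} = {a} \<union> {b}" by (rule insert_is_Un)
    show "{a} \<inter> {b} = {}" using \<open>a \<noteq> b\<close> by simp
    have "{i, j} = {a, b}" if "i \<in> {a, b}" "j \<in> {a, b}" "i \<noteq> j" for i j
      using that by blast
    then show "Q {a, b}"
      unfolding Q_def adj_def by metis
  qed simp_all
  moreover have "P (insert k T)" if PT: "P T" and l: "l \<in> T" and k: "k \<notin> T" and lk: "adj l k" for T l k
  proof -
    obtain T1 T2 where T: "T = T1 \<union> T2" "conn T" "conn T1" "conn T2" "T1 \<inter> T2 = {}"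
      "a \<in> T1" "b \<in> T2" and heavy: "Q T"
      using PT unfolding P_def by (elim exE conjE) (rule that)
    have only_l: "x = l" if "x \<in> T" "adj x k" for x
      using unique_neighbour[OF T(2) k that(1) l that(2) lk] .
    have light: "\<not> m l k \<ge> 4"
    proof
      assume h: "m l k \<ge> 4"
      show False
      proof (cases "l \<in> T1")
        case True
        then show False
          using no_two_heavy[OF T(3,4,5) _ T(6,7) ab(2) True h] True k unfolding T(1) by blast
      next
        case False
        then have "l \<in> T2" using l T(1) by simp
        moreover have "T2 \<inter> T1 = {}" "k \<notin> T2 \<union> T1" using T(1,5) k by auto
        moreover have "m b a \<ge> 4" using ab(2) m_sym[of b a] by simp
        ultimately show False
          using no_two_heavy[OF T(4,3) _ _ T(7,6) _ _ h] by metis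
      qed
    qed
    have conn: "conn (insert k T)" using conn_insert[OF T(2) l k lk] .
    have heavy': "{x, y} = {a, b}" if "x \<in> insert k T" "y \<in> insert k T" "adj x y" "m x y \<ge> 4" for x y
    proof -
      have "x \<noteq> y" using that(3) by (simp add: adj_def)
      have False if "x = k"
      proof -
        have "y \<in> T" using that \<open>x \<noteq> y\<close> \<open>y \<in> insert k T\<close> by blast
        then have "y = l" using only_l \<open>adj x y\<close> adj_sym that by blast
        then show False using light \<open>m x y \<ge> 4\<close> that m_sym[of l k] by simp
      qed
      moreover have False if "y = k"
      proof -
        have "x \<in> T" using that \<open>x \<noteq> y\<close> \<open>x \<in> insert k T\<close> by blast
        then have "x = l" using only_l \<open>adj x y\<close> that by blast
        then show False using light \<open>m x y \<ge> 4\<close> that by simp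
      qed
      ultimately have "x \<in> T" "y \<in> T" using that(1,2) by blast+
      then show ?thesis using heavy that(3,4) unfolding Q_def by metis
    qed
    then have "Q (insert k T)" unfolding Q_def by metis
    show ?thesis
    proof (cases "l \<in> T1")
      case True
      have "conn (insert k T1)" using conn_insert[OF T(3) True _ lk] k T(1) by blast
      moreover have "insert k T = insert k T1 \<union> T2" "insert k T1 \<inter> T2 = {}" using k T by blast+
      ultimately show ?thesis
        unfolding P_def using conn T(4,6,7) \<open>Q (insert k T)\<close> by blast
    next
      case False
      then have "l \<in> T2" using l T(1) by blast
      then have "conn (insert k T2)" using conn_insert[OF T(4) _ _ lk] k T(1) by blast
      moreover have "insert k T = T1 \<union> insert k T2" "T1 \<inter> insert k T2 = {}" using k T by blast+
      ultimately show ?thesis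
        unfolding P_def using conn T(3,6,7) \<open>Q (insert k T)\<close> by blast
    qed
  qed
  ultimately have "P UNIV"
    by (intro grow_induct[of P "{a, b}"]) auto
  then have "Q UNIV"
    unfolding P_def by (rule conjunct2)
  then show ?thesis using ij unfolding Q_def by simp
qed


section \<open>Subdiagrams of a diagram not of type A or B\<close>

definition path :: "'n list \<Rightarrow> bool" where
  "path xs \<longleftrightarrow> distinct xs \<and> (\<forall>i. Suc i < length xs \<longrightarrow> adj (xs ! i) (xs ! Suc i))"

lemma path_take: "path xs \<Longrightarrow> path (take k xs)"
  by (simp add: path_def)

lemma path_drop: "path xs \<Longrightarrow> path (drop k xs)"
  by (simp add: path_def)

lemma path_snoc:
  assumes "path xs" "xs \<noteq> []" "k \<notin> set xs" "adj (last xs) k"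
  shows "path (xs @ [k])"
proof -
  have "adj (xs ! i) k" if "Suc i = length xs" for i
    using assms(2,4) that[symmetric] by (simp add: last_conv_nth)
  then show ?thesis
    using assms by (auto simp: path_def nth_append less_Suc_eq)
qed

lemma path_Cons:
  assumes "path xs" "xs \<noteq> []" "k \<notin> set xs" "adj k (hd xs)"
  shows "path (k # xs)"
  using assms by (auto simp: path_def nth_Cons hd_conv_nth split: nat.split)

lemma path_conn: "path xs \<Longrightarrow> xs \<noteq> [] \<Longrightarrow> conn (set xs)"
proof (induction xs rule: rev_induct)
  case (snoc x xs)
  show ?case
  proof (cases "xs = []")
    case True
    then show ?thesis by (simp add: conn_single)
  next
    case False
    have p: "path xs" using path_take[OF snoc.prems(1), of "length xs"] by simp
    have "Suc (length xs - 1) = length xs" using False by simp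
    then have "adj ((xs @ [x]) ! (length xs - 1)) ((xs @ [x]) ! length xs)"
      using snoc.prems(1) unfolding path_def by (metis length_append_singleton lessI)
    moreover have "(xs @ [x]) ! (length xs - 1) = last xs"
      using False by (simp add: nth_append last_conv_nth)
    ultimately have "adj (last xs) x" "x \<notin> set xs"
      using snoc.prems(1) by (simp_all add: path_def)
    then show ?thesis
      using conn_insert[OF snoc.IH[OF p False], of "last xs" x] False by simp
  qed
qed simp

text \<open>
  An edge between other than consecutive nodes would close a cycle.
\<close>

lemma path_adj:
  assumes "path xs" "i < j" "j < length xs" "adj (xs ! i) (xs ! j)"
  shows "j = Suc i"
proof -
  let ?S = "set (take j xs)"
  have "path (take j xs)" "take j xs \<noteq> []" using assms path_take by auto
  then have "conn ?S" by (rule path_conn)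
  moreover have "xs ! j \<notin> ?S"
    using assms by (auto simp: path_def set_conv_nth nth_eq_iff_index_eq)
  moreover have "xs ! i \<in> ?S" "xs ! (j - 1) \<in> ?S"
    using assms nth_mem[of i "take j xs"] nth_mem[of "j - 1" "take j xs"] by simp_all
  moreover have "adj (xs ! (j - 1)) (xs ! j)"
    using assms by (auto simp: path_def dest: spec[of _ "j - 1"])
  ultimately have "xs ! i = xs ! (j - 1)"
    using unique_neighbour assms(4) by blast
  then have "i = j - 1"
    using assms by (auto simp: path_def nth_eq_iff_index_eq)
  then show ?thesis using assms by simp
qed

lemma path_covers:
  assumes "path xs" "xs \<noteq> []"
    and "\<And>i k. i < length xs \<Longrightarrow> k \<notin> set xs \<Longrightarrow> \<not> adj (xs ! i) k"
  shows "set xs = UNIV"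
proof -
  have "UNIV \<subseteq> set xs"
  proof (rule grow_induct[of "\<lambda>T. T \<subseteq> set xs" "set xs"])
    fix T j k
    assume "T \<subseteq> set xs" "j \<in> T" "adj j k"
    then obtain i where "i < length xs" "adj (xs ! i) k"
      by (metis in_set_conv_nth subsetD)
    then show "insert k T \<subseteq> set xs"
      using assms(3) \<open>T \<subseteq> set xs\<close> by auto
  qed (use assms(2) in simp_all)
  then show ?thesis by auto
qed

lemma path_type:
  assumes xs: "path xs" "set xs = UNIV"
    and M: "\<And>i j. i < length xs \<Longrightarrow> j < length xs \<Longrightarrow> m (xs ! i) (xs ! j) = M i j"
  shows "of_coxeter_type m M"
proof -
  have d: "distinct xs" using xs by (simp add: path_def)
  then have len: "length xs = CARD('n)" using xs(2) distinct_card[of xs] by simp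
  have bij: "bij_betw ((!) xs) {..<length xs} UNIV"
    using bij_betw_nth[OF d, of "{..<length xs}" UNIV] xs by simp
  let ?f = "inv_into {..<length xs} ((!) xs)"
  have f: "?f i < length xs" "xs ! ?f i = i" for i
    using bij_betw_inv_into_right[OF bij, of i] bij_betw_inv_into[OF bij]
    by (auto simp: bij_betw_def)
  show ?thesis
    unfolding of_coxeter_type_def
  proof (intro exI[of _ ?f] conjI allI)
    show "bij_betw ?f UNIV {..<CARD('n)}" using bij_betw_inv_into[OF bij] len by simp
    show "m i j = M (?f i) (?f j)" for i j using M[of "?f i" "?f j"] f by simp
  qed
qed

lemma path_label:
  assumes "path xs" "i < length xs" "j < length xs"
    and 3: "\<And>i. Suc i < length xs \<Longrightarrow> m (xs ! i) (xs ! Suc i) = M i (Suc i)"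
    and M: "\<And>i. M i i = 1" "\<And>i j. M i j = M j i" "\<And>i j. Suc i < j \<Longrightarrow> M i j = 2"
  shows "m (xs ! i) (xs ! j) = M i j"
proof -
  have *: "m (xs ! i) (xs ! j) = M i j" if "i < j" "j < length xs" for i j
  proof (cases "j = Suc i")
    case False
    then have "\<not> adj (xs ! i) (xs ! j)" using path_adj[OF assms(1) that] by auto
    moreover have "xs ! i \<noteq> xs ! j"
      using that assms(1) by (auto simp: path_def nth_eq_iff_index_eq)
    ultimately show ?thesis using not_adj M(3)[of i j] that False by auto
  qed (use 3 that in auto)
  consider "i < j" | "i = j" | "j < i" by linarith
  then show ?thesis
  proof cases
    case 1
    then show ?thesis using * assms(3) by blast
  next
    case 2
    then show ?thesis using M(1) by simp
  next
    case 3
    then have "m (xs ! j) (xs ! i) = M j i" using * assms(2) by blast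
    then show ?thesis using M(2)[of i j] m_sym[of "xs ! i" "xs ! j"] by simp
  qed
qed

lemma longest_path:
  assumes "path xs0" "Q xs0"
  obtains xs where "path xs" "Q xs" "\<And>ys. path ys \<Longrightarrow> Q ys \<Longrightarrow> length ys \<le> length xs"
proof -
  have "length ys < Suc (CARD('n))" if "path ys" for ys
    using that distinct_card[of ys] card_mono[of UNIV "set ys"] by (simp add: path_def)
  then show ?thesis
    using ex_has_greatest_nat[of "\<lambda>ys. path ys \<and> Q ys" xs0 length "Suc (CARD('n))"] assms that
    by (metis less_imp_le)
qed

text \<open>
  Without an edge of label at least 4, a longest path that does not cover the diagram has an
  inner node with a third neighbour.
\<close>

lemma light_case:
  assumes light: "\<And>i j. adj i j \<Longrightarrow> m i j = 3" and A: "\<not> of_coxeter_type m cox_A"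
  obtains c p q r where "adj c p" "adj c q" "adj c r" "distinct [p, q, r]"
proof -
  obtain xs where xs: "path xs" "xs \<noteq> []"
    and longest: "\<And>ys. path ys \<Longrightarrow> ys \<noteq> [] \<Longrightarrow> length ys \<le> length xs"
    using longest_path[of "[undefined]" "\<lambda>xs. xs \<noteq> []"] by (auto simp: path_def)
  have "set xs \<noteq> UNIV"
  proof
    assume "set xs = UNIV"
    moreover have "m (xs ! i) (xs ! j) = cox_A i j" if "i < length xs" "j < length xs" for i j
      using xs(1) that
      by (rule path_label) (use xs light in \<open>auto simp: cox_A_def path_def\<close>)
    ultimately show False using path_type[OF xs(1)] A by blast
  qed
  then obtain i k where ik: "i < length xs" "k \<notin> set xs" "adj (xs ! i) k"
    using path_covers[OF xs] by blast
  have "i \<noteq> 0"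
  proof
    assume "i = 0"
    then have "adj k (hd xs)" using ik(3) xs(2) adj_sym by (simp add: hd_conv_nth)
    then show False using longest[OF path_Cons[OF xs ik(2)]] by simp
  qed
  moreover have "i \<noteq> length xs - 1"
    using longest[OF path_snoc[OF xs ik(2)]] ik(3) xs(2) by (auto simp: last_conv_nth)
  ultimately obtain h where h: "i = Suc h" "Suc i < length xs"
    using ik(1) by (cases i) auto
  have "adj (xs ! i) (xs ! h)" "adj (xs ! i) (xs ! Suc i)"
    using xs(1) h adj_sym by (auto simp: path_def)
  moreover have "distinct [xs ! h, xs ! Suc i, k]"
    using xs(1) h ik(2) by (auto simp: path_def nth_eq_iff_index_eq)
  ultimately show ?thesis using that ik(3) by blast
qed

text \<open>
  If an edge of label 4 ends in a leaf, the rest of the diagram is a path, by the exclusion of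
  branch points.
\<close>

lemma heavy_leaf_type_B:
  assumes ab: "m a b = 4" and leaf: "\<And>k. adj a k \<Longrightarrow> k = b"
  shows "of_coxeter_type m cox_B"
proof -
  have "adj a b" using ab by (auto simp: adj_def)
  then have "a \<noteq> b" by (simp add: adj_def)
  have p0: "path [a, b]"
    using \<open>adj a b\<close> \<open>a \<noteq> b\<close> by (auto simp: path_def less_Suc_eq)
  obtain xs where xs: "path xs" "length xs \<ge> 2 \<and> xs ! 0 = a"
    and longest: "\<And>ys. path ys \<Longrightarrow> length ys \<ge> 2 \<and> ys ! 0 = a \<Longrightarrow> length ys \<le> length xs"
    using longest_path[OF p0, of "\<lambda>xs. length xs \<ge> 2 \<and> xs ! 0 = a"] by auto
  have "adj (xs ! 0) (xs ! Suc 0)"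
    using xs by (auto simp: path_def)
  then have x1: "xs ! Suc 0 = b" using leaf xs(2) by simp
  have "set xs = UNIV"
  proof (rule path_covers[OF xs(1)])
    show "xs \<noteq> []" using xs(2) by auto
    fix i k
    assume i: "i < length xs" and k: "k \<notin> set xs"
    show "\<not> adj (xs ! i) k"
    proof
      assume adj: "adj (xs ! i) k"
      have "i \<noteq> 0"
      proof
        assume "i = 0"
        then have "k = xs ! Suc 0" using adj leaf xs(2) x1 by simp
        moreover have "xs ! Suc 0 \<in> set xs" using xs(2) by simp
        ultimately show False using k by simp
      qed
      moreover have "i \<noteq> length xs - 1"
        using longest[OF path_snoc[OF xs(1) \<open>xs \<noteq> []\<close> k]] adj xs(2) \<open>xs \<noteq> []\<close>
        by (auto simp: last_conv_nth nth_append)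
      ultimately have h: "0 < i" "Suc i < length xs" using i by auto
      let ?S = "set (take i (drop 1 xs))"
      have "path (take i (drop 1 xs))" by (intro path_take path_drop xs)
      then have conn: "conn ?S" by (rule path_conn) (use h in auto)
      have S: "?S = {xs ! l | l. 0 < l \<and> l \<le> i}"
      proof -
        have "xs ! Suc l \<in> ?S" if "l < i" for l
          using that h nth_mem[of l "take i (drop 1 xs)"] by simp
        then have "?S = {xs ! Suc l | l. l < i}"
          using h by (auto simp: set_conv_nth)
        also have "\<dots> = {xs ! l | l. 0 < l \<and> l \<le> i}"
          by (force simp: gr0_conv_Suc Suc_le_eq)
        finally show ?thesis .
      qed
      have d: "xs ! j \<noteq> xs ! l" if "j < length xs" "l < length xs" "j \<noteq> l" for j l
        using xs(1) that by (simp add: path_def nth_eq_iff_index_eq)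
      have ns: "a \<notin> ?S" "xs ! Suc i \<notin> ?S" "k \<notin> ?S"
      proof -
        show "a \<notin> ?S"
        proof
          assume "a \<in> ?S"
          then obtain l where "a = xs ! l" "0 < l" "l \<le> i" unfolding S by blast
          then show False using d[of 0 l] h xs(2) \<open>xs \<noteq> []\<close> by simp
        qed
        show "xs ! Suc i \<notin> ?S"
        proof
          assume "xs ! Suc i \<in> ?S"
          then obtain l where "xs ! Suc i = xs ! l" "l \<le> i" unfolding S by blast
          then show False using d[of "Suc i" l] h by simp
        qed
        show "k \<notin> ?S" using k by (meson in_set_takeD in_set_dropD)
      qed
      have ins: "b \<in> ?S" "xs ! i \<in> ?S"
      proof -
        have "b = xs ! 1" using x1 by simp
        then show "b \<in> ?S" "xs ! i \<in> ?S" unfolding S using h by fastforce+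
      qed
      have dist: "a \<noteq> xs ! Suc i" "a \<noteq> k" "xs ! Suc i \<noteq> k"
        using d[of 0 "Suc i"] h xs(2) k nth_mem[of 0 xs] nth_mem[of "Suc i" xs] \<open>xs \<noteq> []\<close> by auto
      have next_adj: "adj (xs ! i) (xs ! Suc i)" using xs(1) h by (simp add: path_def)
      have "m b a \<ge> 4" using ab m_sym[of b a] by simp
      from no_heavy_and_branch[OF conn ns dist ins(1) this ins(2) next_adj ins(2) adj]
      show False .
    qed
  qed
  moreover have "m (xs ! i) (xs ! j) = cox_B i j" if "i < length xs" "j < length xs" for i j
    using xs(1) that
  proof (rule path_label)
    fix i
    assume i: "Suc i < length xs"
    then have adj: "adj (xs ! i) (xs ! Suc i)" using xs(1) by (simp add: path_def)
    show "m (xs ! i) (xs ! Suc i) = cox_B i (Suc i)"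
    proof (cases "i = 0")
      case True
      then show ?thesis using xs(2) x1 ab by (simp add: cox_B_def)
    next
      case False
      have "m (xs ! i) (xs ! Suc i) = 3"
      proof (rule ccontr)
        assume "m (xs ! i) (xs ! Suc i) \<noteq> 3"
        then have "m (xs ! i) (xs ! Suc i) \<ge> 4" using adj_m[OF adj] by simp
        from unique_heavy_edge[OF \<open>adj a b\<close> _ adj this] have "a \<in> {xs ! i, xs ! Suc i}"
          using ab by auto
        moreover have "xs \<noteq> []" using i by auto
        then have "xs ! 0 \<noteq> xs ! i" "xs ! 0 \<noteq> xs ! Suc i"
          using nth_eq_iff_index_eq[of xs 0 i] nth_eq_iff_index_eq[of xs 0 "Suc i"] xs False i
          by (simp_all add: path_def)
        ultimately show False using xs(2) by simp
      qed
      moreover have "{i, Suc i} \<noteq> {0, 1}" using False by (auto simp: doubleton_eq_iff)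
      ultimately show ?thesis by (simp add: cox_B_def cox_A_def)
    qed
  next
    show "cox_B i j = cox_B j i" for i j
      by (auto simp: cox_B_def cox_A_def insert_commute)
    show "cox_B i j = 2" if "Suc i < j" for i j
      using that by (auto simp: cox_B_def cox_A_def doubleton_eq_iff)
  qed (auto simp: cox_B_def cox_A_def)
  ultimately show ?thesis using path_type[OF xs(1)] by blast
qed

lemma edge_has_neighbour:
  assumes "CARD('n) \<ge> 3"
  shows "\<exists>k\<in>{i, j}. \<exists>l. l \<notin> {i, j} \<and> adj k l"
proof (rule ccontr)
  assume no: "\<not> ?thesis"
  have "UNIV \<subseteq> {i, j}"
    by (rule grow_induct[of "\<lambda>T. T \<subseteq> {i, j}" "{i, j}"]) (use no in blast)+
  then have "card (UNIV :: 'n set) \<le> card {i, j}"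
    by (intro card_mono) auto
  also have "\<dots> \<le> 2" by (simp add: card_insert_if)
  finally show False using assms by simp
qed

text \<open>
  The nodes in the three cases form a subdiagram of type \<open>D\<^sub>4\<close>, \<open>H\<^sub>3\<close> or \<open>F\<^sub>4\<close>. An edge of label 4
  at least one of whose ends is a leaf occurs in type B only, and larger labels than 5 leave no
  room for a third node.
\<close>

theorem base_subdiagram:
  assumes rank: "CARD('n) \<ge> 3"
    and A: "\<not> of_coxeter_type m cox_A" and B: "\<not> of_coxeter_type m cox_B"
  obtains
    (D4) c p q r where "adj c p" "adj c q" "adj c r" "distinct [p, q, r]"
      "\<And>i k. adj i k \<Longrightarrow> m i k = 3"
  | (H3) a b c where "m a b = 5" "adj b c" "a \<noteq> c"
      "\<And>i k. adj i k \<Longrightarrow> {i, k} \<noteq> {a, b} \<Longrightarrow> m i k = 3"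
  | (F4) p a b q where "m a b = 4" "adj p a" "adj b q" "p \<noteq> b" "a \<noteq> q"
      "\<And>i k. adj i k \<Longrightarrow> {i, k} \<noteq> {a, b} \<Longrightarrow> m i k = 3"
proof (cases "\<exists>a b. adj a b \<and> m a b \<ge> 4")
  case False
  have light: "m i j = 3" if "adj i j" for i j
  proof -
    have "\<not> 4 \<le> m i j" using False that by blast
    then show ?thesis using adj_m[OF that] by linarith
  qed
  then show ?thesis
    using light_case[OF light A] D4 by metis
next
  case True
  then obtain a0 b0 where h0: "adj a0 b0" "m a0 b0 \<ge> 4" by blast
  obtain l where l: "l \<notin> {a0, b0}" "adj a0 l \<or> adj b0 l"
    using edge_has_neighbour[OF rank, of a0 b0] by blast
  obtain a b where ab: "adj a b" "m a b \<ge> 4" "adj b l" "a \<noteq> l" "b \<noteq> l"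
  proof (cases "adj b0 l")
    case True
    then show ?thesis using that h0 l by blast
  next
    case False
    then have "adj a0 l" using l by blast
    moreover have "m b0 a0 \<ge> 4" using h0 m_sym[of a0 b0] by simp
    ultimately show ?thesis using that[of b0 a0] adj_sym[OF h0(1)] l by blast
  qed
  have light: "m i k = 3" if "adj i k" "{i, k} \<noteq> {a, b}" for i k
    using unique_heavy_edge[OF ab(1,2) that(1)] that adj_m[OF that(1)] by (cases "m i k \<ge> 4") auto
  have "m a b = 4 \<or> m a b = 5"
    using path_3_labels(1)[OF ab(1,3,4)] ab(2) by linarith
  then show ?thesis
  proof
    assume "m a b = 5"
    then show ?thesis using H3 ab(3,4) light by blast
  next
    assume ab4: "m a b = 4"
    then obtain p where p: "adj a p" "p \<noteq> b"
      using heavy_leaf_type_B B by blast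
    then show ?thesis using F4[OF ab4 adj_sym[OF p(1)] ab(3) p(2) ab(4) light] by blast
  qed
qed


section \<open>Strongly orthogonal roots\<close>

text \<open>
  These are the pairs conjugate to two commuting simple roots. The plane of such a pair contains
  no further roots, so that there the Dunkl condition concerns the two mirrors alone
  (\<open>strongly_orth_normal\<close>).
\<close>

definition strongly_orth :: "real ^ 'n \<Rightarrow> real ^ 'n \<Rightarrow> bool" where
  "strongly_orth b c \<longleftrightarrow> (\<exists>w i k. m i k = 2 \<and> b = act m w (e i) \<and> c = act m w (e k))"

lemma strongly_orthI: "m i k = 2 \<Longrightarrow> strongly_orth (act m w (e i)) (act m w (e k))"
  unfolding strongly_orth_def by blast

lemma strongly_orth_simple: "m i k = 2 \<Longrightarrow> strongly_orth (e i) (e k)"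
  using strongly_orthI[of i k "[]"] by simp

lemma strongly_orth_act: "strongly_orth b c \<Longrightarrow> strongly_orth (act m w b) (act m w c)"
  unfolding strongly_orth_def by (metis act_append)

text \<open>
  Restricting the vectors \<open>x\<close>, but not the roots \<open>c\<close>, to the subdiagram \<open>T\<close> lets the condition be
  proved by adding nodes to \<open>T\<close>.
\<close>

definition complement_spanned :: "'n set \<Rightarrow> 'n \<Rightarrow> bool" where
  "complement_spanned T i \<longleftrightarrow> (\<forall>x. (\<forall>k. k \<notin> T \<longrightarrow> x $ k = 0) \<longrightarrow> B (e i) x = 0 \<longrightarrow>
     x \<in> span {c. strongly_orth (e i) c})"

lemma support_expand:
  assumes "\<And>k. k \<notin> T \<Longrightarrow> x $ k = 0"
  shows "x = (\<Sum>k\<in>T. (x $ k) *\<^sub>R e k)"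
proof -
  have "(\<Sum>k\<in>UNIV. (x $ k) *\<^sub>R e k) = (\<Sum>k\<in>T. (x $ k) *\<^sub>R e k)"
    by (rule sum.mono_neutral_right) (use assms in auto)
  then show ?thesis by (simp add: vec_expand[symmetric])
qed

lemma act_support: "set w \<subseteq> T \<Longrightarrow> k \<notin> T \<Longrightarrow> act m w x $ k = x $ k"
  by (induction w) (auto simp: act_Cons reflection_def axis_def)

lemma complement_spanned_act:
  assumes T: "complement_spanned T i" and w: "set w \<subseteq> T" "act m w (e i) = e j"
  shows "complement_spanned T j"
  unfolding complement_spanned_def
proof (intro allI impI)
  fix x
  assume x: "\<forall>k. k \<notin> T \<longrightarrow> x $ k = 0" "B (e j) x = 0"
  let ?y = "act m (rev w) x"
  have "?y $ k = 0" if "k \<notin> T" for k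
    using act_support[of "rev w" T k x] w(1) x(1) that by simp
  moreover have "B (e i) ?y = 0"
    using x(2) act_adjoint[of w "e i" x] w(2) by simp
  ultimately have "?y \<in> span {c. strongly_orth (e i) c}"
    using T unfolding complement_spanned_def by blast
  then have "act m w ?y \<in> span (act m w ` {c. strongly_orth (e i) c})"
    using linear_span_image[OF linear_act] by blast
  also have "\<dots> \<subseteq> span {c. strongly_orth (e j) c}"
    using strongly_orth_act[of "e i" _ w] w(2) by (intro span_mono) auto
  finally show "x \<in> span {c. strongly_orth (e j) c}" by simp
qed

lemma set_alternating: "set (alternating s t k) \<subseteq> {s, t}"
  by (induction k) auto

text \<open>
  The two simple roots of an edge with odd label are conjugate in its dihedral group.
\<close>

lemma complement_spanned_odd:
  assumes "complement_spanned T i" "i \<in> T" "j \<in> T" "i \<noteq> j" "odd (m i j)"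
  shows "complement_spanned T j"
proof (rule complement_spanned_act[OF assms(1)])
  show "set (alternating i j (m i j - 1)) \<subseteq> T"
    using set_alternating[of i j] assms(2,3) by blast
  show "act m (alternating i j (m i j - 1)) (e i) = e j"
    using act_alternating_label[OF assms(4)] assms(5) by simp
qed

lemma complement_spanned_insert:
  assumes "complement_spanned T i" "m i k = 2"
  shows "complement_spanned (insert k T) i"
  unfolding complement_spanned_def
proof (intro allI impI)
  fix x
  assume x: "\<forall>l. l \<notin> insert k T \<longrightarrow> x $ l = 0" "B (e i) x = 0"
  let ?y = "x - (x $ k) *\<^sub>R e k"
  have "?y $ l = 0" if "l \<notin> T" for l
    using x(1) that by (cases "l = k") (auto simp: axis_def)
  moreover have "B (e i) ?y = 0"
    using x(2) B_commuting[OF assms(2)] by (simp add: form_simps)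
  ultimately have "?y \<in> span {c. strongly_orth (e i) c}"
    using assms(1) unfolding complement_spanned_def by blast
  moreover have "e k \<in> span {c. strongly_orth (e i) c}"
    using strongly_orth_simple[OF assms(2)] by (intro span_base) simp
  ultimately have "?y + (x $ k) *\<^sub>R e k \<in> span {c. strongly_orth (e i) c}"
    by (intro span_add span_scale)
  then show "x \<in> span {c. strongly_orth (e i) c}" by simp
qed

text \<open>
  A new node is joined to a single node \<open>j\<close>. The condition extends at once to a node commuting
  with the new one, and this includes a neighbour \<open>i\<close> of \<open>j\<close> along an edge with odd label. As
  the simple roots of \<open>i\<close>, of \<open>j\<close> and of the new node are conjugate, it follows for all of them.
\<close>

lemma complement_spanned_grow:
  assumes T0: "conn T0" "\<And>i. i \<in> T0 \<Longrightarrow> complement_spanned T0 i"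
    and odd_neighbour: "\<And>i. i \<in> T0 \<Longrightarrow> \<exists>j\<in>T0. j \<noteq> i \<and> odd (m j i)"
    and light: "\<And>i k. adj i k \<Longrightarrow> \<not> {i, k} \<subseteq> T0 \<Longrightarrow> m i k = 3"
  shows "complement_spanned UNIV i"
proof -
  define P where "P T \<longleftrightarrow> T0 \<subseteq> T \<and> conn T \<and>
    (\<forall>i\<in>T. complement_spanned T i \<and> (\<exists>j\<in>T. j \<noteq> i \<and> odd (m j i)))" for T
  have "P UNIV"
  proof (rule grow_induct)
    show "P T0" using T0 odd_neighbour by (simp add: P_def)
    show "T0 \<noteq> {}" using T0(1) conn_nonempty by blast
    fix T j k
    assume PT: "P T" and j: "j \<in> T" and k: "k \<notin> T" and jk: "adj j k"
    have conn: "conn T" and sub: "T0 \<subseteq> T" using PT by (auto simp: P_def)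
    have cs: "complement_spanned T i" if "i \<in> T" for i using PT that by (simp add: P_def)
    have odd: "\<exists>l\<in>T. l \<noteq> i \<and> odd (m l i)" if "i \<in> T" for i using PT that by (simp add: P_def)
    have "m j k = 3" using light[OF jk] k sub by blast
    then have "odd (m j k)" by simp
    have "j \<noteq> k" using j k by blast
    have 1: "complement_spanned (insert k T) i" if "i \<in> T" "i \<noteq> j" for i
    proof (rule complement_spanned_insert[OF cs[OF that(1)]])
      have "\<not> adj i k" using unique_neighbour[OF conn k that(1) j _ jk] that(2) by blast
      moreover have "i \<noteq> k" using that k by blast
      ultimately show "m i k = 2" using not_adj by blast
    qed
    obtain l where l: "l \<in> T" "l \<noteq> j" "odd (m l j)" using odd[OF j] by blast
    have 2: "complement_spanned (insert k T) j"
      by (rule complement_spanned_odd[OF 1[OF l(1,2)] _ _ l(2,3)]) (use l j in auto)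
    have 3: "complement_spanned (insert k T) k"
      by (rule complement_spanned_odd[OF 2 _ _ \<open>j \<noteq> k\<close> \<open>odd (m j k)\<close>]) (use j in auto)
    have "complement_spanned (insert k T) i" if "i \<in> insert k T" for i
      using 1[of i] 2 3 that by (cases "i = k"; cases "i = j") auto
    moreover have "\<exists>l\<in>insert k T. l \<noteq> i \<and> odd (m l i)" if "i \<in> insert k T" for i
      using odd[of i] that \<open>odd (m j k)\<close> \<open>j \<noteq> k\<close> j by (cases "i = k") auto
    moreover have "conn (insert k T)" using conn_insert[OF conn j k jk] .
    ultimately show "P (insert k T)" using sub unfolding P_def by blast
  qed
  then show ?thesis by (simp add: P_def)
qed

text \<open>
  The third root orthogonal to a leaf \<open>p\<close>, besides the two other leaves, is the highest root. The
  word carries the commuting pair \<open>q\<close>, \<open>r\<close> to \<open>p\<close> and the highest root.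
\<close>

lemma D4_leaf_spanned:
  assumes adj: "adj c p" "adj c q" "adj c r" and dist: "distinct [p, q, r]"
    and label: "m c p = 3" "m c q = 3" "m c r = 3"
  shows "complement_spanned {c, p, q, r} p"
  unfolding complement_spanned_def
proof (intro allI impI)
  fix x
  assume supp: "\<forall>k. k \<notin> {c, p, q, r} \<longrightarrow> x $ k = 0" and x: "B (e p) x = 0"
  have ne: "c \<noteq> p" "c \<noteq> q" "c \<noteq> r" using adj by (auto simp: adj_def)
  have com: "m p q = 2" "m p r = 2" "m q r = 2"
    using no_triangle[OF adj_sym[OF adj(1)] adj(2)] no_triangle[OF adj_sym[OF adj(1)] adj(3)]
      no_triangle[OF adj_sym[OF adj(2)] adj(3)] dist by auto
  have B1: "B (e c) (e p) = - 1 / 2" "B (e c) (e q) = - 1 / 2" "B (e c) (e r) = - 1 / 2"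
    "B (e p) (e q) = 0" "B (e p) (e r) = 0" "B (e q) (e r) = 0"
    using label com B_eq_3 B_commuting by auto
  have B2: "B (e p) (e c) = - 1 / 2" "B (e q) (e c) = - 1 / 2" "B (e r) (e c) = - 1 / 2"
    "B (e q) (e p) = 0" "B (e r) (e p) = 0" "B (e r) (e q) = 0"
    using B1 B_sym by metis+
  define comb where "comb t u v w = t *\<^sub>R e c + u *\<^sub>R e p + v *\<^sub>R e q + w *\<^sub>R e r" for t u v w
  have refl: "reflection m (e c) (comb t u v w) = comb (u + v + w - t) u v w"
    "reflection m (e p) (comb t u v w) = comb t (t - u) v w"
    "reflection m (e q) (comb t u v w) = comb t u (t - v) w" for t u v w
    by (simp_all add: comb_def reflection_def form_simps B1 B2 vec_eq_iff algebra_simps)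
  let ?w = "[c, q, p, c]"
  have "act m ?w (comb 0 0 1 0) = comb 0 1 0 0" "act m ?w (comb 0 0 0 1) = comb 2 1 1 1"
    by (simp_all add: act_Cons refl)
  then have "act m ?w (e q) = e p" "act m ?w (e r) = comb 2 1 1 1"
    by (simp_all add: comb_def)
  then have "strongly_orth (e p) (comb 2 1 1 1)"
    using strongly_orthI[OF com(3), of ?w] by simp
  moreover have "strongly_orth (e p) (e q)" "strongly_orth (e p) (e r)"
    using com by (auto intro: strongly_orth_simple)
  ultimately have "(x $ c / 2) *\<^sub>R comb 2 1 1 1 + (x $ q - x $ c / 2) *\<^sub>R e q
      + (x $ r - x $ c / 2) *\<^sub>R e r \<in> span {c. strongly_orth (e p) c}"
    by (intro span_add span_scale span_base) auto
  moreover have expand: "x = comb (x $ c) (x $ p) (x $ q) (x $ r)"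
    using support_expand[of "{c, p, q, r}" x] supp ne dist by (simp add: comb_def add.assoc)
  moreover have "x $ p = x $ c / 2"
  proof -
    have "B (e p) (comb (x $ c) (x $ p) (x $ q) (x $ r)) = x $ p - x $ c / 2"
      by (simp add: comb_def form_simps B1 B2)
    then show ?thesis using x expand by simp
  qed
  moreover have "comb t (t / 2) v w = (t / 2) *\<^sub>R comb 2 1 1 1 + (v - t / 2) *\<^sub>R e q + (w - t / 2) *\<^sub>R e r" for t v w
    by (simp add: comb_def vec_eq_iff algebra_simps)
  ultimately show "x \<in> span {c. strongly_orth (e p) c}" by metis
qed

text \<open>
  For the angle \<open>\<theta> = \<pi> / 5\<close> the cosines of \<open>3 \<theta>\<close> and \<open>2 \<theta>\<close> are opposite; the cubic equation for
  \<open>cos \<theta>\<close> that results has the spurious root \<open>-1\<close>.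
\<close>

lemma golden_ratio: "(2 * cos (pi / 5))\<^sup>2 = 2 * cos (pi / 5) + (1::real)"
proof -
  let ?c = "cos (pi / 5) :: real"
  have "cos (3 * (pi / 5)) = - cos (pi - 3 * (pi / 5))" by (simp only: cos_pi_minus minus_minus)
  also have "pi - 3 * (pi / 5) = 2 * (pi / 5)" by simp
  finally have "4 * ?c ^ 3 - 3 * ?c = 1 - 2 * ?c\<^sup>2"
    using cos_treble_cos[of "pi / 5"] cos_double_cos[of "pi / 5"] by simp
  then have "(?c + 1) * (4 * ?c\<^sup>2 - 2 * ?c - 1) = 0" by (simp add: algebra_simps power2_eq_square power3_eq_cube)
  moreover have "0 < ?c" by (intro cos_gt_zero) auto
  ultimately have "4 * ?c\<^sup>2 - 2 * ?c - 1 = 0" by simp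
  then show ?thesis by (simp add: power2_eq_square)
qed

text \<open>
  The orthogonal roots \<open>e a\<close>, \<open>e c\<close> belong to an orthogonal frame of roots, and the word carries
  them to \<open>e c\<close> and the third member of the frame.
\<close>

lemma H3_leaf_spanned:
  assumes ab: "m a b = 5" and bc: "adj b c" "m b c = 3" and ac: "a \<noteq> c"
  shows "complement_spanned {a, b, c} c"
  unfolding complement_spanned_def
proof (intro allI impI)
  fix x
  assume supp: "\<forall>k. k \<notin> {a, b, c} \<longrightarrow> x $ k = 0" and x: "B (e c) x = 0"
  have "adj a b" using ab by (auto simp: adj_def)
  then have ne: "a \<noteq> b" "b \<noteq> c" using bc by (auto simp: adj_def)
  have com: "m a c = 2" "m c a = 2" using no_triangle[OF \<open>adj a b\<close> bc(1) ac] m_sym[of a c] by auto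
  define g where "g = 2 * cos (pi / 5 :: real)"
  have g: "g * g = g + 1" using golden_ratio by (simp add: g_def power2_eq_square)
  have "0 < g" unfolding g_def by (intro mult_pos_pos cos_gt_zero) auto
  have B1: "B (e a) (e b) = - g / 2" "B (e b) (e c) = - 1 / 2" "B (e a) (e c) = 0"
    using ab bc com B_eq_3 B_commuting by (auto simp: form_axis g_def)
  have B2: "B (e b) (e a) = - g / 2" "B (e c) (e b) = - 1 / 2" "B (e c) (e a) = 0"
    using B1 B_sym by metis+
  define comb where "comb t u v = t *\<^sub>R e a + u *\<^sub>R e b + v *\<^sub>R e c" for t u v
  have refl: "reflection m (e a) (comb t u v) = comb (g * u - t) u v"
    "reflection m (e b) (comb t u v) = comb t (g * t + v - u) v"
    "reflection m (e c) (comb t u v) = comb t u (u - v)" for t u v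
    by (simp_all add: comb_def reflection_def form_simps B1 B2 vec_eq_iff algebra_simps)
  let ?w = "[b, c, a, b, a, b]"
  have g': "g * (g * z) = g * z + z" for z using g by (simp add: mult.assoc[symmetric] distrib_right)
  have "act m ?w (comb 1 0 0) = comb 0 0 1" "act m ?w (comb 0 0 1) = comb (g + 1) (2 * g) g"
    by (simp_all add: act_Cons refl algebra_simps g g')
  then have "act m ?w (e a) = e c" "act m ?w (e c) = comb (g + 1) (2 * g) g"
    by (simp_all add: comb_def)
  then have "strongly_orth (e c) (comb (g + 1) (2 * g) g)"
    using strongly_orthI[OF com(1), of ?w] by simp
  moreover have "strongly_orth (e c) (e a)" using com by (auto intro: strongly_orth_simple)
  ultimately have "(x $ b / (2 * g)) *\<^sub>R comb (g + 1) (2 * g) g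
      + (x $ a - x $ b * g / 2) *\<^sub>R e a \<in> span {y. strongly_orth (e c) y}"
    by (intro span_add span_scale span_base) auto
  moreover have expand: "x = comb (x $ a) (x $ b) (x $ c)"
    using support_expand[of "{a, b, c}" x] supp ne ac by (simp add: comb_def add.assoc)
  moreover have "x $ c = x $ b / 2"
  proof -
    have "B (e c) (comb (x $ a) (x $ b) (x $ c)) = x $ c - x $ b / 2"
      by (simp add: comb_def form_simps B1 B2)
    then show ?thesis using x expand by simp
  qed
  moreover have "comb t u (u / 2) = (u / (2 * g)) *\<^sub>R comb (g + 1) (2 * g) g + (t - u * g / 2) *\<^sub>R e a" for t u
  proof -
    have "u / (2 * g) * (g + 1) = u * g / 2" using \<open>0 < g\<close> by (simp add: field_simps g g')
    moreover have "u / (2 * g) * (2 * g) = u" "u / (2 * g) * g = u / 2" using \<open>0 < g\<close> by auto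
    ultimately show ?thesis using \<open>0 < g\<close> by (simp add: comb_def scaleR_add_right scaleR_diff_left)
  qed
  ultimately show "x \<in> span {y. strongly_orth (e c) y}" by metis
qed

text \<open>
  Besides \<open>e b\<close> and \<open>e q\<close> one more root strongly orthogonal to \<open>e p\<close> is needed. The word carries the
  commuting pair \<open>a\<close>, \<open>q\<close> to \<open>e p\<close> and such a root; here \<open>p\<close> and \<open>a\<close> are conjugate, being joined
  by an edge with label 3.
\<close>

lemma F4_leaf_spanned:
  assumes ab: "m a b = 4" and adj: "adj p a" "adj b q" and dist: "p \<noteq> b" "a \<noteq> q"
    and label: "m p a = 3" "m b q = 3"
  shows "complement_spanned {p, a, b, q} p" "m p q = 2" "conn {p, a, b, q}"
proof -
  have adj_ab: "adj a b" using ab by (auto simp: adj_def)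
  have com: "m p b = 2" "m a q = 2"
    using no_triangle[OF adj(1) adj_ab dist(1)] no_triangle[OF adj_ab adj(2) dist(2)] by auto
  have ne: "p \<noteq> a" "a \<noteq> b" "b \<noteq> q" using adj adj_ab by (auto simp: adj_def)
  have pq: "p \<noteq> q" using com adj m_sym[of p b] by (auto simp: adj_def)
  have "conn {a, p}" using conn_insert[OF conn_single, of p p a] adj(1) ne by auto
  then have c3: "conn {b, a, p}" using conn_insert[of "{a, p}" a b] adj_ab ne dist by auto
  then have "conn {q, b, a, p}" using conn_insert[OF c3, of b q] adj(2) ne dist pq by auto
  then show "conn {p, a, b, q}" by (simp add: insert_commute)
  have "\<not> adj p q" using unique_neighbour[OF c3, of q p b] adj ne dist pq by auto
  then show com3: "m p q = 2" using not_adj pq by blast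
  show "complement_spanned {p, a, b, q} p"
    unfolding complement_spanned_def
  proof (intro allI impI)
    fix x
    assume supp: "\<forall>k. k \<notin> {p, a, b, q} \<longrightarrow> x $ k = 0" and x: "B (e p) x = 0"
    define s where "s = sqrt (2::real)"
    have s: "s * s = 2" "s \<noteq> 0" by (simp_all add: s_def)
    have s': "s * (s * z) = 2 * z" for z using s by (simp add: mult.assoc[symmetric])
    have B1: "B (e p) (e a) = - 1 / 2" "B (e p) (e b) = 0" "B (e p) (e q) = 0"
      "B (e a) (e b) = - s / 2" "B (e a) (e q) = 0" "B (e b) (e q) = - 1 / 2"
      using label ab com com3 B_eq_3 B_eq_4 B_commuting by (auto simp: s_def)
    have B2: "B (e a) (e p) = - 1 / 2" "B (e b) (e p) = 0" "B (e q) (e p) = 0"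
      "B (e b) (e a) = - s / 2" "B (e q) (e a) = 0" "B (e q) (e b) = - 1 / 2"
      using B1 B_sym by metis+
    define comb where "comb t u v w = t *\<^sub>R e p + u *\<^sub>R e a + v *\<^sub>R e b + w *\<^sub>R e q" for t u v w
    have refl: "reflection m (e p) (comb t u v w) = comb (u - t) u v w"
      "reflection m (e a) (comb t u v w) = comb t (t + s * v - u) v w"
      "reflection m (e b) (comb t u v w) = comb t u (s * u + w - v) w" for t u v w
      by (simp_all add: comb_def reflection_def form_simps B1 B2 vec_eq_iff algebra_simps)
    let ?w = "[a, b, p, a, b]"
    have "act m ?w (comb 0 1 0 0) = comb 1 0 0 0" "act m ?w (comb 0 0 0 1) = comb s (2 * s) 2 1"
      by (simp_all add: act_Cons refl algebra_simps s s')
    then have "act m ?w (e a) = e p" "act m ?w (e q) = comb s (2 * s) 2 1"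
      by (simp_all add: comb_def)
    then have "strongly_orth (e p) (comb s (2 * s) 2 1)"
      using strongly_orthI[OF com(2), of ?w] by simp
    moreover have "strongly_orth (e p) (e b)" "strongly_orth (e p) (e q)"
      using com com3 by (auto intro: strongly_orth_simple)
    ultimately have "(x $ a / (2 * s)) *\<^sub>R comb s (2 * s) 2 1 + (x $ b - x $ a / s) *\<^sub>R e b
        + (x $ q - x $ a / (2 * s)) *\<^sub>R e q \<in> span {c. strongly_orth (e p) c}"
      by (intro span_add span_scale span_base) auto
    moreover have expand: "x = comb (x $ p) (x $ a) (x $ b) (x $ q)"
      using support_expand[of "{p, a, b, q}" x] supp ne dist pq by (simp add: comb_def add.assoc)
    moreover have "x $ p = x $ a / 2"
    proof -
      have "B (e p) (comb (x $ p) (x $ a) (x $ b) (x $ q)) = x $ p - x $ a / 2"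
        by (simp add: comb_def form_simps B1 B2)
      then show ?thesis using x expand by simp
    qed
    moreover have "comb (u / 2) u v w = (u / (2 * s)) *\<^sub>R comb s (2 * s) 2 1
        + (v - u / s) *\<^sub>R e b + (w - u / (2 * s)) *\<^sub>R e q" for u v w
    proof -
      have "u / (2 * s) * (2 * s) = u" "u / (2 * s) * s = u / 2" "u / (2 * s) * 2 = u / s"
        using s(2) by auto
      then show ?thesis
        by (simp add: comb_def scaleR_add_right scaleR_diff_left)
    qed
    ultimately show "x \<in> span {c. strongly_orth (e p) c}" by metis
  qed
qed

theorem strongly_orth_span:
  assumes rank: "CARD('n) \<ge> 3"
    and A: "\<not> of_coxeter_type m cox_A" and B: "\<not> of_coxeter_type m cox_B"
  shows "B (e i) x = 0 \<Longrightarrow> x \<in> span {c. strongly_orth (e i) c}"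
proof -
  have "complement_spanned UNIV i"
    using rank A B
  proof (cases rule: base_subdiagram)
    case (D4 c p q r)
    let ?T = "{c, p, q, r}"
    have lab: "m c p = 3" "m c q = 3" "m c r = 3" using D4 by auto
    have ne: "c \<noteq> p" "c \<noteq> q" "c \<noteq> r" using D4 by (auto simp: adj_def)
    have "conn {p, c}" using conn_insert[OF conn_single, of c c p] D4(1) ne by auto
    then have "conn {q, p, c}" using conn_insert[of "{p, c}" c q] D4 ne by auto
    then have "conn {r, q, p, c}" using conn_insert[of "{q, p, c}" c r] D4 ne by auto
    then have conn: "conn ?T" by (simp add: insert_commute)
    have p: "complement_spanned ?T p" using D4_leaf_spanned[OF D4(1-4) lab] .
    have "complement_spanned {c, q, p, r} q"
      using D4_leaf_spanned[of c q p r] D4(1-4) lab by auto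
    then have q: "complement_spanned ?T q" by (simp add: insert_commute)
    have "complement_spanned {c, r, p, q} r"
      using D4_leaf_spanned[of c r p q] D4(1-4) lab by auto
    then have r: "complement_spanned ?T r" by (simp add: insert_commute)
    have c: "complement_spanned ?T c"
      by (rule complement_spanned_odd[OF p]) (use ne lab m_sym[of p c] in auto)
    show ?thesis
    proof (rule complement_spanned_grow[OF conn])
      show "complement_spanned ?T j" if "j \<in> ?T" for j using that p q r c by blast
      show "\<exists>l\<in>?T. l \<noteq> j \<and> odd (m l j)" if "j \<in> ?T" for j
        using that ne lab m_sym[of p c] by auto
    qed (use D4(5) in blast)
  next
    case (H3 a b c)
    let ?T = "{a, b, c}"
    have "adj a b" using H3(1) by (auto simp: adj_def)
    then have ne: "a \<noteq> b" "b \<noteq> c" using H3 by (auto simp: adj_def)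
    have bc: "m b c = 3" using H3(4)[OF H3(2)] ne H3(3) by (auto simp: doubleton_eq_iff)
    have "conn {b, a}" using conn_insert[OF conn_single, of a a b] \<open>adj a b\<close> ne by auto
    then have "conn {c, b, a}" using conn_insert[of "{b, a}" b c] H3 ne by auto
    then have conn: "conn ?T" by (simp add: insert_commute)
    have c: "complement_spanned ?T c" using H3_leaf_spanned[OF H3(1,2) bc H3(3)] .
    have b: "complement_spanned ?T b"
      by (rule complement_spanned_odd[OF c]) (use ne bc m_sym[of c b] in auto)
    have a: "complement_spanned ?T a"
      by (rule complement_spanned_odd[OF b]) (use ne H3(1) m_sym[of b a] in auto)
    show ?thesis
    proof (rule complement_spanned_grow[OF conn])
      show "complement_spanned ?T j" if "j \<in> ?T" for j using that a b c by blast
      show "\<exists>l\<in>?T. l \<noteq> j \<and> odd (m l j)" if "j \<in> ?T" for j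
        using that ne bc H3(1) m_sym[of b a] m_sym[of c b] by auto
    qed (use H3(4) in auto)
  next
    case (F4 p a b q)
    let ?T = "{p, a, b, q}"
    have ne: "p \<noteq> a" "b \<noteq> q" using F4 by (auto simp: adj_def)
    have pa: "m p a = 3" using F4(6)[OF F4(2)] ne F4(4) by (auto simp: doubleton_eq_iff)
    have bq: "m b q = 3" using F4(6)[OF F4(3)] ne F4(5) by (auto simp: doubleton_eq_iff)
    note F = F4_leaf_spanned[OF F4(1-5) pa bq]
    have "complement_spanned {q, b, a, p} q"
      using F4_leaf_spanned(1)[of b a q p] F4 pa bq adj_sym m_sym[of b a] m_sym[of q b] m_sym[of a p]
      by auto
    then have q: "complement_spanned ?T q" by (simp add: insert_commute)
    have a: "complement_spanned ?T a"
      by (rule complement_spanned_odd[OF F(1)]) (use ne pa in auto)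
    have b: "complement_spanned ?T b"
      by (rule complement_spanned_odd[OF q]) (use ne bq m_sym[of q b] in auto)
    show ?thesis
    proof (rule complement_spanned_grow[OF F(3)])
      show "complement_spanned ?T j" if "j \<in> ?T" for j using that a b q F(1) by blast
      show "\<exists>l\<in>?T. l \<noteq> j \<and> odd (m l j)" if "j \<in> ?T" for j
        using that ne pa bq m_sym[of a p] m_sym[of q b] by auto
    qed (use F4(6) in auto)
  qed
  then show "B (e i) x = 0 \<Longrightarrow> x \<in> span {c. strongly_orth (e i) c}"
    by (simp add: complement_spanned_def)
qed

end

section \<open>Residues of the flatness condition\<close>

lemma linear_equationD:
  assumes "linear_equation H \<phi>"
  shows "\<phi> (x + y) = \<phi> x + \<phi> y" "\<phi> (c *s x) = c * \<phi> x" "\<phi> x = 0 \<longleftrightarrow> x \<in> H"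
  using assms unfolding linear_equation_def Vector_Spaces.linear_iff by auto

lemma scaleR_eq_vector_scalar_mult: "t *\<^sub>R (x :: complex ^ 'n) = complex_of_real t *s x"
  unfolding vec_eq_iff vector_scaleR_component vector_smult_component
  by (simp add: scaleR_conv_of_real)

lemma linear_equation_bounded_linear:
  fixes \<phi> :: "complex ^ 'n::finite \<Rightarrow> complex"
  assumes "linear_equation H \<phi>"
  shows "bounded_linear \<phi>"
  by (intro linear_conv_bounded_linear[THEN iffD1] linearI)
    (simp_all add: linear_equationD[OF assms] scaleR_eq_vector_scalar_mult scaleR_conv_of_real)

text \<open>Both sides vanish on the hyperplane itself, because division by zero gives zero.\<close>

lemma omega_eq:
  assumes "linear_equation H \<phi>"
  shows "omega H z v = \<phi> v / \<phi> z"
proof -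
  let ?\<psi> = "SOME \<phi>. linear_equation H \<phi>"
  have \<psi>: "linear_equation H ?\<psi>" by (rule someI[of "linear_equation H", OF assms])
  show ?thesis
  proof (cases "z \<in> H")
    case True
    then show ?thesis
      using linear_equationD(3)[OF \<psi>, of z] linear_equationD(3)[OF assms, of z]
      by (simp add: omega_def)
  next
    case False
    have z: "?\<psi> z \<noteq> 0" "\<phi> z \<noteq> 0"
      using False linear_equationD(3)[OF \<psi>] linear_equationD(3)[OF assms] by blast+
    define c where "c = - (\<phi> v / \<phi> z)"
    have "\<phi> (v + c *s z) = \<phi> v + c * \<phi> z"
      by (simp only: linear_equationD(1,2)[OF assms])
    also have "\<dots> = 0" using z by (simp add: c_def)
    finally have "\<phi> (v + c *s z) = 0" .
    then have "v + c *s z \<in> H" using linear_equationD(3)[OF assms] by blast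
    then have "?\<psi> (v + c *s z) = 0" using linear_equationD(3)[OF \<psi>] by blast
    then have "?\<psi> v + c * ?\<psi> z = 0"
      by (simp only: linear_equationD(1,2)[OF \<psi>])
    then have "?\<psi> v = \<phi> v / \<phi> z * ?\<psi> z"
      by (simp add: c_def)
    then have "?\<psi> v / ?\<psi> z = \<phi> v / \<phi> z"
      using z(1) by simp
    then show ?thesis by (simp add: omega_def Let_def)
  qed
qed

lemma vector_scalar_mult_sum_right: "c *s (\<Sum>i\<in>A. v i) = (\<Sum>i\<in>A. c *s (v i :: complex ^ 'n))"
  by (simp add: vec_eq_iff sum_distrib_left)

lemma bounded_linear_vector_scalar_mult: "bounded_linear (\<lambda>c. c *s (w :: complex ^ 'n::finite))"
  by (intro linear_conv_bounded_linear[THEN iffD1] linearI)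
    (simp_all add: vec_eq_iff distrib_right)

lemma holomorphic_field_const: "holomorphic_field U (\<lambda>_. q)"
  unfolding holomorphic_field_def by (intro ballI exI[of _ "\<lambda>_. 0"]) simp

lemma frechet_derivative_const': "frechet_derivative (\<lambda>_. c) (at z) = (\<lambda>_. 0)"
  by (rule frechet_derivative_at[OF has_derivative_const, symmetric])

text \<open>
  For constant vector fields the curvature consists of the terms quadratic in the connection
  form: the derivatives of the connection form are symmetric in the two directions.
\<close>

lemma flat_quadratic:
  fixes \<H> :: "(complex ^ 'n::finite) set set"
  assumes fin: "finite \<H>" and flat: "dunkl_flat \<H> ip \<kappa>"
    and f: "\<And>H. H \<in> \<H> \<Longrightarrow> linear_equation H (f H)"
    and p: "\<And>H. H \<in> \<H> \<Longrightarrow> Vector_Spaces.linear vector_scalar_mult vector_scalar_mult (orth_proj ip H)"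
    and z: "z \<in> arr_complement \<H>"
  shows "(\<Sum>H\<in>\<H>. \<Sum>K\<in>\<H>. (f H q * f K b - f H b * f K q) / (f H z * f K z) *s
    ((\<kappa> H * \<kappa> K) *s orth_proj ip H (orth_proj ip K u))) = 0"
proof -
  define nab where "nab = dunkl_nabla \<H> ip \<kappa>"
  define A where "A v y = (\<Sum>H\<in>\<H>. (f H v / f H y) *s (\<kappa> H *s orth_proj ip H u))" for v y
  have fz: "f H z \<noteq> 0" if "H \<in> \<H>" for H
    using z that linear_equationD(3)[OF f[OF that]] by (auto simp: arr_complement_def)
  have nab_const: "nab (\<lambda>_. v) (\<lambda>_. u) y = - A v y" for v y
    unfolding nab_def dunkl_nabla_def A_def frechet_derivative_const'
    by (simp add: omega_eq[OF f] cong: sum.cong)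
  have deriv: "frechet_derivative (\<lambda>y. - A v y) (at z) w =
      (\<Sum>H\<in>\<H>. (f H v * f H w / (f H z * f H z)) *s (\<kappa> H *s orth_proj ip H u))" for v w
  proof -
    have "((\<lambda>y. (f H v / f H y) *s (\<kappa> H *s orth_proj ip H u)) has_derivative
        (\<lambda>w. (- (f H v * f H w / (f H z * f H z))) *s (\<kappa> H *s orth_proj ip H u))) (at z)"
      if "H \<in> \<H>" for H
    proof -
      have "(f H has_derivative f H) (at z)"
        by (rule bounded_linear_imp_has_derivative[OF linear_equation_bounded_linear[OF f[OF that]]])
      then have "((\<lambda>y. f H v / f H y) has_derivative (\<lambda>w. - (f H v * f H w / (f H z * f H z)))) (at z)"
        using fz[OF that] by (auto intro!: derivative_eq_intros simp: field_simps)
      from bounded_linear.has_derivative[OF bounded_linear_vector_scalar_mult this]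
      show ?thesis .
    qed
    then have "(A v has_derivative
        (\<lambda>w. \<Sum>H\<in>\<H>. (- (f H v * f H w / (f H z * f H z))) *s (\<kappa> H *s orth_proj ip H u))) (at z)"
      unfolding A_def by (rule has_derivative_sum)
    from frechet_derivative_at[OF has_derivative_minus[OF this], symmetric] show ?thesis
      by (simp add: sum_negf[symmetric] vec.scale_minus_left)
  qed
  have nab2: "nab (\<lambda>_. v) (nab (\<lambda>_. w) (\<lambda>_. u)) z =
    (\<Sum>H\<in>\<H>. (f H w * f H v / (f H z * f H z)) *s (\<kappa> H *s orth_proj ip H u)) +
    (\<Sum>H\<in>\<H>. \<Sum>K\<in>\<H>. (f H v * f K w / (f H z * f K z)) *s
      ((\<kappa> H * \<kappa> K) *s orth_proj ip H (orth_proj ip K u)))" for v w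
  proof -
    have proj: "orth_proj ip H (- A w z) =
        (\<Sum>K\<in>\<H>. - ((f K w / f K z * \<kappa> K) *s orth_proj ip H (orth_proj ip K u)))" if "H \<in> \<H>" for H
    proof -
      have add: "orth_proj ip H (x + y) = orth_proj ip H x + orth_proj ip H y"
        and scale: "orth_proj ip H (c *s x) = c *s orth_proj ip H x" for x y c
        using p[OF that] unfolding Vector_Spaces.linear_iff by auto
      interpret additive "orth_proj ip H" by standard (rule add)
      show ?thesis by (simp add: A_def minus sum scale sum_negf vec.scale_scale)
    qed
    have "nab (\<lambda>_. v) (nab (\<lambda>_. w) (\<lambda>_. u)) z = frechet_derivative (\<lambda>y. - A w y) (at z) v -
        (\<Sum>H\<in>\<H>. (f H v / f H z) *s (\<kappa> H *s orth_proj ip H (- A w z)))"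
      unfolding nab_const[abs_def] by (simp add: nab_def dunkl_nabla_def omega_eq[OF f] cong: sum.cong)
    also have "(\<Sum>H\<in>\<H>. (f H v / f H z) *s (\<kappa> H *s orth_proj ip H (- A w z))) =
      - (\<Sum>H\<in>\<H>. \<Sum>K\<in>\<H>. (f H v * f K w / (f H z * f K z)) *s
      ((\<kappa> H * \<kappa> K) *s orth_proj ip H (orth_proj ip K u)))"
      by (simp add: proj vector_scalar_mult_sum_right sum_negf[symmetric] vec.scale_scale
          vec.scale_minus_right field_simps cong: sum.cong)
    finally show ?thesis unfolding deriv by simp
  qed
  have "nab (lie_bracket (\<lambda>_. q) (\<lambda>_. b)) (\<lambda>_. u) z = 0"
  proof -
    have "lie_bracket (\<lambda>_. q) (\<lambda>_. b) = (\<lambda>_. 0)"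
      by (simp add: fun_eq_iff lie_bracket_def frechet_derivative_const')
    moreover have "f H 0 = 0" if "H \<in> \<H>" for H
      using linear_equationD(2)[OF f[OF that], of 0 0] by simp
    ultimately show ?thesis
      using nab_const[of 0 z] by (simp add: A_def)
  qed
  moreover have "nab (\<lambda>_. q) (nab (\<lambda>_. b) (\<lambda>_. u)) z - nab (\<lambda>_. b) (nab (\<lambda>_. q) (\<lambda>_. u)) z -
      nab (lie_bracket (\<lambda>_. q) (\<lambda>_. b)) (\<lambda>_. u) z = 0"
    using flat z holomorphic_field_const unfolding dunkl_flat_def Let_def nab_def by blast
  ultimately have "nab (\<lambda>_. q) (nab (\<lambda>_. b) (\<lambda>_. u)) z = nab (\<lambda>_. b) (nab (\<lambda>_. q) (\<lambda>_. u)) z"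
    by simp
  then have "(\<Sum>H\<in>\<H>. \<Sum>K\<in>\<H>. (f H q * f K b / (f H z * f K z)) *s
      ((\<kappa> H * \<kappa> K) *s orth_proj ip H (orth_proj ip K u))) =
    (\<Sum>H\<in>\<H>. \<Sum>K\<in>\<H>. (f H b * f K q / (f H z * f K z)) *s
      ((\<kappa> H * \<kappa> K) *s orth_proj ip H (orth_proj ip K u)))"
    unfolding nab2 by (simp add: mult.commute)
  then show ?thesis
    by (simp only: diff_divide_distrib vec.scale_left_diff_distrib sum_subtractf diff_self)
qed

text \<open>
  Along the curve \<open>a + t b + t\<^sup>2 q\<close> a linear form takes the values \<open>\<alpha> + t \<beta> + t\<^sup>2 \<gamma>\<close>. The first
  nonzero coefficient decides which of the logarithmic forms in the directions \<open>t\<^sup>2 q\<close> and \<open>t b\<close>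
  survives as \<open>t\<close> tends to 0.
\<close>

lemma curve_limits:
  fixes \<alpha> \<beta> \<gamma> :: complex
  defines "x \<equiv> \<lambda>t. \<alpha> + complex_of_real t * \<beta> + (complex_of_real t)\<^sup>2 * \<gamma>"
  defines "p \<equiv> \<lambda>t. (complex_of_real t)\<^sup>2 * \<gamma> / x t"
  defines "s \<equiv> \<lambda>t. complex_of_real t * \<beta> / x t"
  shows "\<alpha> \<noteq> 0 \<Longrightarrow> (p \<longlongrightarrow> 0) (at_right 0) \<and> (s \<longlongrightarrow> 0) (at_right 0) \<and> eventually (\<lambda>t. x t \<noteq> 0) (at_right 0)"
    and "\<alpha> = 0 \<Longrightarrow> \<beta> \<noteq> 0 \<Longrightarrow> (p \<longlongrightarrow> 0) (at_right 0) \<and> (s \<longlongrightarrow> 1) (at_right 0) \<and> eventually (\<lambda>t. x t \<noteq> 0) (at_right 0)"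
    and "\<alpha> = 0 \<Longrightarrow> \<beta> = 0 \<Longrightarrow> \<gamma> \<noteq> 0 \<Longrightarrow> (p \<longlongrightarrow> 1) (at_right 0) \<and> (s \<longlongrightarrow> 0) (at_right 0) \<and> eventually (\<lambda>t. x t \<noteq> 0) (at_right 0)"
proof -
  have pos: "eventually (\<lambda>t. t > 0) (at_right (0::real))"
    by (rule eventually_at_right_less)
  show "(p \<longlongrightarrow> 0) (at_right 0) \<and> (s \<longlongrightarrow> 0) (at_right 0) \<and> eventually (\<lambda>t. x t \<noteq> 0) (at_right 0)"
    if \<alpha>: "\<alpha> \<noteq> 0"
  proof (intro conjI)
    have x: "(x \<longlongrightarrow> \<alpha>) (at_right 0)"
      unfolding x_def by (auto intro!: tendsto_eq_intros)
    show "(p \<longlongrightarrow> 0) (at_right 0)" "(s \<longlongrightarrow> 0) (at_right 0)"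
      unfolding p_def s_def using \<alpha> x by (auto intro!: tendsto_eq_intros)
    show "eventually (\<lambda>t. x t \<noteq> 0) (at_right 0)"
      using tendsto_imp_eventually_ne[OF x \<alpha>] .
  qed
  show "(p \<longlongrightarrow> 0) (at_right 0) \<and> (s \<longlongrightarrow> 1) (at_right 0) \<and> eventually (\<lambda>t. x t \<noteq> 0) (at_right 0)"
    if \<alpha>: "\<alpha> = 0" and \<beta>: "\<beta> \<noteq> 0"
  proof (intro conjI)
    define y where "y t = \<beta> + complex_of_real t * \<gamma>" for t
    have xy: "x t = complex_of_real t * y t" for t
      by (simp add: x_def y_def \<alpha> algebra_simps power2_eq_square)
    have y: "(y \<longlongrightarrow> \<beta>) (at_right 0)"
      unfolding y_def by (auto intro!: tendsto_eq_intros)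
    have "((\<lambda>t. complex_of_real t * \<gamma> / y t) \<longlongrightarrow> 0) (at_right 0)" "((\<lambda>t. \<beta> / y t) \<longlongrightarrow> 1) (at_right 0)"
      using \<beta> y by (auto intro!: tendsto_eq_intros)
    moreover have "eventually (\<lambda>t. complex_of_real t * \<gamma> / y t = p t) (at_right 0)"
      "eventually (\<lambda>t. \<beta> / y t = s t) (at_right 0)"
      by (rule eventually_mono[OF pos], simp add: p_def s_def xy power2_eq_square)+
    ultimately show "(p \<longlongrightarrow> 0) (at_right 0)" "(s \<longlongrightarrow> 1) (at_right 0)"
      by (auto intro: Lim_transform_eventually)
    show "eventually (\<lambda>t. x t \<noteq> 0) (at_right 0)"
      by (rule eventually_mono[OF eventually_conj[OF tendsto_imp_eventually_ne[OF y \<beta>] pos]]) (simp add: xy)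
  qed
  show "(p \<longlongrightarrow> 1) (at_right 0) \<and> (s \<longlongrightarrow> 0) (at_right 0) \<and> eventually (\<lambda>t. x t \<noteq> 0) (at_right 0)"
    if \<alpha>: "\<alpha> = 0" and \<beta>: "\<beta> = 0" and \<gamma>: "\<gamma> \<noteq> 0"
  proof (intro conjI)
    have "eventually (\<lambda>t. 1 = p t) (at_right 0)"
      using pos by (rule eventually_mono) (simp add: p_def x_def \<alpha> \<beta> \<gamma>)
    then show "(p \<longlongrightarrow> 1) (at_right 0)"
      by (rule Lim_transform_eventually[OF tendsto_const])
    show "(s \<longlongrightarrow> 0) (at_right 0)" by (simp add: s_def \<beta>)
    show "eventually (\<lambda>t. x t \<noteq> 0) (at_right 0)"
      using pos by (rule eventually_mono) (simp add: x_def \<alpha> \<beta> \<gamma>)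
  qed
qed

text \<open>
  The curve \<open>a + t b + t\<^sup>2 q\<close> approaches the stratum through \<open>a\<close> first along \<open>H0\<close>. Of all terms
  in the curvature, only those pairing \<open>H0\<close> with another hyperplane through \<open>a\<close> grow like
  \<open>t\<^sup>-\<^sup>3\<close>.
\<close>

theorem dunkl_residue:
  fixes \<H> :: "(complex ^ 'n::finite) set set"
  assumes fin: "finite \<H>" and flat: "dunkl_flat \<H> ip \<kappa>"
    and f: "\<And>H. H \<in> \<H> \<Longrightarrow> linear_equation H (f H)"
    and p: "\<And>H. H \<in> \<H> \<Longrightarrow> Vector_Spaces.linear vector_scalar_mult vector_scalar_mult (orth_proj ip H)"
    and H0: "H0 \<in> \<H>" "a \<in> H0" "b \<in> H0" "q \<notin> H0"
    and L: "\<And>H. H \<in> \<H> \<Longrightarrow> a \<in> H \<Longrightarrow> H \<noteq> H0 \<Longrightarrow> b \<notin> H"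
  shows "(\<Sum>H\<in>{H \<in> \<H>. a \<in> H} - {H0}. (\<kappa> H0 * \<kappa> H) *s
    (orth_proj ip H0 (orth_proj ip H u) - orth_proj ip H (orth_proj ip H0 u))) = 0"
proof -
  define z where "z t = a + complex_of_real t *s b + (complex_of_real t)\<^sup>2 *s q" for t
  define x where "x H t = f H a + complex_of_real t * f H b + (complex_of_real t)\<^sup>2 * f H q" for H t
  have fz: "f H (z t) = x H t" if "H \<in> \<H>" for H t
    by (simp add: z_def x_def linear_equationD[OF f[OF that]])
  define P where "P H t = (complex_of_real t)\<^sup>2 * f H q / x H t" for H t
  define S where "S H t = complex_of_real t * f H b / x H t" for H t
  define C where "C H K = (\<kappa> H * \<kappa> K) *s orth_proj ip H (orth_proj ip K u)" for H K
  let ?L = "{H \<in> \<H>. a \<in> H} - {H0}"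
  have lim: "(P H \<longlongrightarrow> of_bool (H = H0)) (at_right 0) \<and> (S H \<longlongrightarrow> of_bool (H \<in> ?L)) (at_right 0) \<and>
      eventually (\<lambda>t. x H t \<noteq> 0) (at_right 0)" if H: "H \<in> \<H>" for H
  proof -
    have f0: "f H y = 0 \<longleftrightarrow> y \<in> H" for y using linear_equationD(3)[OF f[OF H]] .
    consider "H = H0" | "H \<in> ?L" | "a \<notin> H" using H by blast
    then show ?thesis
    proof cases
      case 1
      then have "f H a = 0" "f H b = 0" "f H q \<noteq> 0" using f0 H0 by auto
      from curve_limits(3)[OF this] show ?thesis
        using 1 by (simp add: P_def[abs_def] S_def[abs_def] x_def[abs_def])
    next
      case 2
      then have "f H a = 0" "f H b \<noteq> 0" using f0 L[OF H] by auto
      from curve_limits(2)[OF this, of "f H q"] show ?thesis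
        using 2 by (simp add: P_def[abs_def] S_def[abs_def] x_def[abs_def])
    next
      case 3
      then have "f H a \<noteq> 0" using f0 by auto
      moreover have "H \<noteq> H0" using 3 H0 by auto
      ultimately show ?thesis
        using 3 curve_limits(1)[of "f H a" "f H q" "f H b"]
        by (simp add: P_def[abs_def] S_def[abs_def] x_def[abs_def])
    qed
  qed
  \<comment> \<open>\<open>t\<^sup>3\<close> times the curvature at \<open>z t\<close> in the directions \<open>q\<close> and \<open>b\<close>\<close>
  define E where "E t = (\<Sum>H\<in>\<H>. \<Sum>K\<in>\<H>. (P H t * S K t - S H t * P K t) *s C H K)" for t
  have "eventually (\<lambda>t. \<forall>H\<in>\<H>. x H t \<noteq> 0) (at_right 0)"
    using lim fin by (simp add: eventually_ball_finite)
  then have "eventually (\<lambda>t. E t = 0) (at_right 0)"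
  proof (rule eventually_mono)
    fix t
    assume nz: "\<forall>H\<in>\<H>. x H t \<noteq> 0"
    have "z t \<notin> H" if "H \<in> \<H>" for H
      using nz fz[OF that] linear_equationD(3)[OF f[OF that], of "z t"] that by simp
    then have "z t \<in> arr_complement \<H>"
      by (simp add: arr_complement_def)
    from flat_quadratic[OF fin flat f p this, of q b u]
    have 0: "(\<Sum>H\<in>\<H>. \<Sum>K\<in>\<H>. (f H q * f K b - f H b * f K q) / (x H t * x K t) *s C H K) = 0"
      by (simp add: C_def fz cong: sum.cong)
    have "P H t * S K t - S H t * P K t =
      (complex_of_real t) ^ 3 * ((f H q * f K b - f H b * f K q) / (x H t * x K t))" for H K
      by (simp add: P_def S_def diff_divide_distrib right_diff_distrib power2_eq_square power3_eq_cube ac_simps)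
    then have "E t = (complex_of_real t) ^ 3 *s
        (\<Sum>H\<in>\<H>. \<Sum>K\<in>\<H>. (f H q * f K b - f H b * f K q) / (x H t * x K t) *s C H K)"
      by (simp add: E_def vector_scalar_mult_sum_right vec.scale_scale)
    then show "E t = 0" using 0 by simp
  qed
  then have "(E \<longlongrightarrow> 0) (at_right 0)"
    by (rule tendsto_eventually)
  moreover have "(E \<longlongrightarrow> (\<Sum>H\<in>\<H>. \<Sum>K\<in>\<H>.
      (of_bool (H = H0) * of_bool (K \<in> ?L) - of_bool (H \<in> ?L) * of_bool (K = H0)) *s C H K)) (at_right 0)"
    unfolding E_def
    by (intro tendsto_sum bounded_linear.tendsto[OF bounded_linear_vector_scalar_mult] tendsto_diff tendsto_mult)
      (use lim in auto)
  ultimately have "(\<Sum>H\<in>\<H>. \<Sum>K\<in>\<H>.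
      (of_bool (H = H0) * of_bool (K \<in> ?L) - of_bool (H \<in> ?L) * of_bool (K = H0)) *s C H K) = 0"
    using tendsto_unique trivial_limit_at_right_real by blast
  moreover have "(\<Sum>H\<in>\<H>. \<Sum>K\<in>\<H>. (of_bool (H = H0) * of_bool (K \<in> ?L)) *s C H K) = (\<Sum>K\<in>?L. C H0 K)"
  proof -
    have "(\<Sum>K\<in>\<H>. (of_bool (H = H0) * of_bool (K \<in> ?L)) *s C H K) =
        (if H = H0 then \<Sum>K\<in>?L. C H0 K else 0)" for H
    proof -
      have "(\<Sum>K\<in>\<H>. of_bool (K \<in> ?L) *s C H0 K) = (\<Sum>K\<in>?L. C H0 K)"
        by (rule sum.mono_neutral_cong_right) (use fin in auto)
      then show ?thesis by (cases "H = H0") simp_all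
    qed
    then show ?thesis using fin H0(1) by simp
  qed
  moreover have "(\<Sum>H\<in>\<H>. \<Sum>K\<in>\<H>. (of_bool (H \<in> ?L) * of_bool (K = H0)) *s C H K) = (\<Sum>H\<in>?L. C H H0)"
  proof -
    have "(\<Sum>K\<in>\<H>. (of_bool (H \<in> ?L) * of_bool (K = H0)) *s C H K) = of_bool (H \<in> ?L) *s C H H0" for H
    proof -
      have "(\<Sum>K\<in>\<H>. (of_bool (H \<in> ?L) * of_bool (K = H0)) *s C H K) =
          (\<Sum>K\<in>\<H>. if K = H0 then of_bool (H \<in> ?L) *s C H H0 else 0)"
        by (intro sum.cong) auto
      then show ?thesis using fin H0(1) by simp
    qed
    moreover have "(\<Sum>H\<in>\<H>. of_bool (H \<in> ?L) *s C H H0) = (\<Sum>H\<in>?L. C H H0)"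
      by (rule sum.mono_neutral_cong_right) (use fin in auto)
    ultimately show ?thesis by (simp only:)
  qed
  ultimately have "(\<Sum>K\<in>?L. C H0 K) - (\<Sum>H\<in>?L. C H H0) = 0"
    by (simp add: vec.scale_left_diff_distrib sum_subtractf)
  then show ?thesis
    by (simp add: C_def sum_subtractf[symmetric] vec.scale_right_diff_distrib mult.commute[of "\<kappa> H0"])
qed

section \<open>Hermitian inner products\<close>

locale hermitian_product =
  fixes ip :: "complex ^ 'n::finite \<Rightarrow> complex ^ 'n \<Rightarrow> complex"
  assumes hermitian: "pos_def_hermitian ip"
begin

lemma ip_add_left: "ip (x + y) z = ip x z + ip y z"
  and ip_scale_left: "ip (c *s x) y = c * ip x y"
  and ip_swap: "ip y x = cnj (ip x y)"
  and ip_pos: "x \<noteq> 0 \<Longrightarrow> Re (ip x x) > 0"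
  using hermitian unfolding pos_def_hermitian_def by blast+

lemma ip_add_right: "ip x (y + z) = ip x y + ip x z"
  using ip_add_left[of y z x] by (simp add: ip_swap[of x])

lemma ip_scale_right: "ip x (c *s y) = cnj c * ip x y"
  using ip_scale_left[of c y x] by (simp add: ip_swap[of x])

lemma ip_zero_left [simp]: "ip 0 x = 0"
  using ip_scale_left[of 0 0 x] by simp

lemma ip_diff_left: "ip (x - y) z = ip x z - ip y z"
  using ip_add_left[of "x - y" y z] by simp

lemma ip_eq_0: "ip x x = 0 \<Longrightarrow> x = 0"
  using ip_pos[of x] by fastforce

lemma ip_0_swap: "ip x y = 0 \<Longrightarrow> ip y x = 0"
  using ip_swap[of x y] by simp

lemma ip_sum_left: "ip (\<Sum>i\<in>A. f i) y = (\<Sum>i\<in>A. ip (f i) y)"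
proof -
  interpret additive "\<lambda>x. ip x y" by standard (rule ip_add_left)
  show ?thesis by (rule sum)
qed

lemma ip_expand: "ip z y = (\<Sum>k\<in>UNIV. z $ k * ip (axis k 1) y)"
proof -
  have "ip z y = ip (\<Sum>k\<in>UNIV. (z $ k) *s axis k 1) y"
    by (simp add: basis_expansion)
  then show ?thesis by (simp add: ip_sum_left ip_scale_left)
qed

lemma ip_left_unique: "(\<And>z. ip z x = ip z y) \<Longrightarrow> x = y"
proof -
  assume *: "\<And>z. ip z x = ip z y"
  have "ip x z = ip y z" for z
    using *[of z] by (simp add: ip_swap[of _ z])
  then have "ip (x - y) (x - y) = 0"
    by (simp add: ip_diff_left)
  then show "x = y" using ip_eq_0 by fastforce
qed

lemma riesz:
  assumes "linear_equation H \<phi>"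
  shows "\<exists>n. \<forall>z. ip z n = \<phi> z"
proof -
  let ?T = "\<lambda>n. \<chi> k. ip n (axis k 1)"
  have lin: "Vector_Spaces.linear vector_scalar_mult vector_scalar_mult ?T"
    unfolding Vector_Spaces.linear_iff
    by (simp add: vec.vector_space_axioms vec_eq_iff ip_add_left ip_scale_left)
  have "inj ?T"
  proof (rule injI)
    fix x y
    assume xy: "?T x = ?T y"
    have "ip (axis k 1) x = ip (axis k 1) y" for k
    proof -
      have "ip x (axis k 1) = ip y (axis k 1)"
        using xy by (simp add: vec_eq_iff)
      then show ?thesis
        using ip_swap[of "axis k 1" x] ip_swap[of "axis k 1" y] by metis
    qed
    then have "ip z x = ip z y" for z
      unfolding ip_expand[of z x] ip_expand[of z y] by simp
    then show "x = y" by (rule ip_left_unique)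
  qed
  then have "surj ?T" using vec.linear_inj_imp_surj[OF lin] by blast
  from surjD[OF this, of "\<chi> k. cnj (\<phi> (axis k 1))"]
  obtain n where n: "(\<chi> k. cnj (\<phi> (axis k 1))) = ?T n" by blast
  have "ip z n = \<phi> z" for z
  proof -
    have "ip (axis k 1) n = \<phi> (axis k 1)" for k
    proof -
      have "ip n (axis k 1) = cnj (\<phi> (axis k 1))" using n by (simp add: vec_eq_iff)
      then show ?thesis using ip_swap[of "axis k 1" n] by simp
    qed
    then have "ip z n = (\<Sum>k\<in>UNIV. \<phi> ((z $ k) *s axis k 1))"
      by (simp add: ip_expand[of z] linear_equationD(2)[OF assms])
    also have "\<dots> = \<phi> (\<Sum>k\<in>UNIV. (z $ k) *s axis k 1)"
    proof -
      interpret additive \<phi> by standard (rule linear_equationD(1)[OF assms])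
      show ?thesis by (rule sum[symmetric])
    qed
    finally show ?thesis by (simp add: basis_expansion)
  qed
  then show ?thesis by blast
qed

lemma orth_proj_eq:
  assumes n: "n \<noteq> 0"
  shows "orth_proj ip {z. ip z n = 0} = (\<lambda>z. (ip z n / ip n n) *s n)"
  unfolding orth_proj_def
proof (rule the_equality)
  have nn: "ip n n \<noteq> 0" using ip_eq_0 n by blast
  show "Vector_Spaces.linear vector_scalar_mult vector_scalar_mult (\<lambda>z. (ip z n / ip n n) *s n) \<and>
      (\<lambda>z. (ip z n / ip n n) *s n) \<circ> (\<lambda>z. (ip z n / ip n n) *s n) = (\<lambda>z. (ip z n / ip n n) *s n) \<and>
      {z. (ip z n / ip n n) *s n = 0} = {z. ip z n = 0} \<and>
      (\<forall>z. \<forall>w\<in>{z. ip z n = 0}. ip ((ip z n / ip n n) *s n) w = 0)"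
    using nn n unfolding Vector_Spaces.linear_iff
    by (auto simp: vec.vector_space_axioms ip_add_left ip_scale_left add_divide_distrib
        vec.scale_left_distrib vec.scale_scale fun_eq_iff ip_0_swap)
  fix p
  assume p: "Vector_Spaces.linear vector_scalar_mult vector_scalar_mult p \<and> p \<circ> p = p \<and>
      {z. p z = 0} = {z. ip z n = 0} \<and> (\<forall>z. \<forall>w\<in>{z. ip z n = 0}. ip (p z) w = 0)"
  have add: "p (x + y) = p x + p y" and scale: "p (c *s x) = c *s p x" for x y c
    using p unfolding Vector_Spaces.linear_iff by auto
  interpret additive p by standard (rule add)
  have idem: "p (p z) = p z" for z using p by (metis comp_apply)
  have ker: "p z = 0 \<longleftrightarrow> ip z n = 0" for z using p by blast
  show "p = (\<lambda>z. (ip z n / ip n n) *s n)"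
  proof
    fix z
    let ?d = "p z - (ip z n / ip n n) *s n"
    have "p (z - p z) = 0" by (simp add: diff idem)
    then have "ip (z - p z) n = 0" using ker by blast
    then have d: "ip ?d n = 0" using nn by (simp add: ip_diff_left ip_scale_left)
    then have "ip (p z) ?d = 0" using p by blast
    moreover have "ip n ?d = 0" using d by (rule ip_0_swap)
    ultimately have "ip ?d ?d = 0" by (simp add: ip_diff_left ip_scale_left)
    then show "p z = (ip z n / ip n n) *s n" using ip_eq_0 by fastforce
  qed
qed

end

section \<open>Complexified mirrors\<close>

definition cvec :: "real ^ 'n \<Rightarrow> complex ^ 'n" where
  "cvec x = (\<chi> i. complex_of_real (x $ i))"

lemma cvec_simps: "cvec (x + y) = cvec x + cvec y" "cvec (x - y) = cvec x - cvec y"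
  "cvec (- x) = - cvec x" "cvec (r *\<^sub>R x) = complex_of_real r *s cvec x"
  by (simp_all add: cvec_def vec_eq_iff)

lemma cvec_eq_0: "cvec x = 0 \<longleftrightarrow> x = 0"
  by (simp add: cvec_def vec_eq_iff)

lemma cvec_0 [simp]: "cvec 0 = 0"
  by (simp add: cvec_eq_0)

lemma vec_Re_cvec [simp]: "vec_Re (cvec x) = x" and vec_Im_cvec [simp]: "vec_Im (cvec x) = 0"
  by (simp_all add: cvec_def vec_Re_def vec_Im_def vec_eq_iff)

lemma cvec_Re_Im: "z = cvec (vec_Re z) + \<i> *s cvec (vec_Im z)"
  by (simp add: cvec_def vec_Re_def vec_Im_def vec_eq_iff complex_eq_iff)

lemma vec_Re_Im_add: "vec_Re (x + y) = vec_Re x + vec_Re y" "vec_Im (x + y) = vec_Im x + vec_Im y"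
  by (simp_all add: vec_Re_def vec_Im_def vec_eq_iff)

lemma vec_Re_Im_scale: "vec_Re (c *s z) = Re c *\<^sub>R vec_Re z - Im c *\<^sub>R vec_Im z"
  "vec_Im (c *s z) = Re c *\<^sub>R vec_Im z + Im c *\<^sub>R vec_Re z"
  by (simp_all add: vec_Re_def vec_Im_def vec_eq_iff)

context finite_coxeter
begin

definition cform :: "real ^ 'n \<Rightarrow> complex ^ 'n \<Rightarrow> complex" where
  "cform c z = Complex (B c (vec_Re z)) (B c (vec_Im z))"

definition mirror :: "real ^ 'n \<Rightarrow> (complex ^ 'n) set" where
  "mirror c = {z. cform c z = 0}"

lemma cform_add_right: "cform c (x + y) = cform c x + cform c y"
  by (simp add: cform_def vec_Re_Im_add form_simps complex_eq_iff)

lemma cform_scale_right: "cform c (d *s z) = d * cform c z"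
  by (simp add: cform_def vec_Re_Im_scale form_simps complex_eq_iff)

lemma cform_diff_right: "cform c (x - y) = cform c x - cform c y"
  using cform_add_right[of c "x - y" y] by simp

lemma cform_add_left: "cform (c + d) z = cform c z + cform d z"
  by (simp add: cform_def form_simps complex_eq_iff)

lemma cform_scale_left: "cform (r *\<^sub>R c) z = complex_of_real r * cform c z"
  by (simp add: cform_def form_simps complex_eq_iff)

lemma cform_cvec: "cform c (cvec x) = complex_of_real (B c x)"
  by (simp add: cform_def form_simps complex_eq_iff)

lemma cform_nondegenerate: "(\<And>i. cform (e i) z = 0) \<Longrightarrow> z = 0"
proof -
  assume *: "\<And>i. cform (e i) z = 0"
  have "vec_Re z = 0" "vec_Im z = 0"
    using * by (auto intro!: B_nondegenerate simp: cform_def complex_eq_iff)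
  then show "z = 0"
    by (subst cvec_Re_Im[of z]) (simp add: cvec_eq_0)
qed

lemma linear_equation_mirror: "linear_equation (mirror c) (cform c)"
  unfolding linear_equation_def Vector_Spaces.linear_iff mirror_def
  by (simp add: vec.vector_space_axioms vector_space_over_itself.vector_space_axioms
      cform_add_right cform_scale_right)

lemma mirror_uminus: "mirror (- c) = mirror c"
  using cform_scale_left[of "- 1" c] by (simp add: mirror_def)

lemma mirror_inject:
  assumes "B b b = 1" "B c c = 1" "mirror b = mirror c"
  shows "c = b \<or> c = - b"
proof (rule unit_multiple[OF assms(1,2)])
  have "cvec (c - B b c *\<^sub>R b) \<in> mirror b"
    using assms(1) by (simp add: mirror_def cform_cvec form_simps)
  then have "cvec (c - B b c *\<^sub>R b) \<in> mirror c" using assms(3) by simp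
  then have "B c (c - B b c *\<^sub>R b) = 0" by (simp add: mirror_def cform_cvec)
  then show "(B b c)\<^sup>2 = 1"
    using assms(2) by (simp add: form_simps B_sym[of c b] power2_eq_square)
qed

lemma cform_complexify_act: "cform (act m w c) (complexify_map (act m w) z) = cform c z"
  by (simp add: cform_def complexify_map_def vec_Re_def vec_Im_def act_invariant)

lemma complexify_act_rev: "complexify_map (act m w) (complexify_map (act m (rev w)) z) = z"
  by (simp add: complexify_map_def vec_Re_def vec_Im_def vec_eq_iff)

lemma complexify_act_mirror: "complexify_map (act m w) ` mirror c = mirror (act m w c)"
proof
  show "complexify_map (act m w) ` mirror c \<subseteq> mirror (act m w c)"
    by (auto simp: mirror_def cform_complexify_act)
  show "mirror (act m w c) \<subseteq> complexify_map (act m w) ` mirror c"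
  proof
    fix z
    assume "z \<in> mirror (act m w c)"
    then have "complexify_map (act m (rev w)) z \<in> mirror c"
      using cform_complexify_act[of w c "complexify_map (act m (rev w)) z"]
      by (simp add: mirror_def complexify_act_rev)
    then show "z \<in> complexify_map (act m w) ` mirror c"
      by (intro image_eqI[of _ _ "complexify_map (act m (rev w)) z"]) (simp_all add: complexify_act_rev)
  qed
qed

definition plane :: "'n \<Rightarrow> 'n \<Rightarrow> (real ^ 'n) set" where
  "plane i j = {x *\<^sub>R e i + y *\<^sub>R e j | x y. True}"

text \<open>
  Because every root is positive or negative, a vector on the two walls \<open>i\<close> and \<open>j\<close> of the
  fundamental chamber and on no other is orthogonal to the roots in the plane of \<open>i\<close> and \<open>j\<close>
  only.
\<close>

lemma wall_point:
  assumes "i \<noteq> j"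
  obtains a where "\<And>d. d \<in> roots \<Longrightarrow> B d a = 0 \<longleftrightarrow> d \<in> plane i j"
proof -
  obtain a where a: "\<And>k. B a (e k) = (if k = i \<or> k = j then 0 else 1)"
    using prescribed_form_values[of "\<lambda>k. if k = i \<or> k = j then 0 else 1"] by blast
  have Ba: "B d a = (\<Sum>k\<in>- {i, j}. d $ k)" for d
  proof -
    have "B d a = (\<Sum>k\<in>UNIV. if k \<in> - {i, j} then d $ k else 0)"
      unfolding B_sym[of d a] form_expand[of a d] by (intro sum.cong) (auto simp: a)
    moreover have "- {i, j} = {k. k \<noteq> i \<and> k \<noteq> j}" by auto
    ultimately show ?thesis by (simp add: sum.If_cases)
  qed
  have "B d a = 0 \<longleftrightarrow> d \<in> plane i j" if d: "d \<in> roots" for d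
  proof
    assume "B d a = 0"
    then have 0: "(\<Sum>k\<in>- {i, j}. d $ k) = 0" "(\<Sum>k\<in>- {i, j}. - (d $ k)) = 0"
      by (simp_all add: Ba sum_negf)
    have "d $ k = 0" if "k \<notin> {i, j}" for k
      using root_nonneg[OF d]
    proof
      assume "nonneg d"
      then show "d $ k = 0"
        using sum_nonneg_eq_0_iff[of "- {i, j}" "\<lambda>k. d $ k"] 0(1) that by (auto simp: nonneg_def)
    next
      assume "nonneg (- d)"
      then show "d $ k = 0"
        using sum_nonneg_eq_0_iff[of "- {i, j}" "\<lambda>k. - (d $ k)"] 0(2) that by (auto simp: nonneg_def)
    qed
    then have "d = (d $ i) *\<^sub>R e i + (d $ j) *\<^sub>R e j"
      using support_expand[of "{i, j}" d] assms by simp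
    then show "d \<in> plane i j" unfolding plane_def by blast
  next
    assume "d \<in> plane i j"
    then obtain x y where "d = x *\<^sub>R e i + y *\<^sub>R e j" unfolding plane_def by blast
    then show "B d a = 0" using a[of i] a[of j] B_sym[of a] by (simp add: form_simps)
  qed
  then show ?thesis using that by blast
qed

lemma simple_form_bound: "i \<noteq> j \<Longrightarrow> (B (e i) (e j))\<^sup>2 < 1"
proof -
  assume "i \<noteq> j"
  then have "(e j - B (e i) (e j) *\<^sub>R e i) $ j = 1" by (simp add: axis_def)
  then have "e j - B (e i) (e j) *\<^sub>R e i \<noteq> 0" by (metis zero_index zero_neq_one)
  from form_pos[OF this] show ?thesis
    by (simp add: form_simps B_sym[of "e j" "e i"] power2_eq_square)
qed

text \<open>
  Reflecting a root in the plane with two positive coordinates must not produce coordinates of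
  opposite signs.
\<close>

lemma plane_roots:
  assumes ij: "i \<noteq> j" "m i j \<le> 4" and d: "d \<in> roots" "d \<in> plane i j"
  shows "d = e i \<or> d = - e i \<or> d = e j \<or> d = - e j \<or>
    d = reflection m (e i) (e j) \<or> d = - reflection m (e i) (e j) \<or> B (e i) d = 0"
proof -
  define g where "g = - 2 * B (e i) (e j)"
  have B1: "B (e i) (e j) = - g / 2" "B (e j) (e i) = - g / 2"
    using B_sym by (simp_all add: g_def)
  have signs: "x * y \<ge> 0" if "x *\<^sub>R e i + y *\<^sub>R e j \<in> roots" for x y
  proof -
    have "(x *\<^sub>R e i + y *\<^sub>R e j) $ i = x" "(x *\<^sub>R e i + y *\<^sub>R e j) $ j = y"
      using ij(1) by (simp_all add: axis_def)
    then show ?thesis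
      using root_nonneg[OF that] unfolding nonneg_def
      by (metis mult_nonneg_nonneg mult_nonpos_nonpos neg_0_le_iff_le vector_uminus_component)
  qed
  obtain x y where xy: "d = x *\<^sub>R e i + y *\<^sub>R e j" using d(2) unfolding plane_def by blast
  have ri: "reflection m (e i) (x *\<^sub>R e i + y *\<^sub>R e j) = (g * y - x) *\<^sub>R e i + y *\<^sub>R e j" for x y
    by (simp add: reflection_def form_simps B1 vec_eq_iff algebra_simps)
  have rj: "reflection m (e j) (x *\<^sub>R e i + y *\<^sub>R e j) = x *\<^sub>R e i + (g * x - y) *\<^sub>R e j" for x y
    by (simp add: reflection_def form_simps B1 vec_eq_iff algebra_simps)
  have root_r: "reflection m (e k) c \<in> roots" if "c \<in> roots" for k c
    using act_root[OF that, of "[k]"] by (simp add: act_Cons)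
  have unit: "x * x + y * y - g * (x * y) = 1"
    using root_unit[OF d(1)] unfolding xy by (simp add: form_simps B1 algebra_simps)
  have Bd: "B (e i) d = x - g * y / 2"
    unfolding xy by (simp add: form_simps B1)
  have rij: "reflection m (e i) (e j) = g *\<^sub>R e i + e j"
    using ri[of 0 1] by simp
  have s0: "0 \<le> x * y" using signs d(1) xy by blast
  have s1: "0 \<le> (g * y - x) * y" using signs root_r[OF d(1), of i] unfolding xy ri by blast
  have s2: "0 \<le> x * (g * x - y)" using signs root_r[OF d(1), of j] unfolding xy rj by blast
  have "(g * y - x) *\<^sub>R e i + (g * (g * y - x) - y) *\<^sub>R e j \<in> roots"
    using root_r[OF root_r[OF d(1), of i], of j] unfolding xy ri rj .
  from signs[OF this] have s3: "0 \<le> (g * y - x) * (g * (g * y - x) - y)" .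
  have pm: "z = 1 \<or> z = -1" if "z * z = 1" for z :: real
    using that by (simp add: square_eq_1_iff)
  show ?thesis
  proof (cases "y = 0 \<or> x = 0")
    case True
    then show ?thesis
    proof
      assume "y = 0"
      then show ?thesis using pm[of x] unit unfolding xy by auto
    next
      assume "x = 0"
      then show ?thesis using pm[of y] unit unfolding xy by auto
    qed
  next
    case False
    have sgn: "x * y > 0" using s0 False by (simp add: less_le)
    consider "m i j = 2" | "m i j = 3" | "m i j = 4" using m_ge_2[OF ij(1)] ij(2) by linarith
    then have "x = g * y \<or> g * y = 2 * x"
    proof cases
      case 1
      then have "g = 0" using B_commuting by (simp add: g_def)
      then show ?thesis using s1 sgn by simp
    next
      case 2
      then have g: "g = 1" using B_eq_3 by (simp add: g_def)
      have "x * x = x * y"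
      proof (rule ccontr)
        assume ne: "x * x \<noteq> x * y"
        then have "x \<noteq> y" by auto
        have "(y - x) * y \<ge> 0" "x * (x - y) \<ge> 0" using s1 s2 by (simp_all add: g)
        then have "((y - x) * y) * (x * (x - y)) \<ge> 0" by (rule mult_nonneg_nonneg)
        then have "- ((x * y) * ((x - y) * (x - y))) \<ge> 0" by (simp add: algebra_simps)
        moreover have "(x - y) * (x - y) > 0"
          using \<open>x \<noteq> y\<close> by (metis not_real_square_gt_zero right_minus_eq)
        then have "(x * y) * ((x - y) * (x - y)) > 0" by (rule mult_pos_pos[OF sgn])
        ultimately show False by simp
      qed
      then show ?thesis using False g by simp
    next
      case 3
      then have g: "g = sqrt 2" using B_eq_4 by (simp add: g_def)
      have gg: "g * g = 2" by (simp add: g)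
      have gz: "g * (g * z) = 2 * z" for z using gg by (simp add: mult.assoc[symmetric])
      have e3: "0 \<le> (g * y - x) * (y - g * x)"
        using s3 by (simp add: algebra_simps gz)
      show ?thesis
      proof (rule ccontr)
        assume "\<not> ?thesis"
        then have n1: "g * y - x \<noteq> 0" and "g * y \<noteq> 2 * x" by auto
        have n2: "y - g * x \<noteq> 0"
        proof
          assume "y - g * x = 0"
          then have "g * y = g * (g * x)" by simp
          then show False using \<open>g * y \<noteq> 2 * x\<close> by (simp add: gz)
        qed
        have "((g * y - x) * y) * (x * (g * x - y)) \<ge> 0" using s1 s2 by (rule mult_nonneg_nonneg)
        then have "- ((x * y) * ((g * y - x) * (y - g * x))) \<ge> 0" by (simp add: algebra_simps)
        moreover have "(g * y - x) * (y - g * x) > 0" using e3 n1 n2 by (simp add: less_le)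
        ultimately show False using mult_pos_pos[OF sgn] by fastforce
      qed
    qed
    then show ?thesis
    proof
      assume x: "x = g * y"
      then have "y * y = 1" using unit by (simp add: algebra_simps)
      moreover have "d = y *\<^sub>R reflection m (e i) (e j)"
        unfolding xy rij x by (simp add: algebra_simps)
      ultimately show ?thesis using pm[of y] by auto
    next
      assume "g * y = 2 * x"
      then show ?thesis using Bd by simp
    qed
  qed
qed


lemma simple_in_plane: "e i \<in> plane i j" "e j \<in> plane i j"
proof -
  have "e i = 1 *\<^sub>R e i + 0 *\<^sub>R e j" "e j = 0 *\<^sub>R e i + 1 *\<^sub>R e j" by simp_all
  then show "e i \<in> plane i j" "e j \<in> plane i j" unfolding plane_def by blast+
qed

end

section \<open>The Dunkl conditions in codimension two\<close>

locale dunkl_coxeter = finite_coxeter m + hermitian_product ip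
  for m :: "'n::finite \<Rightarrow> 'n \<Rightarrow> nat" and ip +
  fixes \<kappa> :: "(complex ^ 'n) set \<Rightarrow> complex"
  assumes kappa_nonzero: "c \<in> roots \<Longrightarrow> \<kappa> (mirror c) \<noteq> 0"
    and flat: "dunkl_flat (mirror ` roots) ip \<kappa>"
begin

text \<open>
  The vector that represents the linear form \<open>cform c\<close>, hence is orthogonal to the mirror of \<open>c\<close>
  for the given inner product.
\<close>

definition normal :: "real ^ 'n \<Rightarrow> complex ^ 'n" where
  "normal c = (SOME n. \<forall>z. ip z n = cform c z)"

lemma ip_normal: "ip z (normal c) = cform c z"
  unfolding normal_def using someI_ex[OF riesz[OF linear_equation_mirror]] by blast

lemma normal_add: "normal (c + d) = normal c + normal d"
  by (rule ip_left_unique) (simp add: ip_normal ip_add_right cform_add_left)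

lemma normal_scale: "normal (r *\<^sub>R c) = complex_of_real r *s normal c"
  by (rule ip_left_unique) (simp add: ip_normal ip_scale_right cform_scale_left)

lemma normal_eq_0: "normal c = 0 \<Longrightarrow> c = 0"
  using ip_normal[of "cvec c" c] ip_scale_right[of "cvec c" 0 0] B_eq_0[of c] by (simp add: cform_cvec)

lemma root_nonzero: "c \<in> roots \<Longrightarrow> c \<noteq> 0"
  using root_unit[of c] by (auto simp: form_simps)

lemma proj_mirror:
  assumes "c \<noteq> 0"
  shows "orth_proj ip (mirror c) z = (cform c z / cform c (normal c)) *s normal c"
proof -
  have "normal c \<noteq> 0" using normal_eq_0 assms by blast
  from orth_proj_eq[OF this] show ?thesis
    by (simp add: ip_normal mirror_def)
qed

lemma cform_normal_nonzero: "c \<noteq> 0 \<Longrightarrow> cform c (normal c) \<noteq> 0"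
  using ip_eq_0[of "normal c"] normal_eq_0[of c] by (auto simp: ip_normal)

lemma linear_proj_mirror:
  assumes "c \<noteq> 0"
  shows "Vector_Spaces.linear vector_scalar_mult vector_scalar_mult (orth_proj ip (mirror c))"
  unfolding Vector_Spaces.linear_iff
  by (simp add: vec.vector_space_axioms proj_mirror[OF assms] cform_add_right cform_scale_right
      add_divide_distrib vec.scale_left_distrib vec.scale_scale)

text \<open>
  The residue is taken at the image \<open>a\<close> of a wall point, which lies on the mirrors of the roots in
  the plane only. Of these mirrors, \<open>H0\<close> alone contains the vector \<open>b\<close>, which corresponds to the
  vector of the plane orthogonal to \<open>e i\<close>.
\<close>

lemma plane_residue:
  fixes w :: "'n list"
  assumes ij: "i \<noteq> j"
  defines "H0 \<equiv> mirror (act m w (e i))"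
  shows "(\<Sum>H\<in>mirror ` act m w ` (roots \<inter> plane i j) - {H0}. (\<kappa> H0 * \<kappa> H) *s
    (orth_proj ip H0 (orth_proj ip H u) - orth_proj ip H (orth_proj ip H0 u))) = 0"
proof -
  obtain a where a: "\<And>d. d \<in> roots \<Longrightarrow> B d a = 0 \<longleftrightarrow> d \<in> plane i j"
    using wall_point[OF ij] by blast
  define b where "b = e j - B (e i) (e j) *\<^sub>R e i"
  let ?a = "cvec (act m w a)" and ?b = "cvec (act m w b)" and ?q = "cvec (act m w (e i))"
  have mem: "cvec (act m w x) \<in> mirror c \<longleftrightarrow> B (act m (rev w) c) x = 0" for x c
    using act_adjoint[of "rev w" c x] by (simp add: mirror_def cform_cvec)
  have H0: "cvec (act m w x) \<in> H0 \<longleftrightarrow> B (e i) x = 0" for x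
    unfolding H0_def mem by simp
  have in_plane: "cvec (act m w a) \<in> mirror c \<longleftrightarrow> act m (rev w) c \<in> plane i j" if "c \<in> roots" for c
    unfolding mem using a[OF act_root[OF that]] .
  have set: "{H \<in> mirror ` roots. ?a \<in> H} = mirror ` act m w ` (roots \<inter> plane i j)"
  proof
    show "{H \<in> mirror ` roots. ?a \<in> H} \<subseteq> mirror ` act m w ` (roots \<inter> plane i j)"
    proof
      fix H
      assume "H \<in> {H \<in> mirror ` roots. ?a \<in> H}"
      then obtain c where c: "c \<in> roots" "H = mirror c" "?a \<in> mirror c" by blast
      then have "act m (rev w) c \<in> roots \<inter> plane i j" using in_plane act_root by blast
      moreover have "H = mirror (act m w (act m (rev w) c))" using c by simp
      ultimately show "H \<in> mirror ` act m w ` (roots \<inter> plane i j)" by blast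
    qed
    show "mirror ` act m w ` (roots \<inter> plane i j) \<subseteq> {H \<in> mirror ` roots. ?a \<in> H}"
      using act_root in_plane by auto
  qed
  have "(\<Sum>H\<in>{H \<in> mirror ` roots. ?a \<in> H} - {H0}. (\<kappa> H0 * \<kappa> H) *s
    (orth_proj ip H0 (orth_proj ip H u) - orth_proj ip H (orth_proj ip H0 u))) = 0"
  proof (rule dunkl_residue[OF _ flat])
    show "finite (mirror ` roots)" using finite_roots by simp
    show "linear_equation H (cform (SOME c. c \<in> roots \<and> mirror c = H))" if "H \<in> mirror ` roots" for H
    proof -
      have "\<exists>c. c \<in> roots \<and> mirror c = H" using that by blast
      from someI_ex[OF this] show ?thesis using linear_equation_mirror by metis
    qed
    show "Vector_Spaces.linear vector_scalar_mult vector_scalar_mult (orth_proj ip H)"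
      if "H \<in> mirror ` roots" for H
      using that linear_proj_mirror root_nonzero by blast
    show "H0 \<in> mirror ` roots" using root_act by (simp add: H0_def)
    show "?a \<in> H0" using H0 a[of "e i"] simple_in_plane(1) by simp
    show "?b \<in> H0" using H0 by (simp add: b_def form_simps)
    show "?q \<notin> H0" using H0 by simp
    fix H
    assume "H \<in> mirror ` roots" "?a \<in> H" and ne: "H \<noteq> H0"
    then obtain c where c: "c \<in> roots" "H = mirror c" "act m (rev w) c \<in> plane i j"
      using in_plane by blast
    then obtain x y where xy: "act m (rev w) c = x *\<^sub>R e i + y *\<^sub>R e j" unfolding plane_def by blast
    show "?b \<notin> H"
    proof
      assume "?b \<in> H"
      then have "B (x *\<^sub>R e i + y *\<^sub>R e j) b = 0" using mem c(2) xy by simp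
      then have "y * (1 - (B (e i) (e j))\<^sup>2) = 0"
        by (simp add: b_def form_simps B_sym[of "e j" "e i"] algebra_simps power2_eq_square)
      then have "y = 0" using simple_form_bound[OF ij] by simp
      then have xe: "act m (rev w) c = x *\<^sub>R e i" using xy by simp
      then have "x * x = 1"
        using root_unit[OF act_root[OF c(1), of "rev w"]] by (simp add: form_simps)
      then have "x = 1 \<or> x = -1" by (simp add: square_eq_1_iff)
      moreover have "c = x *\<^sub>R act m w (e i)" using arg_cong[OF xe, of "act m w"] by (simp add: act_simps)
      ultimately show False using ne c(2) mirror_uminus by (auto simp: H0_def)
    qed
  qed
  then show ?thesis unfolding set .
qed

section \<open>The inner product is determined\<close>

text \<open>
  If only two mirrors contain their intersection, the flatness condition says that their
  projections commute.
\<close>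

lemma strongly_orth_normal:
  assumes "strongly_orth b c"
  shows "cform b (normal c) = 0"
proof (rule ccontr)
  assume nz: "cform b (normal c) \<noteq> 0"
  obtain w i k where ik: "m i k = 2" and b: "b = act m w (e i)" and c: "c = act m w (e k)"
    using assms unfolding strongly_orth_def by blast
  have ne: "i \<noteq> k" using ik by auto
  have root: "b \<in> roots" "c \<in> roots" using b c root_act by auto
  have orth: "B b c = 0" using ik B_commuting by (simp add: b c act_invariant)
  have sub: "roots \<inter> plane i k \<subseteq> {e i, - e i, e k, - e k}"
  proof
    fix d
    assume "d \<in> roots \<inter> plane i k"
    then obtain x y where d: "d \<in> roots" "d = x *\<^sub>R e i + y *\<^sub>R e k" unfolding plane_def by blast
    have "reflection m (e i) (e k) = e k" using ik B_commuting by (simp add: reflection_def)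
    moreover have "d = e k \<or> d = - e k" if "B (e i) d = 0"
    proof -
      have "x = 0" using that ik B_commuting unfolding d(2) by (simp add: form_simps)
      moreover from this have "y * y = 1" using root_unit[OF d(1)] unfolding d(2) by (simp add: form_simps)
      ultimately show ?thesis unfolding d(2) by (auto simp: square_eq_1_iff)
    qed
    ultimately show "d \<in> {e i, - e i, e k, - e k}"
      using plane_roots[OF ne _ d(1)] ik d(2) unfolding plane_def by auto
  qed
  have "mirror b \<noteq> mirror c"
  proof
    assume "mirror b = mirror c"
    then have "c = b \<or> c = - b" using mirror_inject[OF root_unit root_unit] root by blast
    then show False using orth root_unit[OF root(1)] by (auto simp: form_simps)
  qed
  then have "mirror ` act m w ` (roots \<inter> plane i k) - {mirror b} = {mirror c}"
  proof -
    have "e k \<in> roots \<inter> plane i k" by (simp add: simple_in_plane)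
    then have "mirror c \<in> mirror ` act m w ` (roots \<inter> plane i k)" using c by blast
    moreover have "mirror ` act m w ` (roots \<inter> plane i k) \<subseteq> {mirror b, mirror c}"
      using sub mirror_uminus by (auto simp: b c act_simps)
    ultimately show ?thesis using \<open>mirror b \<noteq> mirror c\<close> by blast
  qed
  with plane_residue[OF ne, of w "normal c"]
  have "(\<kappa> (mirror b) * \<kappa> (mirror c)) *s (orth_proj ip (mirror b) (orth_proj ip (mirror c) (normal c)) -
      orth_proj ip (mirror c) (orth_proj ip (mirror b) (normal c))) = 0"
    by (simp add: b)
  then have "orth_proj ip (mirror b) (orth_proj ip (mirror c) (normal c)) =
      orth_proj ip (mirror c) (orth_proj ip (mirror b) (normal c))"
    using kappa_nonzero[OF root(1)] kappa_nonzero[OF root(2)] by simp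
  moreover have "orth_proj ip (mirror c) (normal c) = normal c"
    using cform_normal_nonzero root root_nonzero by (simp add: proj_mirror)
  ultimately obtain r s where "r *s normal b = s *s normal c" and r: "r \<noteq> 0"
    using nz cform_normal_nonzero[OF root_nonzero[OF root(1)]] root root_nonzero
    by (simp add: proj_mirror)
  then have "cnj r * cform b z = cnj s * cform c z" for z
    using ip_scale_right[of z r "normal b"] ip_scale_right[of z s "normal c"] by (simp add: ip_normal)
  from this[of "cvec b"] show False
    using r orth root_unit[OF root(1)] B_sym[of c b] by (simp add: cform_cvec)
qed

text \<open>
  The hermitian form \<open>\<langle>n\<^sub>x, n\<^sub>i\<rangle>\<close> vanishes for the roots \<open>x\<close> strongly orthogonal to \<open>e i\<close>, hence on the
  orthogonal complement of \<open>e i\<close>, so it is \<open>B (e i) x\<close> times a constant. By symmetry the constants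
  agree along the edges of the diagram.
\<close>

lemma hermitian_multiple:
  assumes span: "\<And>i x. B (e i) x = 0 \<Longrightarrow> x \<in> span {c. strongly_orth (e i) c}"
  obtains c where "c \<noteq> 0" "\<And>x. normal x = c *s cvec x"
proof -
  define C where "C i = cform (e i) (normal (e i))" for i
  have form: "cform (e i) (normal x) = complex_of_real (B (e i) x) * C i" for i x
  proof -
    let ?y = "x - B (e i) x *\<^sub>R e i"
    let ?S = "{x. cform (e i) (normal x) = 0}"
    have "subspace ?S"
      unfolding subspace_def
      using normal_scale[of 0 0] cform_scale_right[of "e i" 0 "normal 0"]
      by (simp add: normal_add normal_scale cform_add_right cform_scale_right)
    moreover have "{c. strongly_orth (e i) c} \<subseteq> ?S" using strongly_orth_normal by blast
    ultimately have "span {c. strongly_orth (e i) c} \<subseteq> ?S" by (intro span_minimal)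
    moreover have "B (e i) ?y = 0" by (simp add: form_simps)
    ultimately have "cform (e i) (normal ?y) = 0" using span by blast
    moreover have "normal x = normal ?y + complex_of_real (B (e i) x) *s normal (e i)"
      using normal_add[of ?y "B (e i) x *\<^sub>R e i"] by (simp add: normal_scale)
    ultimately show ?thesis by (simp add: cform_add_right cform_scale_right C_def)
  qed
  have C_real: "cnj (C i) = C i" for i
    using ip_swap[of "normal (e i)" "normal (e i)"] by (simp add: C_def ip_normal)
  have C_adj: "C i = C j" if "adj i j" for i j
  proof -
    have "cform (e i) (normal (e j)) = cnj (cform (e j) (normal (e i)))"
      using ip_swap[of "normal (e i)" "normal (e j)"] by (simp add: ip_normal)
    then have "complex_of_real (B (e i) (e j)) * C i = complex_of_real (B (e i) (e j)) * C j"
      unfolding form by (simp add: C_real B_sym[of "e j"])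
    moreover have "B (e i) (e j) \<noteq> 0" using B_adj[OF that] by auto
    ultimately show ?thesis by simp
  qed
  obtain i0 :: 'n where True by simp
  have C: "C i = C i0" for i
  proof -
    have "\<forall>i\<in>UNIV. C i = C i0"
      by (rule grow_induct[of "\<lambda>T. \<forall>i\<in>T. C i = C i0" "{i0}"]) (use C_adj in auto)
    then show ?thesis by simp
  qed
  show ?thesis
  proof
    show "C i0 \<noteq> 0" unfolding C_def using cform_normal_nonzero[of "e i0"] root_nonzero[of "e i0"] by simp
    fix x
    have "cform (e i) (normal x - C i0 *s cvec x) = 0" for i
      using form[of i x] C[of i] by (simp add: cform_diff_right cform_scale_right cform_cvec)
    then have "normal x - C i0 *s cvec x = 0" by (rule cform_nondegenerate)
    then show "normal x = C i0 *s cvec x" by simp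
  qed
qed

end

section \<open>Invariance for a multiple of the Coxeter form\<close>

text \<open>
  The inner product is from now on the hermitian extension of the Coxeter form, up to the
  constant \<open>c\<close>.
\<close>

locale dunkl_coxeter_scaled = dunkl_coxeter m ip \<kappa>
  for m :: "'n::finite \<Rightarrow> 'n \<Rightarrow> nat" and ip and \<kappa> +
  fixes c :: complex
  assumes c_nonzero: "c \<noteq> 0" and normal_eq: "\<And>x. normal x = c *s cvec x"
    and rank: "CARD('n) \<ge> 3"
begin

lemma ip_cvec: "ip z (cvec x) = cform x z / cnj c"
  using ip_normal[of z x] c_nonzero by (simp add: normal_eq ip_scale_right field_simps)

theorem ip_invariant:
  "ip (complexify_map (act m w) y) (complexify_map (act m w) z) = ip y z"
proof -
  have ip: "ip y z = (cform (vec_Re z) y - \<i> * cform (vec_Im z) y) / cnj c" for y z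
  proof -
    have "ip y z = ip y (cvec (vec_Re z) + \<i> *s cvec (vec_Im z))"
      by (simp only: cvec_Re_Im[symmetric])
    then show ?thesis
      by (simp add: ip_add_right ip_scale_right ip_cvec diff_divide_distrib)
  qed
  have "vec_Re (complexify_map (act m w) z) = act m w (vec_Re z)"
    "vec_Im (complexify_map (act m w) z) = act m w (vec_Im z)"
    by (simp_all add: complexify_map_def vec_Re_def vec_Im_def vec_eq_iff)
  then show ?thesis
    by (simp add: ip[of "complexify_map (act m w) y"] ip[of y] cform_complexify_act)
qed

lemma proj_root:
  assumes "d \<in> roots"
  shows "orth_proj ip (mirror d) z = cform d z *s cvec d"
proof -
  have "cform d (normal d) = c"
    using root_unit[OF assms] by (simp add: normal_eq cform_scale_right cform_cvec)
  then show ?thesis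
    using c_nonzero proj_mirror[OF root_nonzero[OF assms], of z]
    by (simp add: normal_eq vec.scale_scale)
qed

text \<open>
  For labels 3 and 4 the residue relation in the plane of \<open>i\<close> and \<open>j\<close>, evaluated at the first
  root, involves only the mirror of the second root and its reflection: for label 4 there is a
  fourth mirror, but it is that of a root orthogonal to the first one.
\<close>

lemma kappa_step_le_4:
  assumes "m i j \<le> 4"
  shows "\<kappa> (mirror (act m w (reflection m (e i) (e j)))) = \<kappa> (mirror (act m w (e j)))"
proof -
  consider "i = j" | "m i j = 2" | "i \<noteq> j" "m i j = 3 \<or> m i j = 4"
    using m_ge_2[of i j] assms by linarith
  then show ?thesis
  proof cases
    case 1
    have "reflection m (e i) (e i) = - e i" by (simp add: reflection_def vec_eq_iff)
    then show ?thesis using 1 by (simp add: act_simps mirror_uminus)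
  next
    case 2
    then show ?thesis using B_commuting by (simp add: reflection_def)
  next
    case 3
    define g where "g = B (e i) (e j)"
    have g0: "g \<noteq> 0" using 3(2) B_eq_3 B_eq_4 by (auto simp: g_def)
    have g1: "g\<^sup>2 < 1" using simple_form_bound[OF 3(1)] by (simp add: g_def)
    define r where "r = reflection m (e i) (e j)"
    have r: "r = e j - (2 * g) *\<^sub>R e i" by (simp add: r_def reflection_def g_def)
    have r_root: "r \<in> roots" using root_act[of "[i]" j] by (simp add: r_def act_Cons)
    let ?H0 = "mirror (act m w (e i))" and ?H1 = "mirror (act m w (e j))" and ?H2 = "mirror (act m w r)"
    have ij: "B (e j) (e i) = g" "B (e i) (e j) = g" "B r (e i) = - g" "B (e j) r = 1 - 2 * g\<^sup>2"
      "B (e i) r = - g"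
      using B_sym[of "e j" "e i"] by (simp_all add: r form_simps g_def power2_eq_square)
    have unit: "B (act m w d) (act m w d) = 1" if "d \<in> roots" for d
      using root_unit[OF that] by (simp add: act_invariant)
    have ne: "mirror (act m w d) \<noteq> mirror (act m w d')"
      if "d \<in> roots" "d' \<in> roots" "(B d d')\<^sup>2 \<noteq> 1" for d d'
      using mirror_inject[OF unit[OF that(1)] unit[OF that(2)]] that(3) root_unit[OF that(1)]
        act_inject[of w d' d] act_inject[of w d' "- d"]
      by (auto simp: act_simps form_simps)
    have H01: "?H0 \<noteq> ?H1" and H02: "?H0 \<noteq> ?H2"
      using ne[of "e i" "e j"] ne[of "e i" r] r_root g1 ij by auto
    have "1 - 2 * g\<^sup>2 \<noteq> 1" "1 - 2 * g\<^sup>2 \<noteq> - 1" using g0 g1 by auto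
    then have H12: "?H1 \<noteq> ?H2"
      using ne[of "e j" r] r_root ij by (auto simp: power2_eq_1_iff)
    let ?L = "mirror ` act m w ` (roots \<inter> plane i j) - {?H0}"
    define F where "F H = (\<kappa> ?H0 * \<kappa> H) *s (orth_proj ip ?H0 (orth_proj ip H (cvec (act m w (e i)))) -
      orth_proj ip H (orth_proj ip ?H0 (cvec (act m w (e i)))))" for H
    have F: "F (mirror (act m w d)) = (\<kappa> ?H0 * \<kappa> (mirror (act m w d))) *s
        cvec (act m w (B d (e i) *\<^sub>R (B d (e i) *\<^sub>R e i - d)))" if "d \<in> roots" for d
      using that act_root[OF that, of w] root_act[of w i] B_sym[of "e i" d]
      by (simp add: F_def proj_root cform_cvec cform_scale_right act_invariant act_simps cvec_simps
          vec.scale_right_diff_distrib vec.scale_scale)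
    have zero: "F H = 0" if H: "H \<in> ?L - {?H1, ?H2}" for H
    proof -
      obtain d where d: "d \<in> roots" "d \<in> plane i j" "H = mirror (act m w d)" using H by blast
      have nd: "mirror (act m w d) \<noteq> ?H0" "mirror (act m w d) \<noteq> ?H1" "mirror (act m w d) \<noteq> ?H2"
        using H d(3) by simp_all
      have neg: "mirror (act m w (- x)) = mirror (act m w x)" for x
        by (simp add: act_simps mirror_uminus)
      have "d \<noteq> e i" "d \<noteq> - e i" "d \<noteq> e j" "d \<noteq> - e j" "d \<noteq> r" "d \<noteq> - r"
        using nd neg by metis+
      then have "B (e i) d = 0"
        using plane_roots[OF 3(1) assms d(1,2)] unfolding r_def by blast
      then show ?thesis using F[OF d(1)] d(3) B_sym[of d "e i"] by (simp add: act_simps)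
    qed
    have "{?H1, ?H2} \<subseteq> ?L"
    proof -
      have "e j = 0 *\<^sub>R e i + 1 *\<^sub>R e j" "r = (- 2 * g) *\<^sub>R e i + 1 *\<^sub>R e j" by (simp_all add: r)
      then have "e j \<in> roots \<inter> plane i j" "r \<in> roots \<inter> plane i j"
        using r_root simple_root unfolding plane_def by blast+
      then show ?thesis using H01 H02 by blast
    qed
    moreover have "finite ?L" using finite_roots by auto
    ultimately have "(\<Sum>H\<in>?L. F H) = (\<Sum>H\<in>{?H1, ?H2}. F H)"
      using zero by (intro sum.mono_neutral_right) auto
    moreover have "(\<Sum>H\<in>?L. F H) = 0"
      unfolding F_def using plane_residue[OF 3(1)] .
    ultimately have "F ?H1 + F ?H2 = 0" using H12 by simp
    moreover have "F ?H1 = (\<kappa> ?H0 * \<kappa> ?H1) *s cvec (act m w (g *\<^sub>R (g *\<^sub>R e i - e j)))"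
      using F[of "e j"] ij by simp
    moreover have "F ?H2 = - (\<kappa> ?H0 * \<kappa> ?H2) *s cvec (act m w (g *\<^sub>R (g *\<^sub>R e i - e j)))"
    proof -
      have "B r (e i) *\<^sub>R (B r (e i) *\<^sub>R e i - r) = - (g *\<^sub>R (g *\<^sub>R e i - e j))"
        unfolding ij unfolding r by (simp add: vec_eq_iff algebra_simps)
      then show ?thesis using F[OF r_root] by (simp add: act_simps cvec_simps)
    qed
    ultimately have "(\<kappa> ?H0 * (\<kappa> ?H1 - \<kappa> ?H2)) *s cvec (act m w (g *\<^sub>R (g *\<^sub>R e i - e j))) = 0"
      by (simp add: right_diff_distrib vec.scale_left_diff_distrib)
    moreover have "cvec (act m w (g *\<^sub>R (g *\<^sub>R e i - e j))) \<noteq> 0"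
    proof
      assume "cvec (act m w (g *\<^sub>R (g *\<^sub>R e i - e j))) = 0"
      then have "act m w (g *\<^sub>R (g *\<^sub>R e i - e j)) = act m w 0"
        by (simp only: cvec_eq_0 linear_0[OF linear_act])
      then have "g *\<^sub>R (g *\<^sub>R e i - e j) = 0" by (rule act_inject)
      then have "(g *\<^sub>R e i - e j) $ j = 0" using g0 by simp
      then show False using 3(1) by (simp add: axis_def)
    qed
    moreover have "\<kappa> ?H0 \<noteq> 0" using kappa_nonzero root_act by blast
    ultimately show ?thesis by (simp add: r_def)
  qed
qed

definition kap :: "'n list \<Rightarrow> 'n \<Rightarrow> complex" where
  "kap w j = \<kappa> (mirror (act m w (e j)))"

lemma kap_eq: "act m v (e i) = e j \<Longrightarrow> kap (w @ v) i = kap w j"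
  by (simp add: kap_def act_append)

lemma kap_step_le_4: "m i j \<le> 4 \<Longrightarrow> kap (w @ [i]) j = kap w j"
  using kappa_step_le_4 by (simp add: kap_def act_append act_Cons)

lemma kap_label_3:
  assumes "m j l = 3"
  shows "kap w j = kap w l"
proof -
  have "j \<noteq> l" using assms by auto
  have "act m [j, l] (e j) = e l"
    using act_alternating_label[OF \<open>j \<noteq> l\<close>] assms by (simp add: eval_nat_numeral)
  then have "kap w l = kap ((w @ [j]) @ [l]) j" using kap_eq[of "[j, l]" j l w] by simp
  also have "\<dots> = kap (w @ [j]) j" using kap_step_le_4[of l j "w @ [j]"] assms m_sym[of l j] by simp
  also have "\<dots> = kap w j" using kap_step_le_4[of j j w] by simp
  finally show ?thesis by simp
qed

text \<open>
  An edge with label 5 has a neighbouring edge with label 3, which links the roots of one of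
  its nodes to a root commuting with the other node.
\<close>

lemma kap_label_5:
  assumes ij: "m i j = 5" and jl: "m j l = 3" "l \<noteq> i"
  shows "kap (w @ [i]) j = kap w j" "kap (w @ [j]) i = kap w i"
proof -
  have "adj i j" "adj j l" using ij jl by (auto simp: adj_def)
  then have "m i l = 2" using no_triangle jl(2) by blast
  have 1: "kap (w @ [i]) j = kap w j" for w
  proof -
    have "kap (w @ [i]) j = kap (w @ [i]) l" by (rule kap_label_3[OF jl(1)])
    also have "\<dots> = kap w l" using kap_step_le_4[of i l w] \<open>m i l = 2\<close> by simp
    also have "\<dots> = kap w j" by (rule kap_label_3[OF jl(1), symmetric])
    finally show ?thesis .
  qed
  have 2: "kap (w @ [j]) j = kap w j" for w using kap_step_le_4[of j j w] by simp
  have 3: "kap (w @ u) j = kap w j" if "set u \<subseteq> {i, j}" for u w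
    using that
  proof (induction u rule: rev_induct)
    case (snoc x u)
    then show ?case using 1[of "w @ u"] 2[of "w @ u"] by auto
  qed simp
  have "i \<noteq> j" using ij by auto
  have 4: "kap w i = kap w j" for w
  proof -
    have "act m (alternating j i 4) (e j) = e i"
      using act_alternating_label[of j i] ij m_sym[of j i] \<open>i \<noteq> j\<close> by simp
    then have "kap w i = kap (w @ alternating j i 4) j" by (rule kap_eq[symmetric])
    also have "\<dots> = kap w j" using 3[of "alternating j i 4" w] set_alternating[of j i 4] by blast
    finally show ?thesis .
  qed
  show "kap (w @ [i]) j = kap w j" by (rule 1)
  show "kap (w @ [j]) i = kap w i" using 4[of "w @ [j]"] 4[of w] 2[of w] by simp
qed

lemma kap_step: "kap (w @ [i]) j = kap w j"
proof (cases "m i j \<le> 4")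
  case True
  then show ?thesis by (rule kap_step_le_4)
next
  case False
  then have ij: "adj i j" "m i j \<ge> 5" by (auto simp: adj_def)
  obtain k l where l: "k \<in> {i, j}" "l \<notin> {i, j}" "adj k l"
    using edge_has_neighbour[OF rank] by blast
  from l(1) consider "k = j" | "k = i" by blast
  then show ?thesis
  proof cases
    case 1
    then have "adj j l" "i \<noteq> l" using l by auto
    then have "m i j = 5" "m j l = 3"
      using path_3_labels[OF ij(1)] ij(2) by force+
    then show ?thesis using kap_label_5(1) \<open>i \<noteq> l\<close> by blast
  next
    case 2
    then have "adj i l" "j \<noteq> l" using l by auto
    then have "m j i = 5" "m i l = 3"
      using path_3_labels[OF adj_sym[OF ij(1)]] ij(2) m_sym[of i j] by force+
    then show ?thesis using kap_label_5(2) \<open>j \<noteq> l\<close> by blast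
  qed
qed

theorem kappa_invariant:
  assumes "d \<in> roots"
  shows "\<kappa> (complexify_map (act m w) ` mirror d) = \<kappa> (mirror d)"
proof -
  have kap: "kap v j = kap [] j" for v j
    by (induction v rule: rev_induct) (simp_all add: kap_step)
  obtain v j where "d = act m v (e j)" using assms by (auto simp: roots_def)
  then show ?thesis
    using kap[of "w @ v" j] kap[of v j] by (simp add: complexify_act_mirror kap_def act_append)
qed

end

section \<open>Finite Coxeter groups\<close>

text \<open>
  Averaging the standard inner product over the group gives an invariant one, for which the
  simple roots are orthogonal to the mirrors of their reflections. On each simple root it is
  therefore proportional to the Coxeter form, and by irreducibility the factors agree.
\<close>

lemma finite_group_form_pos:
  fixes m :: "'n::finite \<Rightarrow> 'n \<Rightarrow> nat"
  assumes matrix: "coxeter_matrix m" and irr: "coxeter_irreducible m"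
    and fin: "finite (range (act m))" and x: "x \<noteq> 0"
  shows "coxeter_form m x x > 0"
proof -
  let ?B = "coxeter_form m"
  define avg where "avg y z = (\<Sum>f\<in>range (act m). f y \<bullet> f z)" for y z
  have m_diag: "m i i = 1" and m_sym: "m i j = m j i" for i j
    using matrix by (auto simp: coxeter_matrix_def)
  have B_diag: "?B (e i) (e i) = 1" for i by (simp add: form_axis m_diag)
  have bilin: "avg y (z + z') = avg y z + avg y z'" "avg (z + z') y = avg z y + avg z' y"
    "avg y (r *\<^sub>R z) = r * avg y z" "avg (r *\<^sub>R z) y = r * avg z y" for y z z' r
    unfolding avg_def sum_distrib_left sum.distrib[symmetric]
    by (auto intro!: sum.cong simp: act_simps inner_add_left inner_add_right)
  have avg_sym: "avg y z = avg z y" for y z by (simp add: avg_def inner_commute)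
  have pos: "avg y y > 0" if "y \<noteq> 0" for y
  proof -
    have "act m [] y \<bullet> act m [] y > 0" using that by simp
    then show ?thesis
      unfolding avg_def by (intro sum_pos2[OF fin, of "act m []"]) auto
  qed
  have invol: "reflection m (e i) (reflection m (e i) y) = y" for i y
    by (simp add: reflection_def form_simps B_diag)
  have inv: "avg (reflection m (e i) y) (reflection m (e i) z) = avg y z" for i y z
  proof -
    have mem: "f \<circ> reflection m (e i) \<in> range (act m)" if "f \<in> range (act m)" for f
    proof -
      obtain w where "f = act m w" using \<open>f \<in> range (act m)\<close> by blast
      then have "f \<circ> reflection m (e i) = act m (w @ [i])"
        by (simp add: fun_eq_iff act_append act_Cons)
      then show ?thesis by simp
    qed
    show ?thesis
      unfolding avg_def
      by (rule sum.reindex_bij_witness[of _ "\<lambda>f. f \<circ> reflection m (e i)" "\<lambda>f. f \<circ> reflection m (e i)"])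
        (simp_all add: mem, simp_all add: fun_eq_iff invol)
  qed
  define q where "q i = avg (e i) (e i)" for i
  have q_pos: "q i > 0" for i
  proof -
    have "e i \<noteq> (0 :: real ^ 'n)" by (simp add: axis_eq_0_iff)
    then show ?thesis unfolding q_def by (rule pos)
  qed
  have key: "avg (e i) y = q i * ?B (e i) y" for i y
  proof -
    have "reflection m (e i) y = y + (- 2 * ?B (e i) y) *\<^sub>R e i"
      "reflection m (e i) (e i) = (-1) *\<^sub>R e i"
      by (simp_all add: reflection_def B_diag vec_eq_iff)
    then have "avg (e i) y = avg ((-1) *\<^sub>R e i) (y + (- 2 * ?B (e i) y) *\<^sub>R e i)"
      using inv[of i "e i" y] by simp
    also have "\<dots> = - (avg (e i) y + - 2 * ?B (e i) y * q i)"
      by (simp only: bilin q_def mult_minus1)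
    finally show ?thesis by simp
  qed
  have edge: "q i = q j" if "i \<noteq> j" "m i j \<noteq> 2" for i j
  proof -
    have "q i * ?B (e i) (e j) = q j * ?B (e i) (e j)"
      by (metis key avg_sym form_axis m_sym)
    moreover have "?B (e i) (e j) \<noteq> 0"
    proof (cases "m i j = 0")
      case False
      then have "m i j \<ge> 3" using that matrix unfolding coxeter_matrix_def
        by (metis One_nat_def Suc_1 Suc_leI less_one linorder_neqE_nat not_less_eq numeral_3_eq_3)
      then have "pi / real (m i j) < pi / 2" by (intro divide_strict_left_mono) auto
      moreover have "0 < pi / real (m i j)" using False by simp
      ultimately have "cos (pi / real (m i j)) > 0" by (intro cos_gt_zero)
      then show ?thesis by (simp add: form_axis)
    qed (simp add: form_axis)
    ultimately show ?thesis by simp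
  qed
  obtain i0 :: 'n where True by simp
  have q: "q i = q i0" for i
  proof -
    have "(i0, i) \<in> {(k, l). k \<noteq> l \<and> m k l \<noteq> 2}\<^sup>*" using irr by (simp add: coxeter_irreducible_def)
    then show ?thesis by (induction rule: rtrancl_induct) (use edge in auto)
  qed
  have key_const: "avg (e i) y = q i0 * ?B (e i) y" for i y
    using key[of i y] q[of i] by metis
  have sum_avg: "avg (\<Sum>i\<in>A. f i) y = (\<Sum>i\<in>A. avg (f i) y)" for A and f :: "'n \<Rightarrow> real ^ 'n" and y
  proof -
    interpret additive "\<lambda>z. avg z y" by standard (rule bilin(2))
    show ?thesis by (rule sum)
  qed
  have "avg x x = avg (\<Sum>i\<in>UNIV. (x $ i) *\<^sub>R e i) x" by (simp add: vec_expand[symmetric])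
  also have "\<dots> = q i0 * (\<Sum>i\<in>UNIV. x $ i * ?B (e i) x)"
    by (simp add: sum_avg bilin key_const sum_distrib_left ac_simps)
  also have "(\<Sum>i\<in>UNIV. x $ i * ?B (e i) x) = ?B (\<Sum>i\<in>UNIV. (x $ i) *\<^sub>R e i) x"
    by (simp add: form_sum_left form_scale_left)
  also have "\<dots> = ?B x x" by (simp add: vec_expand[symmetric])
  finally show ?thesis using pos[OF x] q_pos[of i0] by (simp add: zero_less_mult_iff)
qed

lemma word_prod_closed:
  assumes "group G" "range s \<subseteq> carrier G"
  shows "word_prod G s w \<in> carrier G"
proof -
  interpret group G by fact
  show ?thesis using assms(2) by (induction w) (auto simp: word_prod_def)
qed

lemma representation_word_prod:
  assumes "reflection_representation G s m \<rho>" "group G" "range s \<subseteq> carrier G"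
  shows "\<rho> (word_prod G s w) = act m w"
proof (induction w)
  case Nil
  then show ?case using assms(1) by (simp add: reflection_representation_def word_prod_def fun_eq_iff)
next
  case (Cons i w)
  have "word_prod G s (i # w) = s i \<otimes>\<^bsub>G\<^esub> word_prod G s w" by (simp add: word_prod_def)
  moreover have "s i \<in> carrier G" "word_prod G s w \<in> carrier G"
    using assms(3) word_prod_closed[OF assms(2,3)] by auto
  ultimately have "\<rho> (word_prod G s (i # w)) = \<rho> (s i) \<circ> \<rho> (word_prod G s w)"
    using assms(1) by (simp add: reflection_representation_def)
  moreover have "\<rho> (s i) x = reflection m (e i) x" for x
    using assms(1) by (simp add: reflection_representation_def reflection_def)
  ultimately show ?case by (simp add: fun_eq_iff Cons act_Cons)
qed

lemma representation_range:
  assumes "coxeter_system G s m" "reflection_representation G s m \<rho>"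
  shows "\<rho> ` carrier G = range (act m)"
proof -
  have G: "group G" "range s \<subseteq> carrier G" and gen: "\<And>g. g \<in> carrier G \<Longrightarrow> \<exists>w. g = word_prod G s w"
    using assms(1) by (auto simp: coxeter_system_def)
  note word = representation_word_prod[OF assms(2) G]
  show ?thesis
  proof
    show "\<rho> ` carrier G \<subseteq> range (act m)" using gen word by blast
    show "range (act m) \<subseteq> \<rho> ` carrier G"
      using word word_prod_closed[OF G] by (metis image_eqI image_subsetI)
  qed
qed

context finite_coxeter
begin

lemma dim_form_hyperplane:
  assumes "c \<noteq> 0"
  shows "dim {x. B c x = 0} = CARD('n) - 1"
proof -
  define v where "v = (\<chi> k. B c (e k))"
  have v: "B c x = v \<bullet> x" for x
    unfolding form_expand[of c x] v_def by (simp add: inner_vec_def mult.commute)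
  have "v \<noteq> 0" using form_pos[OF assms] v[of c] by auto
  from dim_hyperplane[OF this] show ?thesis by (simp add: v)
qed

lemma form_hyperplane_complexify: "complexify_set {x. B c x = 0} = mirror c"
  by (auto simp: complexify_set_def mirror_def cform_def complex_eq_iff)

lemma reflection_fixes: "c \<noteq> 0 \<Longrightarrow> reflection m c x = x \<longleftrightarrow> B c x = 0"
  by (simp add: reflection_def)

text \<open>
  For an involution preserving the form, a vector \<open>y - f y\<close> is orthogonal to the fixed points,
  which by their dimension make up the whole orthogonal complement.
\<close>

lemma is_reflection_act:
  assumes "is_reflection (act m w)"
  obtains c where "c \<in> roots" "act m w = reflection m c"
proof -
  let ?f = "act m w" and ?F = "{x. act m w x = x}"
  have invol: "?f (?f x) = x" and dimF: "dim ?F = CARD('n) - 1" for x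
    using assms by (auto simp: is_reflection_def fun_eq_iff)
  have "?F \<noteq> UNIV"
  proof
    assume "?F = UNIV"
    then have "CARD('n) = CARD('n) - 1" using dimF by simp
    moreover have "CARD('n) > 0" by simp
    ultimately show False by linarith
  qed
  then obtain y where y: "?f y \<noteq> y" by blast
  define d where "d = y - ?f y"
  have "d \<noteq> 0" and fd: "?f d = - d" using y by (simp_all add: d_def act_simps invol)
  define c where "c = (1 / sqrt (B d d)) *\<^sub>R d"
  have Bd: "B d d > 0" using form_pos[OF \<open>d \<noteq> 0\<close>] .
  have unit: "B c c = 1" using Bd by (simp add: c_def form_simps)
  then have "c \<noteq> 0" by (auto simp: form_simps)
  have fc: "?f c = - c" by (simp add: c_def act_simps fd)
  have "?F \<subseteq> {x. B c x = 0}"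
  proof
    fix x
    assume "x \<in> ?F"
    then have "B c x = - B c x" using act_invariant[of w c x] fc by (simp add: form_simps)
    then show "x \<in> {x. B c x = 0}" by simp
  qed
  moreover have "subspace ?F" by (simp add: subspace_def act_simps)
  moreover have "subspace {x. B c x = 0}" by (simp add: subspace_def form_simps)
  ultimately have F: "?F = {x. B c x = 0}"
    using subspace_dim_equal[of ?F "{x. B c x = 0}"] dimF dim_form_hyperplane[OF \<open>c \<noteq> 0\<close>] by simp
  have "?f x = reflection m c x" for x
  proof -
    have "x - B c x *\<^sub>R c \<in> {x. B c x = 0}" using unit by (simp add: form_simps)
    then have "?f (x - B c x *\<^sub>R c) = x - B c x *\<^sub>R c" using F by blast
    then have "?f x + B c x *\<^sub>R c = x - B c x *\<^sub>R c" by (simp add: act_simps fc)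
    then have "?f x = x - B c x *\<^sub>R c - B c x *\<^sub>R c" by (metis add_diff_cancel_right')
    then show ?thesis by (simp add: reflection_def vec_eq_iff)
  qed
  then have "?f = reflection m c" by blast
  then show ?thesis using that reflection_root[OF unit] by blast
qed

lemma root_reflection:
  assumes "c \<in> roots"
  obtains w where "act m w = reflection m c" "is_reflection (act m w)"
proof -
  obtain v i where c: "c = act m v (e i)" using assms by (auto simp: roots_def)
  let ?w = "v @ [i] @ rev v"
  have "act m ?w x = reflection m c x" for x
    using act_reflection[of v "e i" "act m (rev v) x"] by (simp add: c act_append act_Cons)
  then have w: "act m ?w = reflection m c" by blast
  have "c \<noteq> 0" using root_unit[OF assms] by (auto simp: form_simps)
  have "is_reflection (act m ?w)"
    unfolding is_reflection_def w using root_unit[OF assms]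
    by (simp add: linear_reflection fun_eq_iff reflection_fixes[OF \<open>c \<noteq> 0\<close>] dim_form_hyperplane[OF \<open>c \<noteq> 0\<close>])
  then show ?thesis using w that by blast
qed

lemma reflection_hyperplanes_eq:
  assumes "\<rho> ` carrier G = range (act m)"
  shows "reflection_hyperplanes G \<rho> = mirror ` roots"
proof
  have fixed: "complexify_set {x. reflection m c x = x} = mirror c" if "c \<in> roots" for c
  proof -
    have "c \<noteq> 0" using root_unit[OF that] by (auto simp: form_simps)
    then show ?thesis by (simp add: reflection_fixes form_hyperplane_complexify)
  qed
  show "reflection_hyperplanes G \<rho> \<subseteq> mirror ` roots"
  proof
    fix H
    assume "H \<in> reflection_hyperplanes G \<rho>"
    then obtain g where g: "g \<in> carrier G" "is_reflection (\<rho> g)" "H = complexify_set {x. \<rho> g x = x}"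
      unfolding reflection_hyperplanes_def by blast
    then obtain w where w: "\<rho> g = act m w" using assms by blast
    then obtain c where "c \<in> roots" "act m w = reflection m c"
      using is_reflection_act[of w] g(2) by metis
    then show "H \<in> mirror ` roots" using g(3) w fixed by simp
  qed
  show "mirror ` roots \<subseteq> reflection_hyperplanes G \<rho>"
  proof
    fix H
    assume "H \<in> mirror ` roots"
    then obtain c where c: "c \<in> roots" "H = mirror c" by blast
    obtain w where w: "act m w = reflection m c" "is_reflection (act m w)"
      using root_reflection[OF c(1)] by blast
    have "act m w \<in> \<rho> ` carrier G" using assms by blast
    then obtain g where g: "g \<in> carrier G" "act m w = \<rho> g" by blast
    have "H = complexify_set {x. \<rho> g x = x}" using fixed[OF c(1)] c(2) w(1) g(2) by simp
    then show "H \<in> reflection_hyperplanes G \<rho>"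
      unfolding reflection_hyperplanes_def using g w(2) by auto
  qed
qed

end

section \<open>Invariance of Dunkl systems\<close>

theorem proposition2p28:
  fixes G :: "('a, 'b) monoid_scheme"
    and s :: "'n::finite \<Rightarrow> 'a"
    and m :: "'n \<Rightarrow> 'n \<Rightarrow> nat"
    and \<rho> :: "'a \<Rightarrow> real ^ 'n \<Rightarrow> real ^ 'n"
    and ip :: "complex ^ 'n \<Rightarrow> complex ^ 'n \<Rightarrow> complex"
    and \<kappa> :: "(complex ^ 'n) set \<Rightarrow> complex"
  assumes "coxeter_system G s m"
    and "finite (carrier G)"
    and "coxeter_irreducible m"
    and "CARD('n) \<ge> 3"
    and "\<not> of_coxeter_type m cox_A"
    and "\<not> of_coxeter_type m cox_B"
    and "reflection_representation G s m \<rho>"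
    and "dunkl_system (reflection_hyperplanes G \<rho>) ip \<kappa>"
  shows "dunkl_invariant G (\<lambda>g. complexify_map (\<rho> g)) (reflection_hyperplanes G \<rho>) ip \<kappa>"
proof -
  have range: "\<rho> ` carrier G = range (act m)"
    using representation_range assms(1,7) .
  have matrix: "coxeter_matrix m" using assms(1) by (simp add: coxeter_system_def)
  have fin: "finite (range (act m))" using assms(2) range by (metis finite_imageI)
  interpret finite_coxeter m
    using matrix assms(3) finite_group_form_pos[OF matrix assms(3) fin] fin by unfold_locales
  have hyps: "reflection_hyperplanes G \<rho> = mirror ` roots"
    using reflection_hyperplanes_eq[OF range] .
  interpret dunkl_coxeter m ip \<kappa>
    using assms(8) unfolding hyps by unfold_locales (auto simp: dunkl_system_def)
  obtain c where c: "c \<noteq> 0" "\<And>x. normal x = c *s cvec x"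
    using hermitian_multiple strongly_orth_span[OF assms(4-6)] by blast
  interpret dunkl_coxeter_scaled m ip \<kappa> c
    using c assms(4) by unfold_locales
  have rep: "\<exists>w. \<rho> g = act m w" if "g \<in> carrier G" for g
    using range that by blast
  show ?thesis
    unfolding dunkl_invariant_def hyps
  proof (intro conjI ballI allI)
    show "ip (complexify_map (\<rho> g) x) (complexify_map (\<rho> g) y) = ip x y" if "g \<in> carrier G" for g x y
      using rep[OF that] ip_invariant by metis
    show "\<kappa> (complexify_map (\<rho> g) ` H) = \<kappa> H" if "g \<in> carrier G" "H \<in> mirror ` roots" for g H
      using rep[OF that(1)] that(2) kappa_invariant by auto
  qed
qed

end
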